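(* Let $1<p<\infty$, let $E$ be a UMD space, let $i,j\ge 0$ be integers, and let $S^{ij}$ be an operator-valued dyadic shift on $\mathbb{R}^d$ with parameters $i$ and $j$, associated with operator-valued kernels $(a_K)_{K\in\mathcal{D}}$ whose family of values is $R$-bounded with constant $\mathcal{R}_p(\{a\})$. Then for all $f\in L^p(\mathbb{R}^d;E)$, $$\|S^{ij}f\|_{L^p(\mathbb{R}^d;E)}\le 4\,(\max\{i,j\}+1)\,\mathcal{R}_p(\{a\})\,\beta_p(E)^2\,\|f\|_{L^p(\mathbb{R}^d;E)}.$$
   Context: $\mathcal{D}$ is a system of dyadic cubes of $\mathbb{R}^d$, with Lebesgue measure; $\ell(I)$ is the side length of $I$, and $\langle f\rangle_I=\frac1{|I|}\int_I f\,dx$. UMD constant: $E$ is UMD if there is a finite (least) constant $\beta_p(E)$ with $\|\sum_{n=1}^N\epsilon_n d_n\|_{L^p(E)}\le\beta_p(E)\|\sum_{n=1}^N d_n\|_{L^p(E)}$ for all $E$-valued $L^p$-martingale difference sequences $(d_n)_{n=1}^N$ and all signs $\epsilon_n\in\{-1,+1\}$. $R$-bound: for $\mathcal{T}\subseteq\mathcal{L}(E)$, $\mathcal{R}_p(\mathcal{T})$ is the least constant such that $(\mathbb{E}|\sum_{n=1}^N\varepsilon_nT_ne_n|_E^p)^{1/p}\le\mathcal{R}_p(\mathcal{T})(\mathbb{E}|\sum_{n=1}^N\varepsilon_ne_n|_E^p)^{1/p}$ for all $N$, $T_n\in\mathcal{T}$, $e_n\in E$, where $\varepsilon_n$ are independent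 unbiased random signs. Haar projections: $D_If=\sum_{I'\in\mathrm{child}(I)}\langle f\rangle_{I'}1_{I'}-\langle f\rangle_I1_I$, where $\mathrm{child}(I)$ is the set of dyadic children of $I$; and $D_K^if=\sum_{I\in\mathcal{D}:\,I\subseteq K,\ \ell(I)=2^{-i}\ell(K)}D_If$. Operator-valued dyadic shift with parameters $i,j$: $f\mapsto\sum_{K\in\mathcal{D}}D_K^jA_KD_K^if$, where $A_Kf(x)=\frac{1_K(x)}{|K|}\int_Ka_K(x,x')f(x')\,dx'$ and the (strongly measurable) kernels $a_K:\mathbb{R}^d\times\mathbb{R}^d\to\mathcal{L}(E)$ satisfy $\mathcal{R}_p(\{a_K(x,x'):K\in\mathcal{D},x\in K,x'\in K\})\le\mathcal{R}_p(\{a\})<\infty$. The sum over $K$ is understood as the limit in $L^p(\mathbb{R}^d;E)$ of its finite partial sums. *)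

theory Defs
  imports "HOL-Probability.Probability"
begin

section \<open>Strong measurability, Bochner integral and \<open>L\<^sup>p\<close> norm in an arbitrary Banach space\<close>

text \<open>
  The library's \<^const>\<open>has_bochner_integral\<close> and \<^const>\<open>integrable\<close> are restricted to second countable
  target spaces. The following definitions are the same ones for an arbitrary Banach space;
  Borel measurability is replaced by strong measurability, i.e. being an almost everywhere limit
  of simple functions.
\<close>

definition strongly_measurable :: "'a measure \<Rightarrow> ('a \<Rightarrow> 'e::real_normed_vector) \<Rightarrow> bool" where
  "strongly_measurable M f \<longleftrightarrow>
     (\<exists>s. (\<forall>n. simple_function M (s n)) \<and> (AE x in M. (\<lambda>n. s n x) \<longlonglongrightarrow> f x))"

definition has_strong_integral :: "'a measure \<Rightarrow> ('a \<Rightarrow> 'e::real_normed_vector) \<Rightarrow> 'e \<Rightarrow> bool" where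
  "has_strong_integral M f v \<longleftrightarrow>
     strongly_measurable M f \<and>
     (\<exists>s. (\<forall>n. Bochner_Integration.simple_bochner_integrable M (s n)) \<and>
          (\<lambda>n. \<integral>\<^sup>+x. ennreal (norm (f x - s n x)) \<partial>M) \<longlonglongrightarrow> 0 \<and>
          (\<lambda>n. Bochner_Integration.simple_bochner_integral M (s n)) \<longlonglongrightarrow> v)"

definition strong_integral :: "'a measure \<Rightarrow> ('a \<Rightarrow> 'e::real_normed_vector) \<Rightarrow> 'e" where
  "strong_integral M f =
     (if \<exists>v. has_strong_integral M f v then THE v. has_strong_integral M f v else 0)"

definition set_strong_integral :: "'a measure \<Rightarrow> 'a set \<Rightarrow> ('a \<Rightarrow> 'e::real_normed_vector) \<Rightarrow> 'e" where
  "set_strong_integral M A f = strong_integral M (\<lambda>x. indicator A x *\<^sub>R f x)"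

definition in_Lp :: "'a measure \<Rightarrow> real \<Rightarrow> ('a \<Rightarrow> 'e::real_normed_vector) \<Rightarrow> bool" where
  "in_Lp M p f \<longleftrightarrow>
     strongly_measurable M f \<and> (\<integral>\<^sup>+x. ennreal (norm (f x) powr p) \<partial>M) < \<infinity>"

definition Lp_norm :: "'a measure \<Rightarrow> real \<Rightarrow> ('a \<Rightarrow> 'e::real_normed_vector) \<Rightarrow> real" where
  "Lp_norm M p f = enn2real (\<integral>\<^sup>+x. ennreal (norm (f x) powr p) \<partial>M) powr (1 / p)"

text \<open>
  Unconditional sum in \<open>L\<^sup>p\<close>: the limit of the net of finite partial sums. The distance is taken in
  the extended nonnegative reals, so that convergence cannot hold because a norm is infinite.
\<close>

definition has_Lp_sum ::
  "'a measure \<Rightarrow> real \<Rightarrow> ('i \<Rightarrow> 'a \<Rightarrow> 'e::real_normed_vector) \<Rightarrow> ('a \<Rightarrow> 'e) \<Rightarrow> 'i set \<Rightarrow> bool" where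
  "has_Lp_sum M p g S A \<longleftrightarrow>
     in_Lp M p S \<and>
     ((\<lambda>F. \<integral>\<^sup>+x. ennreal (norm ((\<Sum>i\<in>F. g i x) - S x) powr p) \<partial>M) \<longlongrightarrow> 0)
       (finite_subsets_at_top A)"

section \<open>The UMD constant\<close>

text \<open>
  \<open>d 1, \<dots>, d N\<close> is an \<open>L\<^sup>p\<close>-martingale difference sequence with respect to the filtration
  \<open>F 1 \<subseteq> \<dots> \<subseteq> F N\<close>. The last clause is \<open>\<bbbE>[d (n + 1) | F n] = 0\<close>, spelled out because the library's
  conditional expectation is real-valued only. There is no condition on the mean of \<open>d 1\<close>.
\<close>

definition martingale_differences ::
  "'w measure \<Rightarrow> real \<Rightarrow> (nat \<Rightarrow> 'w measure) \<Rightarrow> nat \<Rightarrow> (nat \<Rightarrow> 'w \<Rightarrow> 'e::real_normed_vector) \<Rightarrow> bool"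
where
  "martingale_differences M p F N d \<longleftrightarrow>
     (\<forall>n\<in>{1..N}. subalgebra M (F n)) \<and>
     (\<forall>m\<in>{1..N}. \<forall>n\<in>{m..N}. sets (F m) \<subseteq> sets (F n)) \<and>
     (\<forall>n\<in>{1..N}. in_Lp M p (d n) \<and> strongly_measurable (restr_to_subalg M (F n)) (d n)) \<and>
     (\<forall>n\<in>{1..<N}. \<forall>A\<in>sets (F n). set_strong_integral M A (d (Suc n)) = 0)"

text \<open>
  A definition cannot quantify over all types of sample points, so the probability spaces range
  over those (with arbitrary \<open>\<sigma>\<close>-algebra) on sets of real sequences. This is no loss
  of generality: a finite martingale difference sequence has values in a separable closed subspace
  (up to a null set), which is a Polish space and so Borel isomorphic to a subset of the
  sequence space, and one may pass to the joint distribution with its natural filtration.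
\<close>

definition UMD_bound :: "'e::banach itself \<Rightarrow> real \<Rightarrow> real \<Rightarrow> bool" where
  "UMD_bound _ p \<beta> \<longleftrightarrow>
     0 \<le> \<beta> \<and>
     (\<forall>(M :: (nat \<Rightarrow> real) measure) F N (d :: nat \<Rightarrow> (nat \<Rightarrow> real) \<Rightarrow> 'e) (\<epsilon> :: nat \<Rightarrow> real).
        prob_space M \<longrightarrow> martingale_differences M p F N d \<longrightarrow> (\<forall>n\<in>{1..N}. \<epsilon> n \<in> {-1, 1}) \<longrightarrow>
        Lp_norm M p (\<lambda>\<omega>. \<Sum>n=1..N. \<epsilon> n *\<^sub>R d n \<omega>) \<le> \<beta> * Lp_norm M p (\<lambda>\<omega>. \<Sum>n=1..N. d n \<omega>))"

definition UMD :: "'e::banach itself \<Rightarrow> real \<Rightarrow> bool" where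
  "UMD E p \<longleftrightarrow> (\<exists>\<beta>. UMD_bound E p \<beta>)"

definition UMD_const :: "'e::banach itself \<Rightarrow> real \<Rightarrow> real" where
  "UMD_const E p = Inf {\<beta>. UMD_bound E p \<beta>}"

section \<open>\<open>R\<close>-bounds\<close>

text \<open>The coordinates of \<open>random_signs N\<close> with index in \<open>{1..N}\<close> are independent unbiased signs.\<close>

definition random_signs :: "nat \<Rightarrow> (nat \<Rightarrow> real) pmf" where
  "random_signs N = Pi_pmf {1..N} 0 (\<lambda>_. pmf_of_set {-1, 1})"

definition R_bound :: "real \<Rightarrow> ('e::banach \<Rightarrow>\<^sub>L 'e) set \<Rightarrow> real \<Rightarrow> bool" where
  "R_bound p \<T> C \<longleftrightarrow>
     0 \<le> C \<and>
     (\<forall>N (T :: nat \<Rightarrow> 'e \<Rightarrow>\<^sub>L 'e) (e :: nat \<Rightarrow> 'e). (\<forall>n\<in>{1..N}. T n \<in> \<T>) \<longrightarrow>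
        measure_pmf.expectation (random_signs N)
          (\<lambda>\<epsilon>. norm (\<Sum>n=1..N. \<epsilon> n *\<^sub>R blinfun_apply (T n) (e n)) powr p) powr (1 / p)
        \<le> C * measure_pmf.expectation (random_signs N)
                (\<lambda>\<epsilon>. norm (\<Sum>n=1..N. \<epsilon> n *\<^sub>R e n) powr p) powr (1 / p))"

definition R_bounded :: "real \<Rightarrow> ('e::banach \<Rightarrow>\<^sub>L 'e) set \<Rightarrow> bool" where
  "R_bounded p \<T> \<longleftrightarrow> (\<exists>C. R_bound p \<T> C)"

definition R_const :: "real \<Rightarrow> ('e::banach \<Rightarrow>\<^sub>L 'e) set \<Rightarrow> real" where
  "R_const p \<T> = Inf {C. R_bound p \<T> C}"

section \<open>Dyadic cubes and Haar projections\<close>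

definition half_open_cube :: "real ^ 'd \<Rightarrow> real \<Rightarrow> (real ^ 'd) set" where
  "half_open_cube a l = {x. \<forall>i. a $ i \<le> x $ i \<and> x $ i < a $ i + l}"

text \<open>
  \<open>G k\<close> is the generation of cubes of side length \<open>2\<^sup>-\<^sup>k\<close>. The standard dyadic system and all
  its (random) shifts are included.
\<close>

definition dyadic_system :: "(real ^ 'd) set set \<Rightarrow> bool" where
  "dyadic_system \<D> \<longleftrightarrow>
     (\<exists>G :: int \<Rightarrow> (real ^ 'd) set set.
        \<D> = (\<Union>k. G k) \<and>
        (\<forall>k. partition_on UNIV (G k)) \<and>
        (\<forall>k. \<forall>Q\<in>G k. \<exists>a. Q = half_open_cube a (2 powi (- k))) \<and>
        (\<forall>k. \<forall>Q\<in>G (k + 1). \<exists>P\<in>G k. Q \<subseteq> P))"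

definition side_length :: "(real ^ 'd) set \<Rightarrow> real" where
  "side_length Q = (THE l. 0 < l \<and> (\<exists>a. Q = half_open_cube a l))"

definition children :: "(real ^ 'd) set set \<Rightarrow> (real ^ 'd) set \<Rightarrow> (real ^ 'd) set set" where
  "children \<D> I = {J \<in> \<D>. J \<subseteq> I \<and> side_length J = side_length I / 2}"

definition average :: "(real ^ 'd) set \<Rightarrow> (real ^ 'd \<Rightarrow> 'e::banach) \<Rightarrow> 'e" where
  "average I f = (1 / measure lebesgue I) *\<^sub>R set_strong_integral lebesgue I f"

definition haar_proj ::
  "(real ^ 'd) set set \<Rightarrow> (real ^ 'd) set \<Rightarrow> (real ^ 'd \<Rightarrow> 'e::banach) \<Rightarrow> real ^ 'd \<Rightarrow> 'e" where
  "haar_proj \<D> I f x =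
     (\<Sum>J\<in>children \<D> I. indicator J x *\<^sub>R average J f) - indicator I x *\<^sub>R average I f"

definition haar_proj_level ::
  "(real ^ 'd) set set \<Rightarrow> nat \<Rightarrow> (real ^ 'd) set \<Rightarrow> (real ^ 'd \<Rightarrow> 'e::banach) \<Rightarrow> real ^ 'd \<Rightarrow> 'e" where
  "haar_proj_level \<D> i K f x =
     (\<Sum>I\<in>{I \<in> \<D>. I \<subseteq> K \<and> side_length I = side_length K / 2 ^ i}. haar_proj \<D> I f x)"

section \<open>Operator-valued dyadic shifts\<close>

definition averaging_op ::
  "((real ^ 'd) set \<Rightarrow> real ^ 'd \<Rightarrow> real ^ 'd \<Rightarrow> 'e::banach \<Rightarrow>\<^sub>L 'e) \<Rightarrow> (real ^ 'd) set \<Rightarrow>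
   (real ^ 'd \<Rightarrow> 'e) \<Rightarrow> real ^ 'd \<Rightarrow> 'e" where
  "averaging_op a K f x =
     (indicator K x / measure lebesgue K) *\<^sub>R
       set_strong_integral lebesgue K (\<lambda>x'. blinfun_apply (a K x x') (f x'))"

text \<open>Strong measurability of an operator-valued kernel is understood in the strong operator topology.\<close>

definition strongly_measurable_kernel ::
  "(real ^ 'd \<Rightarrow> real ^ 'd \<Rightarrow> 'e::banach \<Rightarrow>\<^sub>L 'e) \<Rightarrow> bool" where
  "strongly_measurable_kernel k \<longleftrightarrow>
     (\<forall>e. strongly_measurable (lebesgue :: ((real ^ 'd) \<times> (real ^ 'd)) measure)
            (\<lambda>z. blinfun_apply (k (fst z) (snd z)) e))"

definition kernel_values ::
  "(real ^ 'd) set set \<Rightarrow> ((real ^ 'd) set \<Rightarrow> real ^ 'd \<Rightarrow> real ^ 'd \<Rightarrow> 'e::banach \<Rightarrow>\<^sub>L 'e) \<Rightarrow>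
   ('e \<Rightarrow>\<^sub>L 'e) set" where
  "kernel_values \<D> a = {a K x x' | K x x'. K \<in> \<D> \<and> x \<in> K \<and> x' \<in> K}"

text \<open>\<open>g\<close> is (a representative of) the image of \<open>f\<close> under the shift with parameters \<open>i\<close>, \<open>j\<close>.\<close>

definition is_dyadic_shift_image ::
  "(real ^ 'd) set set \<Rightarrow> real \<Rightarrow> nat \<Rightarrow> nat \<Rightarrow>
   ((real ^ 'd) set \<Rightarrow> real ^ 'd \<Rightarrow> real ^ 'd \<Rightarrow> 'e::banach \<Rightarrow>\<^sub>L 'e) \<Rightarrow>
   (real ^ 'd \<Rightarrow> 'e) \<Rightarrow> (real ^ 'd \<Rightarrow> 'e) \<Rightarrow> bool" where
  "is_dyadic_shift_image \<D> p i j a f g \<longleftrightarrow>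
     has_Lp_sum lebesgue p
       (\<lambda>K. haar_proj_level \<D> j K (averaging_op a K (haar_proj_level \<D> i K f))) g \<D>"

end

theory Submission imports Defs begin

text \<open>
  Put \<open>m = max i j + 1\<close> and split the cubes \<open>K\<close> according to their level modulo \<open>m\<close>. Within one residue
  class the blocks \<open>D_K^j A_K D_K^i f\<close> form a martingale difference sequence on the words of a finite
  alphabet that labels the descendants of a cube \<open>m\<close> levels below it. The UMD inequality decouples it, at
  the cost of one factor \<open>\<beta>\<close>: the last letter is replaced by an independent copy and random signs
  appear. Conditionally on the word, these decoupled sums are Rademacher sums, to which the \<open>R\<close>-bound
  applies; kernel averages are absorbed because the \<open>R\<close>-bound passes to closed symmetric convex hulls,
  and each of the two Haar projections, being a difference of two averages, costs a factor \<open>2\<close> by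
  convexity and symmetry. What remains is the decoupled sum of the martingale differences of \<open>f\<close>
  between consecutive levels of the residue class, and a second use of UMD returns to \<open>f\<close>. Summing
  over the \<open>m\<close> classes gives the constant for finite partial sums. The sum converges unconditionally
  because, up to a function of small norm, \<open>f\<close> has only finitely many nonzero Haar projections.
\<close>

section \<open>Strongly measurable functions and the strong integral\<close>

text \<open>The choice m = max i j + 1 is what makes a residue class a martingale: the two Haar
  projections at K involve averages at most m levels below K, which is where the next cubes of the
  same class live, so a single letter carries all that a block sees. No constant beyond \<beta> is
  lost in decoupling because, on pairs of words, each difference splits into a symmetric and an
  antisymmetric half that are themselves martingale differences; passing to the copy only changes
  signs. Two obstacles shape the rest. First, kernels are measurable only in the strong operator
  topology, so single sections may fail to be integrable; averages are therefore controlled by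
  membership in closed convex hulls, with divergent averages read as 0. Second, a uniform bound for
  finite sums gives no tail bound for a fixed f, and even the indicator of a cube has nonzero
  projections along all its ancestors. Outside finitely many cubes it is replaced by a function with
  the same projections and small norm, to which the uniform bound applies. This is where p > 1
  enters.\<close>

lemma strongly_measurable_simple: "simple_function M f \<Longrightarrow> strongly_measurable M f"
  unfolding strongly_measurable_def by (rule exI[of _ "\<lambda>_. f"]) auto

lemma strongly_measurable_compose2:
  assumes f: "strongly_measurable M f" and g: "strongly_measurable M g"
    and c: "\<And>x s t. s \<longlonglongrightarrow> f x \<Longrightarrow> t \<longlonglongrightarrow> g x \<Longrightarrow> (\<lambda>n. h (s n) (t n)) \<longlonglongrightarrow> h (f x) (g x)"
  shows "strongly_measurable M (\<lambda>x. h (f x) (g x))"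
proof -
  obtain s t where s: "\<And>n. simple_function M (s n)" "AE x in M. (\<lambda>n. s n x) \<longlonglongrightarrow> f x"
    and t: "\<And>n. simple_function M (t n)" "AE x in M. (\<lambda>n. t n x) \<longlonglongrightarrow> g x"
    using f g unfolding strongly_measurable_def by blast
  have "AE x in M. (\<lambda>n. h (s n x) (t n x)) \<longlonglongrightarrow> h (f x) (g x)"
    using s(2) t(2) by eventually_elim (rule c)
  moreover have "simple_function M (\<lambda>x. h (s n x) (t n x))" for n
    using s(1) t(1) by (rule simple_function_compose2)
  ultimately show ?thesis
    unfolding strongly_measurable_def by (intro exI[of _ "\<lambda>n x. h (s n x) (t n x)"]) auto
qed

lemma strongly_measurable_add:
  "strongly_measurable M f \<Longrightarrow> strongly_measurable M g \<Longrightarrow> strongly_measurable M (\<lambda>x. f x + g x)"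
  by (erule strongly_measurable_compose2) (auto intro: tendsto_add)

lemma strongly_measurable_diff:
  "strongly_measurable M f \<Longrightarrow> strongly_measurable M g \<Longrightarrow> strongly_measurable M (\<lambda>x. f x - g x)"
  by (erule strongly_measurable_compose2) (auto intro: tendsto_diff)

lemma strongly_measurable_scaleR:
  "strongly_measurable M f \<Longrightarrow> strongly_measurable M g \<Longrightarrow> strongly_measurable M (\<lambda>x. f x *\<^sub>R g x)"
  by (erule strongly_measurable_compose2) (auto intro: tendsto_scaleR)

lemma strongly_measurable_const: "strongly_measurable M (\<lambda>x. c)"
  by (rule strongly_measurable_simple) auto

lemma strongly_measurable_indicator:
  "A \<in> sets M \<Longrightarrow> strongly_measurable M (indicator A :: _ \<Rightarrow> real)"
  by (rule strongly_measurable_simple) auto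

lemma strongly_measurable_cmult: "strongly_measurable M f \<Longrightarrow> strongly_measurable M (\<lambda>x. c *\<^sub>R f x)"
  by (rule strongly_measurable_scaleR[OF strongly_measurable_const])

lemma strongly_measurable_set:
  "A \<in> sets M \<Longrightarrow> strongly_measurable M f \<Longrightarrow> strongly_measurable M (\<lambda>x. indicator A x *\<^sub>R f x)"
  by (rule strongly_measurable_scaleR[OF strongly_measurable_indicator])

lemma strongly_measurable_sum:
  "(\<And>i. i \<in> I \<Longrightarrow> strongly_measurable M (f i)) \<Longrightarrow> strongly_measurable M (\<lambda>x. \<Sum>i\<in>I. f i x)"
  by (induction I rule: infinite_finite_induct)
    (auto intro: strongly_measurable_add strongly_measurable_const)

text \<open>The norm of a strongly measurable function is measurable only up to a null set.\<close>

lemma strongly_measurable_norm: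
  assumes "strongly_measurable M f"
  obtains h :: "'a \<Rightarrow> real"
  where "h \<in> borel_measurable M" "AE x in M. h x = norm (f x)" "\<And>x. 0 \<le> h x"
proof -
  obtain s where s: "\<And>n. simple_function M (s n)" "AE x in M. (\<lambda>n. s n x) \<longlonglongrightarrow> f x"
    using assms unfolding strongly_measurable_def by blast
  have [measurable]: "(\<lambda>x. norm (s n x)) \<in> borel_measurable M" for n
    by (rule borel_measurable_simple_function[OF simple_function_compose1[OF s(1)]])
  define h where "h x = max 0 (lim (\<lambda>n. norm (s n x)))" for x
  have "h \<in> borel_measurable M" unfolding h_def by measurable
  moreover have "AE x in M. h x = norm (f x)"
    using s(2) by eventually_elim (auto simp: h_def limI[OF tendsto_norm])
  ultimately show thesis by (intro that[of h]) (auto simp: h_def)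
qed

text \<open>Norms of strongly measurable functions agree only almost everywhere with measurable
  functions, while additivity of the integral is applied to measurable summands; hence the
  representatives \<open>h\<close> and \<open>k\<close>. The left side is handled by monotonicity
  alone.\<close>

lemma nn_integral_norm_add_le:
  assumes "strongly_measurable M f" "strongly_measurable M g"
    and "\<And>x. x \<in> space M \<Longrightarrow> norm (u x) \<le> norm (f x) + norm (g x)"
  shows "(\<integral>\<^sup>+x. norm (u x) \<partial>M) \<le> (\<integral>\<^sup>+x. norm (f x) \<partial>M) + (\<integral>\<^sup>+x. norm (g x) \<partial>M)"
proof -
  obtain h k where h [measurable]: "h \<in> borel_measurable M" "AE x in M. h x = norm (f x)"
    and k [measurable]: "k \<in> borel_measurable M" "AE x in M. k x = norm (g x)"
    using strongly_measurable_norm assms by metis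
  have "(\<integral>\<^sup>+x. norm (u x) \<partial>M) \<le> (\<integral>\<^sup>+x. ennreal (h x) + ennreal (k x) \<partial>M)"
  proof (rule nn_integral_mono_AE)
    show "AE x in M. ennreal (norm (u x)) \<le> ennreal (h x) + ennreal (k x)"
      using h(2) k(2) AE_space
      by eventually_elim (use assms(3) in \<open>auto simp flip: ennreal_plus intro!: ennreal_leI\<close>)
  qed
  also have "\<dots> = (\<integral>\<^sup>+x. ennreal (h x) \<partial>M) + (\<integral>\<^sup>+x. ennreal (k x) \<partial>M)"
    by (rule nn_integral_add) auto
  also have "(\<integral>\<^sup>+x. ennreal (h x) \<partial>M) = (\<integral>\<^sup>+x. norm (f x) \<partial>M)"
    using h(2) by (intro nn_integral_cong_AE) auto
  also have "(\<integral>\<^sup>+x. ennreal (k x) \<partial>M) = (\<integral>\<^sup>+x. norm (g x) \<partial>M)"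
    using k(2) by (intro nn_integral_cong_AE) auto
  finally show ?thesis .
qed

text \<open>Dominated convergence for measurable representatives of the norms. The countably many
  exceptional null sets are merged before the limit is taken.\<close>

lemma nn_integral_dominated_tendsto_0:
  fixes f :: "nat \<Rightarrow> 'a \<Rightarrow> 'e::real_normed_vector"
  assumes sm: "\<And>n. strongly_measurable M (f n)" and p: "0 < p" and C: "0 \<le> C"
    and lim: "AE x in M. (\<lambda>n. f n x) \<longlonglongrightarrow> 0"
    and bound: "\<And>n. AE x in M. norm (f n x) \<le> C * norm (g x)"
    and g: "strongly_measurable M g" "(\<integral>\<^sup>+x. norm (g x) powr p \<partial>M) < \<infinity>"
  shows "(\<lambda>n. \<integral>\<^sup>+x. norm (f n x) powr p \<partial>M) \<longlonglongrightarrow> 0"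
proof -
  have "\<forall>n. \<exists>h\<in>borel_measurable M. AE x in M. h x = norm (f n x)"
    using strongly_measurable_norm[OF sm] by metis
  then obtain h where h [measurable]: "\<And>n. h n \<in> borel_measurable M"
    and h': "\<And>n. AE x in M. h n x = norm (f n x)" by metis
  obtain k where k [measurable]: "k \<in> borel_measurable M" and k': "AE x in M. k x = norm (g x)"
    using strongly_measurable_norm[OF g(1)] by metis
  have "(\<lambda>n. \<integral>\<^sup>+x. ennreal (h n x powr p) \<partial>M) \<longlonglongrightarrow> (\<integral>\<^sup>+x. 0 \<partial>M)"
  proof (rule nn_integral_dominated_convergence)
    show "AE x in M. ennreal (h n x powr p) \<le> ennreal (C powr p * k x powr p)" for n
      using h'[of n] k' bound[of n] by eventually_elim
        (use p C in \<open>auto intro!: ennreal_leI powr_mono2 simp flip: powr_mult\<close>)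
    have "(\<integral>\<^sup>+x. ennreal (C powr p * k x powr p) \<partial>M) = C powr p * (\<integral>\<^sup>+x. k x powr p \<partial>M)"
      by (subst nn_integral_cmult[symmetric]) (auto simp: ennreal_mult)
    also have "(\<integral>\<^sup>+x. k x powr p \<partial>M) = (\<integral>\<^sup>+x. norm (g x) powr p \<partial>M)"
      using k' by (intro nn_integral_cong_AE) auto
    finally show "(\<integral>\<^sup>+x. ennreal (C powr p * k x powr p) \<partial>M) < \<infinity>"
      using g(2) by (simp add: ennreal_mult_less_top)
    have "AE x in M. \<forall>n. h n x = norm (f n x)" using h' by (simp add: AE_all_countable)
    with lim show "AE x in M. (\<lambda>n. ennreal (h n x powr p)) \<longlonglongrightarrow> 0"
    proof eventually_elim
      case (elim x)
      have "(\<lambda>n. norm (f n x) powr p) \<longlonglongrightarrow> 0 powr p"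
        using elim p by (intro tendsto_powr' tendsto_norm_zero tendsto_const) auto
      with elim p show ?case by (auto simp flip: ennreal_0 intro!: tendsto_ennrealI)
    qed
  qed auto
  moreover have "(\<integral>\<^sup>+x. ennreal (h n x powr p) \<partial>M) = (\<integral>\<^sup>+x. norm (f n x) powr p \<partial>M)" for n
    using h'[of n] by (intro nn_integral_cong_AE) auto
  ultimately show ?thesis by simp
qed

text \<open>Strong measurability provides simple approximants without any domination. Cutting them
  off where they exceed twice the norm of \<open>f\<close> makes dominated convergence applicable
  and leaves the limit unchanged.\<close>

lemma simple_function_approx_Lp:
  fixes f :: "'a \<Rightarrow> 'e::real_normed_vector"
  assumes f: "strongly_measurable M f" "(\<integral>\<^sup>+x. norm (f x) powr p \<partial>M) < \<infinity>" and p: "0 < p"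
  obtains t where "\<And>n. simple_function M (t n)" "\<And>n. (\<integral>\<^sup>+x. norm (t n x) powr p \<partial>M) < \<infinity>"
    "(\<lambda>n. \<integral>\<^sup>+x. norm (f x - t n x) powr p \<partial>M) \<longlonglongrightarrow> 0"
proof -
  obtain s where s: "\<And>n. simple_function M (s n)" "AE x in M. (\<lambda>n. s n x) \<longlonglongrightarrow> f x"
    using f(1) unfolding strongly_measurable_def by blast
  obtain h where h [measurable]: "h \<in> borel_measurable M" and h': "AE x in M. h x = norm (f x)"
    using strongly_measurable_norm[OF f(1)] by metis
  have [measurable]: "(\<lambda>x. norm (s n x)) \<in> borel_measurable M" for n
    by (rule borel_measurable_simple_function[OF simple_function_compose1[OF s(1)]])
  \<comment> \<open>The factor 2 leaves room: where \<open>f\<close> is nonzero,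
    \<open>s n x\<close> is eventually not cut off; where \<open>f\<close> vanishes, the cut-off
    function is 0. The difference to \<open>f\<close> is then at most 3 times the norm of
    \<open>f\<close>.\<close>
  define A where "A n = {x \<in> space M. norm (s n x) \<le> 2 * h x}" for n
  have A: "A n \<in> sets M" for n unfolding A_def by measurable
  define t where "t n x = (indicator (A n) x :: real) *\<^sub>R s n x" for n x
  have t: "simple_function M (t n)" for n
    unfolding t_def[abs_def]
    by (rule simple_function_compose2[OF simple_function_indicator[OF A] s(1)])
  have tb: "AE x in M. norm (t n x) \<le> 2 * norm (f x)" for n
    using h' by eventually_elim (simp add: t_def A_def split: split_indicator)
  show thesis
  proof (rule that[OF t])
    fix n
    obtain k where k [measurable]: "k \<in> borel_measurable M" and k': "AE x in M. k x = norm (f x)"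
      using strongly_measurable_norm[OF f(1)] by metis
    have "(\<integral>\<^sup>+x. norm (t n x) powr p \<partial>M) \<le> (\<integral>\<^sup>+x. ennreal (2 powr p) * ennreal (k x powr p) \<partial>M)"
    proof (rule nn_integral_mono_AE)
      show "AE x in M. ennreal (norm (t n x) powr p) \<le> ennreal (2 powr p) * ennreal (k x powr p)"
        using tb[of n] k' by eventually_elim
          (use p in \<open>auto intro!: ennreal_leI powr_mono2 simp flip: powr_mult ennreal_mult\<close>)
    qed
    also have "\<dots> = 2 powr p * (\<integral>\<^sup>+x. k x powr p \<partial>M)" by (rule nn_integral_cmult) auto
    also have "(\<integral>\<^sup>+x. k x powr p \<partial>M) = (\<integral>\<^sup>+x. norm (f x) powr p \<partial>M)"
      using k' by (intro nn_integral_cong_AE) auto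
    also have "2 powr p * \<dots> < \<infinity>" using f(2) by (simp add: ennreal_mult_less_top)
    finally show "(\<integral>\<^sup>+x. norm (t n x) powr p \<partial>M) < \<infinity>" .
  next
    show "(\<lambda>n. \<integral>\<^sup>+x. norm (f x - t n x) powr p \<partial>M) \<longlonglongrightarrow> 0"
    proof (rule nn_integral_dominated_tendsto_0[OF _ p, of M _ 3 f])
      show "strongly_measurable M (\<lambda>x. f x - t n x)" for n
        by (intro strongly_measurable_diff f strongly_measurable_simple t)
      show "AE x in M. norm (f x - t n x) \<le> 3 * norm (f x)" for n
        using tb[of n]
      proof eventually_elim
          case (elim x)
          then show ?case using norm_triangle_ineq4[of "f x" "t n x"] by simp
        qed
      show "AE x in M. (\<lambda>n. f x - t n x) \<longlonglongrightarrow> 0"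
        using s(2) h' AE_space
      proof eventually_elim
        case (elim x)
        have "(\<lambda>n. t n x) \<longlonglongrightarrow> f x"
        proof (cases "f x = 0")
          case True
          then have "t n x = 0" for n using elim by (auto simp: t_def A_def indicator_def)
          with True show ?thesis by simp
        next
          case False
          have "\<forall>\<^sub>F n in sequentially. norm (s n x) < 2 * norm (f x)"
            by (rule order_tendstoD(2)[OF tendsto_norm[OF elim(1)]]) (use False in simp)
          then have "\<forall>\<^sub>F n in sequentially. t n x = s n x"
            by eventually_elim (use elim in \<open>auto simp: t_def A_def\<close>)
          with elim(1) show ?thesis by (simp add: tendsto_cong)
        qed
        from tendsto_diff[OF tendsto_const this, of "f x"] show ?case by simp
      qed
    qed (use f in auto)
  qed
qed

section \<open>The integral as a limit of integrals of simple functions\<close>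

text \<open>Both uniqueness and existence of the integral rest on this estimate: the difference of
  two simple functions is simple, and the triangle inequality passes through
  \<open>f\<close>.\<close>

lemma simple_bochner_integral_dist_le:
  fixes f s t :: "'a \<Rightarrow> 'e::real_normed_vector"
  assumes f: "strongly_measurable M f"
  assumes s: "Bochner_Integration.simple_bochner_integrable M s" and t: "Bochner_Integration.simple_bochner_integrable M t"
  shows "ennreal (norm (Bochner_Integration.simple_bochner_integral M s - Bochner_Integration.simple_bochner_integral M t)) \<le>
    (\<integral>\<^sup>+ x. norm (f x - s x) \<partial>M) + (\<integral>\<^sup>+ x. norm (f x - t x) \<partial>M)"
    (is "ennreal (norm (?s - ?t)) \<le> _")
proof -
  have sf: "simple_function M s" "simple_function M t"
    using s t by (auto elim: Bochner_Integration.simple_bochner_integrable.cases)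
  have "ennreal (norm (?s - ?t)) = norm (Bochner_Integration.simple_bochner_integral M (\<lambda>x. s x - t x))"
    using s t by (subst Bochner_Integration.simple_bochner_integral_diff) auto
  also have "\<dots> \<le> Bochner_Integration.simple_bochner_integral M (\<lambda>x. norm (s x - t x))"
    using Bochner_Integration.simple_bochner_integrable_compose2[of "(-)" M "s" "t"] s t
    by (auto intro!: Bochner_Integration.simple_bochner_integral_norm_bound)
  also have "\<dots> = (\<integral>\<^sup>+x. norm (s x - t x) \<partial>M)"
    using Bochner_Integration.simple_bochner_integrable_compose2[of "\<lambda>x y. norm (x - y)" M "s" "t"] s t
    by (auto intro!: Bochner_Integration.simple_bochner_integral_eq_nn_integral)
  also have "\<dots> \<le> (\<integral>\<^sup>+ x. norm (f x - s x) \<partial>M) + (\<integral>\<^sup>+ x. norm (f x - t x) \<partial>M)"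
  proof (rule nn_integral_norm_add_le)
    show "norm (s x - t x) \<le> norm (f x - s x) + norm (f x - t x)" for x
      by (metis norm_diff_triangle_le norm_minus_commute order_refl)
  qed (intro strongly_measurable_diff strongly_measurable_simple f sf)+
  finally show ?thesis .
qed

lemma simple_bochner_integral_le_nn_integral:
  fixes s :: "'a \<Rightarrow> 'e::real_normed_vector"
  assumes s: "Bochner_Integration.simple_bochner_integrable M s"
  shows "ennreal (norm (Bochner_Integration.simple_bochner_integral M s)) \<le> (\<integral>\<^sup>+ x. norm (s x) \<partial>M)"
proof -
  have "ennreal (norm (Bochner_Integration.simple_bochner_integral M s))
      \<le> Bochner_Integration.simple_bochner_integral M (\<lambda>x. norm (s x))"
    using s by (auto intro!: Bochner_Integration.simple_bochner_integral_norm_bound)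
  also have "\<dots> = (\<integral>\<^sup>+x. norm (s x) \<partial>M)"
    using Bochner_Integration.simple_bochner_integrable_compose2[of "\<lambda>x y. norm x" M "s" "s"] s
    by (auto intro!: Bochner_Integration.simple_bochner_integral_eq_nn_integral)
  finally show ?thesis .
qed

lemma has_strong_integral_unique:
  assumes "has_strong_integral M f v" "has_strong_integral M f w"
  shows "v = w"
proof -
  obtain s where s: "\<And>n. Bochner_Integration.simple_bochner_integrable M (s n)"
     "(\<lambda>n. \<integral>\<^sup>+x. norm (f x - s n x) \<partial>M) \<longlonglongrightarrow> 0"
     "(\<lambda>n. Bochner_Integration.simple_bochner_integral M (s n)) \<longlonglongrightarrow> v"
    using assms(1) unfolding has_strong_integral_def by blast
  obtain t where t: "\<And>n. Bochner_Integration.simple_bochner_integrable M (t n)"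
     "(\<lambda>n. \<integral>\<^sup>+x. norm (f x - t n x) \<partial>M) \<longlonglongrightarrow> 0"
     "(\<lambda>n. Bochner_Integration.simple_bochner_integral M (t n)) \<longlonglongrightarrow> w"
    using assms(2) unfolding has_strong_integral_def by blast
  have f: "strongly_measurable M f" using assms(1) unfolding has_strong_integral_def by blast
  have "ennreal (norm (v - w)) \<le> 0 + 0"
  proof (rule LIMSEQ_le)
    show "(\<lambda>n. ennreal (norm (Bochner_Integration.simple_bochner_integral M (s n) -
        Bochner_Integration.simple_bochner_integral M (t n)))) \<longlonglongrightarrow> ennreal (norm (v - w))"
      by (intro tendsto_intros s t)
    show "(\<lambda>n. (\<integral>\<^sup>+x. norm (f x - s n x) \<partial>M) + (\<integral>\<^sup>+x. norm (f x - t n x) \<partial>M)) \<longlonglongrightarrow> 0 + 0"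
      by (intro tendsto_add s t)
  qed (use simple_bochner_integral_dist_le[OF f s(1) t(1)] in auto)
  then show ?thesis by (simp add: ennreal_eq_0_iff)
qed

lemma strong_integral_eqI: "has_strong_integral M f v \<Longrightarrow> strong_integral M f = v"
  unfolding strong_integral_def using has_strong_integral_unique by (auto intro!: the_equality)

lemma has_strong_integral_norm_le:
  assumes "has_strong_integral M f v"
  shows "ennreal (norm v) \<le> (\<integral>\<^sup>+x. norm (f x) \<partial>M)"
proof -
  obtain s where s: "\<And>n. Bochner_Integration.simple_bochner_integrable M (s n)"
     "(\<lambda>n. \<integral>\<^sup>+x. norm (f x - s n x) \<partial>M) \<longlonglongrightarrow> 0"
     "(\<lambda>n. Bochner_Integration.simple_bochner_integral M (s n)) \<longlonglongrightarrow> v"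
    using assms(1) unfolding has_strong_integral_def by blast
  have f: "strongly_measurable M f" using assms(1) unfolding has_strong_integral_def by blast
  have sf: "simple_function M (s n)" for n
    using s by (auto elim: Bochner_Integration.simple_bochner_integrable.cases)
  have "ennreal (norm v) \<le> (\<integral>\<^sup>+x. norm (f x) \<partial>M) + 0"
  proof (rule LIMSEQ_le)
    show "(\<lambda>n. ennreal (norm (Bochner_Integration.simple_bochner_integral M (s n)))) \<longlonglongrightarrow> ennreal (norm v)"
      by (intro tendsto_intros s)
    show "(\<lambda>n. (\<integral>\<^sup>+x. norm (f x) \<partial>M) + (\<integral>\<^sup>+x. norm (f x - s n x) \<partial>M)) \<longlonglongrightarrow> (\<integral>\<^sup>+x. norm (f x) \<partial>M) + 0"
      by (intro tendsto_add tendsto_const s)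
    have "ennreal (norm (Bochner_Integration.simple_bochner_integral M (s n)))
      \<le> (\<integral>\<^sup>+x. norm (f x) \<partial>M) + (\<integral>\<^sup>+x. norm (f x - s n x) \<partial>M)" for n
    proof (rule order.trans[OF simple_bochner_integral_le_nn_integral[OF s(1)] nn_integral_norm_add_le])
      show "norm (s n x) \<le> norm (f x) + norm (f x - s n x)" for x
        by (metis add.commute norm_minus_commute norm_triangle_sub)
    qed (use f sf in \<open>auto intro: strongly_measurable_diff strongly_measurable_simple\<close>)
    then show "\<exists>N. \<forall>n\<ge>N. ennreal (norm (Bochner_Integration.simple_bochner_integral M (s n)))
      \<le> (\<integral>\<^sup>+x. norm (f x) \<partial>M) + (\<integral>\<^sup>+x. norm (f x - s n x) \<partial>M)" by auto
  qed
  then show ?thesis by simp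
qed

definition strongly_integrable :: "'a measure \<Rightarrow> ('a \<Rightarrow> 'e::real_normed_vector) \<Rightarrow> bool" where
  "strongly_integrable M f \<longleftrightarrow> strongly_measurable M f \<and> (\<integral>\<^sup>+x. norm (f x) \<partial>M) < \<infinity>"

text \<open>Completeness of the target space: the integrals of simple functions tending to
  \<open>f\<close> in L^1 form a Cauchy sequence.\<close>

lemma has_strong_integral_strong_integral:
  fixes f :: "'a \<Rightarrow> 'e::banach"
  assumes "strongly_integrable M f"
  shows "has_strong_integral M f (strong_integral M f)"
proof -
  have f: "strongly_measurable M f" "(\<integral>\<^sup>+x. norm (f x) \<partial>M) < \<infinity>"
    using assms by (auto simp: strongly_integrable_def)
  obtain t where t: "\<And>n. simple_function M (t n)" "\<And>n. (\<integral>\<^sup>+x. norm (t n x) \<partial>M) < \<infinity>"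
    "(\<lambda>n. \<integral>\<^sup>+x. norm (f x - t n x) \<partial>M) \<longlonglongrightarrow> 0"
    using simple_function_approx_Lp[of M f 1] f by (auto simp: powr_one)
  have t': "Bochner_Integration.simple_bochner_integrable M (t n)" for n
    using t by (intro Bochner_Integration.simple_bochner_integrableI_bounded) auto
  have "Cauchy (\<lambda>n. Bochner_Integration.simple_bochner_integral M (t n))"
  proof (rule metric_CauchyI)
    fix e :: real assume "0 < e"
    then have "\<forall>\<^sub>F n in sequentially. (\<integral>\<^sup>+x. norm (f x - t n x) \<partial>M) < ennreal (e / 2)"
      by (intro order_tendstoD(2)[OF t(3)]) auto
    then obtain N where N: "\<And>n. n \<ge> N \<Longrightarrow> (\<integral>\<^sup>+x. norm (f x - t n x) \<partial>M) < ennreal (e / 2)"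
      by (auto simp: eventually_sequentially)
    show "\<exists>N. \<forall>m\<ge>N. \<forall>n\<ge>N. dist (Bochner_Integration.simple_bochner_integral M (t m))
        (Bochner_Integration.simple_bochner_integral M (t n)) < e"
    proof (intro exI allI impI)
      fix m n assume mn: "m \<ge> N" "n \<ge> N"
      have "ennreal (norm (Bochner_Integration.simple_bochner_integral M (t m) -
          Bochner_Integration.simple_bochner_integral M (t n)))
        \<le> (\<integral>\<^sup>+x. norm (f x - t m x) \<partial>M) + (\<integral>\<^sup>+x. norm (f x - t n x) \<partial>M)"
        by (rule simple_bochner_integral_dist_le[OF f(1) t' t'])
      also have "\<dots> < ennreal (e / 2) + ennreal (e / 2)"
        using N mn by (intro add_strict_mono) auto
      also have "\<dots> = ennreal e" using \<open>0 < e\<close> by (simp flip: ennreal_plus)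
      finally show "dist (Bochner_Integration.simple_bochner_integral M (t m))
        (Bochner_Integration.simple_bochner_integral M (t n)) < e"
        using \<open>0 < e\<close> by (simp add: dist_norm ennreal_less_iff)
    qed
  qed
  then obtain v where "(\<lambda>n. Bochner_Integration.simple_bochner_integral M (t n)) \<longlonglongrightarrow> v"
    by (auto simp: Cauchy_convergent_iff convergent_def)
  then have "has_strong_integral M f v"
    unfolding has_strong_integral_def using f t t' by blast
  then show ?thesis using strong_integral_eqI by metis
qed

lemma has_strong_integral_linear:
  assumes f: "has_strong_integral M f v" and g: "has_strong_integral M g w"
  shows "has_strong_integral M (\<lambda>x. a *\<^sub>R f x + b *\<^sub>R g x) (a *\<^sub>R v + b *\<^sub>R w)"
proof -
  obtain s where s: "\<And>n. Bochner_Integration.simple_bochner_integrable M (s n)"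
     "(\<lambda>n. \<integral>\<^sup>+x. norm (f x - s n x) \<partial>M) \<longlonglongrightarrow> 0"
     "(\<lambda>n. Bochner_Integration.simple_bochner_integral M (s n)) \<longlonglongrightarrow> v"
    using f unfolding has_strong_integral_def by blast
  obtain t where t: "\<And>n. Bochner_Integration.simple_bochner_integrable M (t n)"
     "(\<lambda>n. \<integral>\<^sup>+x. norm (g x - t n x) \<partial>M) \<longlonglongrightarrow> 0"
     "(\<lambda>n. Bochner_Integration.simple_bochner_integral M (t n)) \<longlonglongrightarrow> w"
    using g unfolding has_strong_integral_def by blast
  have sm: "strongly_measurable M f" "strongly_measurable M g"
    using f g unfolding has_strong_integral_def by blast+
  have sf: "simple_function M (s n)" "simple_function M (t n)" for n
    using s(1)[of n] t(1)[of n] by (auto elim: Bochner_Integration.simple_bochner_integrable.cases)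
  have as: "Bochner_Integration.simple_bochner_integrable M (\<lambda>x. a *\<^sub>R s n x)" for n
    using Bochner_Integration.simple_bochner_integrable_compose2[of "\<lambda>x y. a *\<^sub>R x", OF _ s(1) s(1)] by simp
  have bt: "Bochner_Integration.simple_bochner_integrable M (\<lambda>x. b *\<^sub>R t n x)" for n
    using Bochner_Integration.simple_bochner_integrable_compose2[of "\<lambda>x y. b *\<^sub>R x", OF _ t(1) t(1)] by simp
  have st: "Bochner_Integration.simple_bochner_integrable M (\<lambda>x. a *\<^sub>R s n x + b *\<^sub>R t n x)" for n
    by (rule Bochner_Integration.simple_bochner_integrable_compose2[OF _ as bt]) simp
  have "(\<lambda>n. Bochner_Integration.simple_bochner_integral M (\<lambda>x. a *\<^sub>R s n x + b *\<^sub>R t n x))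
      \<longlonglongrightarrow> a *\<^sub>R v + b *\<^sub>R w"
    unfolding Bochner_Integration.simple_bochner_integral_add[OF as bt]
    unfolding Bochner_Integration.simple_bochner_integral_linear[OF linear_scale_self s(1)]
      Bochner_Integration.simple_bochner_integral_linear[OF linear_scale_self t(1)]
    by (intro tendsto_intros s t)
  moreover have "(\<lambda>n. \<integral>\<^sup>+x. norm (a *\<^sub>R f x + b *\<^sub>R g x - (a *\<^sub>R s n x + b *\<^sub>R t n x)) \<partial>M) \<longlonglongrightarrow> 0"
  proof (rule tendsto_sandwich[OF _ _ tendsto_const])
    show "(\<lambda>n. ennreal \<bar>a\<bar> * (\<integral>\<^sup>+x. norm (f x - s n x) \<partial>M) + ennreal \<bar>b\<bar> * (\<integral>\<^sup>+x. norm (g x - t n x) \<partial>M)) \<longlonglongrightarrow> 0"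
      using tendsto_add[OF ennreal_tendsto_cmult[OF _ s(2), of "\<bar>a\<bar>"] ennreal_tendsto_cmult[OF _ t(2), of "\<bar>b\<bar>"]]
      by simp
    have le: "(\<integral>\<^sup>+x. norm (a *\<^sub>R f x + b *\<^sub>R g x - (a *\<^sub>R s n x + b *\<^sub>R t n x)) \<partial>M)
      \<le> (\<integral>\<^sup>+x. norm (a *\<^sub>R (f x - s n x)) \<partial>M) + (\<integral>\<^sup>+x. norm (b *\<^sub>R (g x - t n x)) \<partial>M)" for n
    proof (rule nn_integral_norm_add_le)
      show "norm (a *\<^sub>R f x + b *\<^sub>R g x - (a *\<^sub>R s n x + b *\<^sub>R t n x)) \<le>
         norm (a *\<^sub>R (f x - s n x)) + norm (b *\<^sub>R (g x - t n x))" for x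
        using norm_triangle_ineq[of "a *\<^sub>R (f x - s n x)" "b *\<^sub>R (g x - t n x)"]
        by (simp add: algebra_simps)
    qed (intro strongly_measurable_cmult strongly_measurable_diff strongly_measurable_simple sm sf)+
    have "(\<integral>\<^sup>+x. norm (c *\<^sub>R u x) \<partial>M) = ennreal \<bar>c\<bar> * (\<integral>\<^sup>+x. norm (u x) \<partial>M)"
      if u: "strongly_measurable M u" for c and u :: "'a \<Rightarrow> 'b"
    proof -
      obtain h where h [measurable]: "h \<in> borel_measurable M" and h': "AE x in M. h x = norm (u x)"
        using strongly_measurable_norm[OF u] by metis
      have "(\<integral>\<^sup>+x. norm (c *\<^sub>R u x) \<partial>M) = (\<integral>\<^sup>+x. ennreal \<bar>c\<bar> * ennreal (h x) \<partial>M)"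
        using h' by (intro nn_integral_cong_AE) (auto simp: ennreal_mult)
      also have "\<dots> = ennreal \<bar>c\<bar> * (\<integral>\<^sup>+x. h x \<partial>M)" by (rule nn_integral_cmult) auto
      also have "(\<integral>\<^sup>+x. h x \<partial>M) = (\<integral>\<^sup>+x. norm (u x) \<partial>M)"
        using h' by (intro nn_integral_cong_AE) auto
      finally show ?thesis .
    qed
    note scale = this
    show "\<forall>\<^sub>F n in sequentially. (\<integral>\<^sup>+x. norm (a *\<^sub>R f x + b *\<^sub>R g x - (a *\<^sub>R s n x + b *\<^sub>R t n x)) \<partial>M)
      \<le> ennreal \<bar>a\<bar> * (\<integral>\<^sup>+x. norm (f x - s n x) \<partial>M) + ennreal \<bar>b\<bar> * (\<integral>\<^sup>+x. norm (g x - t n x) \<partial>M)"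
    proof (intro always_eventually allI)
      fix n
      have "strongly_measurable M (\<lambda>x. f x - s n x)" "strongly_measurable M (\<lambda>x. g x - t n x)"
        by (intro strongly_measurable_diff strongly_measurable_simple sm sf)+
      from le[of n, unfolded scale[OF this(1)] scale[OF this(2)]]
      show "(\<integral>\<^sup>+x. norm (a *\<^sub>R f x + b *\<^sub>R g x - (a *\<^sub>R s n x + b *\<^sub>R t n x)) \<partial>M)
      \<le> ennreal \<bar>a\<bar> * (\<integral>\<^sup>+x. norm (f x - s n x) \<partial>M) + ennreal \<bar>b\<bar> * (\<integral>\<^sup>+x. norm (g x - t n x) \<partial>M)" .
    qed
  qed auto
  ultimately have "\<exists>r. (\<forall>n. Bochner_Integration.simple_bochner_integrable M (r n)) \<and>
      (\<lambda>n. \<integral>\<^sup>+x. norm (a *\<^sub>R f x + b *\<^sub>R g x - r n x) \<partial>M) \<longlonglongrightarrow> 0 \<and>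
      (\<lambda>n. Bochner_Integration.simple_bochner_integral M (r n)) \<longlonglongrightarrow> a *\<^sub>R v + b *\<^sub>R w"
    by (intro exI[of _ "\<lambda>n x. a *\<^sub>R s n x + b *\<^sub>R t n x"] conjI allI st)
  then show ?thesis unfolding has_strong_integral_def
    by (intro conjI strongly_measurable_add strongly_measurable_cmult sm)
qed

section \<open>The UMD inequality on finite sample spaces\<close>

lemma simple_function_uniform_count_measure:
  "finite \<Omega> \<Longrightarrow> simple_function (uniform_count_measure \<Omega>) f"
  by (auto simp: simple_function_def space_uniform_count_measure sets_uniform_count_measure)

lemma nn_integral_uniform_count_measure:
  assumes "finite \<Omega>" "\<And>\<omega>. 0 \<le> g \<omega>"
  shows "(\<integral>\<^sup>+\<omega>. ennreal (g \<omega>) \<partial>uniform_count_measure \<Omega>) = ennreal ((\<Sum>\<omega>\<in>\<Omega>. g \<omega>) / card \<Omega>)"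
  unfolding uniform_count_measure_def using assms
  by (subst nn_integral_point_measure_finite)
    (auto simp: sum_ennreal sum_divide_distrib simp flip: ennreal_mult intro!: sum_ennreal)

lemma has_strong_integral_uniform_count_measure:
  fixes f :: "'w \<Rightarrow> 'e::real_normed_vector"
  assumes "finite \<Omega>" "\<Omega> \<noteq> {}"
  shows "has_strong_integral (uniform_count_measure \<Omega>) f ((1 / card \<Omega>) *\<^sub>R (\<Sum>\<omega>\<in>\<Omega>. f \<omega>))"
proof -
  let ?M = "uniform_count_measure \<Omega>"
  interpret prob_space ?M using assms by (rule prob_space_uniform_count_measure)
  have sf: "simple_function ?M g" for g :: "'w \<Rightarrow> 'c" 
    using assms by (intro simple_function_uniform_count_measure)
  have f: "Bochner_Integration.simple_bochner_integrable ?M f"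
    by (rule Bochner_Integration.simple_bochner_integrable.intros[OF sf]) simp
  \<comment> \<open>Partitioning by \<open>id\<close> rather than by the values of \<open>f\<close>
    yields one term per sample point.\<close>
  have "Bochner_Integration.simple_bochner_integral ?M f
      = (\<Sum>y\<in>id ` space ?M. measure ?M {x \<in> space ?M. id x = y} *\<^sub>R f y)"
    by (rule Bochner_Integration.simple_bochner_integral_partition[OF f sf]) auto
  also have "\<dots> = (\<Sum>y\<in>\<Omega>. (1 / card \<Omega>) *\<^sub>R f y)"
  proof (rule sum.cong)
    fix y assume y: "y \<in> \<Omega>"
    then have "{x \<in> space ?M. id x = y} = {y}" by (auto simp: space_uniform_count_measure)
    then show "measure ?M {x \<in> space ?M. id x = y} *\<^sub>R f y = (1 / card \<Omega>) *\<^sub>R f y"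
      using y assms by (simp add: measure_uniform_count_measure)
  qed (simp add: space_uniform_count_measure)
  finally have "Bochner_Integration.simple_bochner_integral ?M f = (1 / card \<Omega>) *\<^sub>R (\<Sum>\<omega>\<in>\<Omega>. f \<omega>)"
    by (simp add: scaleR_sum_right)
  then show ?thesis unfolding has_strong_integral_def
    using f strongly_measurable_simple[OF sf] by (intro conjI exI[of _ "\<lambda>_. f"]) auto
qed

text \<open>Under the uniform measure integrals are sums over \<Omega>. Symmetry of
  \<open>r t\<close> makes the saturated sets closed under complements, so that they form a
  sigma-algebra; \<open>meas\<close> says that \<open>d t\<close> is constant along
  \<open>r t\<close>, and \<open>zero\<close> is the vanishing of integrals over saturated
  sets.\<close>

lemma UMD_finite_seq:
  fixes \<Omega> :: "(nat \<Rightarrow> real) set" and d :: "nat \<Rightarrow> (nat \<Rightarrow> real) \<Rightarrow> 'e::banach"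
  assumes umd: "UMD_bound TYPE('e) p \<beta>" and p: "0 < p" and fin: "finite \<Omega>" "\<Omega> \<noteq> {}"
    and sym: "\<And>t \<omega> \<omega>'. r t \<omega> \<omega>' \<Longrightarrow> r t \<omega>' \<omega>"
    and mono: "\<And>m n \<omega> \<omega>'. 1 \<le> m \<Longrightarrow> m \<le> n \<Longrightarrow> n \<le> N \<Longrightarrow> r n \<omega> \<omega>' \<Longrightarrow> r m \<omega> \<omega>'"
    and meas: "\<And>t \<omega> \<omega>'. t \<in> {1..N} \<Longrightarrow> \<omega> \<in> \<Omega> \<Longrightarrow> \<omega>' \<in> \<Omega> \<Longrightarrow> r t \<omega> \<omega>' \<Longrightarrow> d t \<omega> = d t \<omega>'"
    and zero: "\<And>t A. t \<in> {1..<N} \<Longrightarrow> A \<subseteq> \<Omega> \<Longrightarrow>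
        (\<And>\<omega> \<omega>'. \<omega> \<in> A \<Longrightarrow> \<omega>' \<in> \<Omega> \<Longrightarrow> r t \<omega> \<omega>' \<Longrightarrow> \<omega>' \<in> A) \<Longrightarrow> (\<Sum>\<omega>\<in>A. d (Suc t) \<omega>) = 0"
    and eps: "\<And>t. t \<in> {1..N} \<Longrightarrow> \<epsilon> t \<in> {-1, 1}"
  shows "(\<Sum>\<omega>\<in>\<Omega>. norm (\<Sum>t=1..N. \<epsilon> t *\<^sub>R d t \<omega>) powr p)
    \<le> \<beta> powr p * (\<Sum>\<omega>\<in>\<Omega>. norm (\<Sum>t=1..N. d t \<omega>) powr p)"
proof -
  define M where "M = uniform_count_measure \<Omega>"
  define \<A> where "\<A> t = {A. A \<subseteq> \<Omega> \<and> (\<forall>\<omega>\<in>A. \<forall>\<omega>'\<in>\<Omega>. r t \<omega> \<omega>' \<longrightarrow> \<omega>' \<in> A)}" for t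
  define F where "F t = sigma \<Omega> (\<A> t)" for t
  have "sigma_algebra \<Omega> (\<A> t)" for t
    unfolding sigma_algebra_iff2 \<A>_def using sym by (fastforce simp: image_subset_iff)
  then have sets_F: "sets (F t) = \<A> t" for t
    by (simp add: F_def sigma_algebra.sets_measure_of_eq)
  have space_F: "space (F t) = \<Omega>" for t
    by (auto simp: F_def \<A>_def intro!: space_measure_of)
  have M: "space M = \<Omega>" "sets M = Pow \<Omega>"
    by (auto simp: M_def space_uniform_count_measure sets_uniform_count_measure)
  have sub: "subalgebra M (F t)" for t
    by (auto simp: subalgebra_def M space_F sets_F \<A>_def)
  interpret prob_space M unfolding M_def using fin by (rule prob_space_uniform_count_measure)
  have sf: "simple_function M g" for g :: "(nat \<Rightarrow> real) \<Rightarrow> 'e"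
    unfolding M_def by (rule simple_function_uniform_count_measure[OF fin(1)])
  have integral: "set_strong_integral M A g = (1 / card \<Omega>) *\<^sub>R (\<Sum>\<omega>\<in>A. g \<omega>)"
    if "A \<subseteq> \<Omega>" for A and g :: "(nat \<Rightarrow> real) \<Rightarrow> 'e"
  proof -
    have "(\<Sum>\<omega>\<in>\<Omega>. indicat_real A \<omega> *\<^sub>R g \<omega>) = (\<Sum>\<omega>\<in>A. g \<omega>)"
      using that fin by (intro sum.mono_neutral_cong_right) auto
    then show ?thesis unfolding set_strong_integral_def M_def
      using strong_integral_eqI[OF has_strong_integral_uniform_count_measure[OF fin,
        of "\<lambda>\<omega>. indicat_real A \<omega> *\<^sub>R g \<omega>"]] by simp
  qed
  have int: "(\<integral>\<^sup>+\<omega>. norm (g \<omega>) powr p \<partial>M) = ennreal ((\<Sum>\<omega>\<in>\<Omega>. norm (g \<omega>) powr p) / card \<Omega>)"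
    for g :: "(nat \<Rightarrow> real) \<Rightarrow> 'e"
    unfolding M_def by (rule nn_integral_uniform_count_measure) (use fin in auto)
  have "martingale_differences M p F N d"
    unfolding martingale_differences_def
  proof (intro conjI ballI)
    fix m n assume "m \<in> {1..N}" "n \<in> {m..N}"
    then show "sets (F m) \<subseteq> sets (F n)"
      unfolding sets_F \<A>_def using mono[of m n] by auto
  next
    fix n assume n: "n \<in> {1..N}"
    show "in_Lp M p (d n)"
      unfolding in_Lp_def by (simp add: strongly_measurable_simple sf int)
    have "simple_function (restr_to_subalg M (F n)) (d n)"
      unfolding simple_function_def
      using meas[OF n] by (auto simp: space_restr_to_subalg sets_restr_to_subalg sub sets_F \<A>_def M fin)
    then show "strongly_measurable (restr_to_subalg M (F n)) (d n)"
      by (rule strongly_measurable_simple)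
  next
    fix n A assume "n \<in> {1..<N}" "A \<in> sets (F n)"
    with zero[of n A] show "set_strong_integral M A (d (Suc n)) = 0"
      by (subst integral) (auto simp: sets_F \<A>_def)
  qed (rule sub)
  then have le: "Lp_norm M p (\<lambda>\<omega>. \<Sum>n=1..N. \<epsilon> n *\<^sub>R d n \<omega>) \<le> \<beta> * Lp_norm M p (\<lambda>\<omega>. \<Sum>n=1..N. d n \<omega>)"
    and \<beta>: "0 \<le> \<beta>"
    using umd eps prob_space_axioms unfolding UMD_bound_def by blast+
  have norm_eq: "Lp_norm M p g = ((\<Sum>\<omega>\<in>\<Omega>. norm (g \<omega>) powr p) / card \<Omega>) powr (1 / p)" 
    for g :: "(nat \<Rightarrow> real) \<Rightarrow> 'e"
    unfolding Lp_norm_def int by (subst enn2real_ennreal) (auto intro!: divide_nonneg_nonneg sum_nonneg)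
  have pow: "Lp_norm M p g powr p = (\<Sum>\<omega>\<in>\<Omega>. norm (g \<omega>) powr p) / card \<Omega>" for g :: "(nat \<Rightarrow> real) \<Rightarrow> 'e"
    using p sum_nonneg[of \<Omega> "\<lambda>\<omega>. norm (g \<omega>) powr p"] by (simp add: norm_eq powr_powr)
  have "Lp_norm M p (\<lambda>\<omega>. \<Sum>n=1..N. \<epsilon> n *\<^sub>R d n \<omega>) powr p
      \<le> (\<beta> * Lp_norm M p (\<lambda>\<omega>. \<Sum>n=1..N. d n \<omega>)) powr p"
    using le p by (intro powr_mono2) (auto simp: Lp_norm_def)
  \<comment> \<open>After taking p-th powers the normalisation by \<open>card \<Omega>\<close>
    cancels from both sides.\<close>
  then show ?thesis
    using \<beta> fin by (subst (asm) powr_mult) (auto simp: pow Lp_norm_def[of _ _ "\<lambda>\<omega>. \<Sum>n=1..N. d n \<omega>"] field_simps card_gt_0_iff)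
qed

text \<open>The filtration is given by relations \<open>r t\<close>, \<open>\<F>\<^sub>t\<close> being the saturated sets. The definition of
  \<^const>\<open>UMD_bound\<close> fixes the type of sample points, so the space is embedded.\<close>

lemma UMD_finite:
  fixes \<Omega> :: "'w set" and d :: "nat \<Rightarrow> 'w \<Rightarrow> 'e::banach"
  assumes umd: "UMD_bound TYPE('e) p \<beta>" and p: "0 < p" and fin: "finite \<Omega>" "\<Omega> \<noteq> {}"
    and sym: "\<And>t \<omega> \<omega>'. r t \<omega> \<omega>' \<Longrightarrow> r t \<omega>' \<omega>"
    and mono: "\<And>m n \<omega> \<omega>'. 1 \<le> m \<Longrightarrow> m \<le> n \<Longrightarrow> n \<le> N \<Longrightarrow> r n \<omega> \<omega>' \<Longrightarrow> r m \<omega> \<omega>'"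
    and meas: "\<And>t \<omega> \<omega>'. t \<in> {1..N} \<Longrightarrow> \<omega> \<in> \<Omega> \<Longrightarrow> \<omega>' \<in> \<Omega> \<Longrightarrow> r t \<omega> \<omega>' \<Longrightarrow> d t \<omega> = d t \<omega>'"
    and zero: "\<And>t A. t \<in> {1..<N} \<Longrightarrow> A \<subseteq> \<Omega> \<Longrightarrow>
        (\<And>\<omega> \<omega>'. \<omega> \<in> A \<Longrightarrow> \<omega>' \<in> \<Omega> \<Longrightarrow> r t \<omega> \<omega>' \<Longrightarrow> \<omega>' \<in> A) \<Longrightarrow> (\<Sum>\<omega>\<in>A. d (Suc t) \<omega>) = 0"
    and eps: "\<And>t. t \<in> {1..N} \<Longrightarrow> \<epsilon> t \<in> {-1, 1}"
  shows "(\<Sum>\<omega>\<in>\<Omega>. norm (\<Sum>t=1..N. \<epsilon> t *\<^sub>R d t \<omega>) powr p)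
    \<le> \<beta> powr p * (\<Sum>\<omega>\<in>\<Omega>. norm (\<Sum>t=1..N. d t \<omega>) powr p)"
proof -
  obtain h :: "'w \<Rightarrow> nat" where h: "inj_on h \<Omega>"
    using finite_imp_inj_to_nat_seg[OF fin(1)] by metis
  \<comment> \<open>A sample point with number h becomes the constant sequence h; only injectivity
    matters.\<close>
  define g :: "'w \<Rightarrow> nat \<Rightarrow> real" where "g \<omega> = (\<lambda>_. real (h \<omega>))" for \<omega>
  have g: "inj_on g \<Omega>" using h by (auto simp: inj_on_def g_def fun_eq_iff)
  define k where "k = the_inv_into \<Omega> g"
  have k: "k (g \<omega>) = \<omega>" if "\<omega> \<in> \<Omega>" for \<omega>
    using that by (simp add: k_def the_inv_into_f_f[OF g])
  have sum_g: "(\<Sum>z\<in>g ` A. f (k z)) = (\<Sum>\<omega>\<in>A. f \<omega>)" if "A \<subseteq> \<Omega>" for A and f :: "'w \<Rightarrow> 'e"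
    using that k by (subst sum.reindex[OF inj_on_subset[OF g that]]) (auto intro!: sum.cong)
  have sum_norm: "(\<Sum>z\<in>g ` \<Omega>. norm (f (k z)) powr p) = (\<Sum>\<omega>\<in>\<Omega>. norm (f \<omega>) powr p)" for f :: "'w \<Rightarrow> 'e"
    using k by (subst sum.reindex[OF g]) (auto intro!: sum.cong)
  have "(\<Sum>z\<in>g ` \<Omega>. norm (\<Sum>t=1..N. \<epsilon> t *\<^sub>R d t (k z)) powr p)
    \<le> \<beta> powr p * (\<Sum>z\<in>g ` \<Omega>. norm (\<Sum>t=1..N. d t (k z)) powr p)"
  proof (rule UMD_finite_seq[OF umd p, where r = "\<lambda>t z z'. r t (k z) (k z')"])
    fix t A assume t: "t \<in> {1..<N}" and A: "A \<subseteq> g ` \<Omega>"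
      and sat: "\<And>z z'. z \<in> A \<Longrightarrow> z' \<in> g ` \<Omega> \<Longrightarrow> r t (k z) (k z') \<Longrightarrow> z' \<in> A"
    obtain A' where A': "A' \<subseteq> \<Omega>" "A = g ` A'" using A by (meson subset_imageE)
    have "(\<Sum>\<omega>\<in>A'. d (Suc t) \<omega>) = 0"
    proof (rule zero[OF t A'(1)])
      fix \<omega> \<omega>' assume *: "\<omega> \<in> A'" "\<omega>' \<in> \<Omega>" "r t \<omega> \<omega>'"
      then have "g \<omega>' \<in> A" using sat[of "g \<omega>" "g \<omega>'"] A' k by auto
      then show "\<omega>' \<in> A'" using A' * g by (auto simp: inj_on_def)
    qed
    then show "(\<Sum>z\<in>A. d (Suc t) (k z)) = 0" using A' by (simp add: sum_g)
  next
    fix t z z' assume "t \<in> {1..N}" "z \<in> g ` \<Omega>" "z' \<in> g ` \<Omega>" "r t (k z) (k z')"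
    then show "d t (k z) = d t (k z')" using meas[of t "k z" "k z'"] k by auto
  qed (use mono[of _ _ "k _" "k _"] sym eps fin in simp_all)
  then show ?thesis
    unfolding sum_norm[of "\<lambda>\<omega>. \<Sum>t=1..N. \<epsilon> t *\<^sub>R d t \<omega>"] sum_norm[of "\<lambda>\<omega>. \<Sum>t=1..N. d t \<omega>"] .
qed

section \<open>Decoupling\<close>

text \<open>The map from \<open>(a, c)\<close> to \<open>(upd a c, get a)\<close> is an involution
  of the product of \<open>A\<close> and \<open>C\<close>: it exchanges the new entry with the old
  one. Each \<open>a\<close> is therefore hit once for every element of \<open>C\<close>.\<close>

lemma sum_resample:
  fixes \<Phi> :: "'w \<Rightarrow> 'v::real_vector"
  assumes "finite A" "finite C"
    and "\<And>a c. a \<in> A \<Longrightarrow> c \<in> C \<Longrightarrow> upd a c \<in> A" "\<And>a. a \<in> A \<Longrightarrow> get a \<in> C"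
    and "\<And>a c. a \<in> A \<Longrightarrow> c \<in> C \<Longrightarrow> get (upd a c) = c"
    and "\<And>a c. a \<in> A \<Longrightarrow> c \<in> C \<Longrightarrow> upd (upd a c) (get a) = a"
  shows "(\<Sum>a\<in>A. \<Sum>c\<in>C. \<Phi> (upd a c)) = real (card C) *\<^sub>R (\<Sum>a\<in>A. \<Phi> a)"
proof -
  have "(\<Sum>a\<in>A. \<Sum>c\<in>C. \<Phi> (upd a c)) = (\<Sum>(a, c)\<in>A \<times> C. \<Phi> (upd a c))"
    by (rule sum.cartesian_product)
  also have "\<dots> = (\<Sum>(a, c)\<in>A \<times> C. \<Phi> a)"
    by (rule sum.reindex_bij_witness[where i = "\<lambda>(a, c). (upd a c, get a)" and j = "\<lambda>(a, c). (upd a c, get a)"])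
      (use assms in auto)
  also have "\<dots> = (\<Sum>a\<in>A. \<Sum>c\<in>C. \<Phi> a)"
    by (rule sum.cartesian_product[symmetric])
  also have "\<dots> = real (card C) *\<^sub>R (\<Sum>a\<in>A. \<Phi> a)"
    by (simp only: sum_constant_scaleR scaleR_sum_right)
  finally show ?thesis .
qed

section \<open>Words over a finite alphabet\<close>

definition words :: "nat \<Rightarrow> 'c set \<Rightarrow> (nat \<Rightarrow> 'c) set" where
  "words N C = PiE {..<N} (\<lambda>_. C)"

lemma finite_words: "finite C \<Longrightarrow> finite (words N C)"
  by (simp add: words_def finite_PiE)

lemma words_nonempty: "C \<noteq> {} \<Longrightarrow> words N C \<noteq> {}"
  by (simp add: words_def PiE_eq_empty_iff)

lemma card_words: "finite C \<Longrightarrow> card (words N C) = card C ^ N"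
  by (simp add: words_def card_PiE)

lemma words_upd: "x \<in> words N C \<Longrightarrow> n < N \<Longrightarrow> c \<in> C \<Longrightarrow> x(n := c) \<in> words N C"
  by (auto simp: words_def PiE_iff extensional_def)

lemma words_nth: "x \<in> words N C \<Longrightarrow> n < N \<Longrightarrow> x n \<in> C"
  by (auto simp: words_def)

lemma sum_words_resample:
  fixes \<Phi> :: "(nat \<Rightarrow> 'c) \<Rightarrow> 'v::real_vector"
  assumes "finite C" "n < N"
  shows "(\<Sum>x\<in>words N C. \<Sum>c\<in>C. \<Phi> (x(n := c))) = real (card C) *\<^sub>R (\<Sum>x\<in>words N C. \<Phi> x)"
  by (rule sum_resample[where get = "\<lambda>x. x n"])
    (use assms in \<open>auto simp: finite_words words_upd words_nth simp del: fun_upd_apply\<close>, simp)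

section \<open>Martingale differences on pairs of words\<close>

context
  fixes N :: nat and C :: "'c set" and H :: "nat \<Rightarrow> (nat \<Rightarrow> 'c) \<Rightarrow> 'c \<Rightarrow> 'e::banach" and c :: 'e and p \<beta> :: real
  assumes umd: "UMD_bound TYPE('e) p \<beta>" and p: "0 < p"
    and C: "finite C" "C \<noteq> {}"
    and H_cong: "\<And>n x x' y. n < N \<Longrightarrow> (\<And>i. i < n \<Longrightarrow> x i = x' i) \<Longrightarrow> H n x y = H n x' y"
    and H_sum: "\<And>n x. n < N \<Longrightarrow> x \<in> words N C \<Longrightarrow> (\<Sum>y\<in>C. H n x y) = 0"
begin

text \<open>Equality of information at time t about a pair of words (x, y). At odd t = 2n + 1 the
  first n letters of both words are known; at even t = 2n + 2 also their letters with index n, but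
  only as an unordered pair. The step into an even time carries the part symmetric in
  \<open>x n\<close> and \<open>y n\<close>, the step into the next odd time the antisymmetric
  part.\<close>

definition agree :: "nat \<Rightarrow> (nat \<Rightarrow> 'c) \<times> (nat \<Rightarrow> 'c) \<Rightarrow> (nat \<Rightarrow> 'c) \<times> (nat \<Rightarrow> 'c) \<Rightarrow> bool" where
  "agree t \<omega> \<omega>' \<longleftrightarrow>
     (\<forall>i<(t - 1) div 2. fst \<omega> i = fst \<omega>' i \<and> snd \<omega> i = snd \<omega>' i) \<and>
     (even t \<longrightarrow> (let n = (t - 1) div 2 in
        fst \<omega> n = fst \<omega>' n \<and> snd \<omega> n = snd \<omega>' n \<or> fst \<omega> n = snd \<omega>' n \<and> snd \<omega> n = fst \<omega>' n))"

text \<open>Time 1 carries the constant \<open>c\<close>, which is admissible because nothing is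
  asked of the mean of the first difference. Times 2n + 2 and 2n + 3 carry half the sum and half the
  difference of the values of \<open>H n\<close> at \<open>x n\<close> and \<open>y n\<close>; both
  index formulas return n.\<close>

definition diffs :: "nat \<Rightarrow> (nat \<Rightarrow> 'c) \<times> (nat \<Rightarrow> 'c) \<Rightarrow> 'e" where
  "diffs t \<omega> = (if t \<le> 1 then c else if even t
     then let n = (t - 1) div 2 in (1 / 2) *\<^sub>R (H n (fst \<omega>) (fst \<omega> n) + H n (fst \<omega>) (snd \<omega> n))
     else let n = (t - 1) div 2 - 1 in (1 / 2) *\<^sub>R (H n (fst \<omega>) (fst \<omega> n) - H n (fst \<omega>) (snd \<omega> n)))"

lemma agree_mono:
  assumes "1 \<le> m" "m \<le> n" "agree n \<omega> \<omega>'"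
  shows "agree m \<omega> \<omega>'"
proof -
  have le: "(m - 1) div 2 \<le> (n - 1) div 2" using assms by (simp add: div_le_mono)
  show ?thesis
  proof (cases "(m - 1) div 2 < (n - 1) div 2")
    case True
    then show ?thesis using assms le unfolding agree_def by (auto simp: Let_def)
  next
    case False
    with le have eq: "(m - 1) div 2 = (n - 1) div 2" by simp
    \<comment> \<open>For a common value l of \<open>(t - 1) div 2\<close> only the times 2l + 1 and
      2l + 2 are left.\<close>
    have "even m \<Longrightarrow> even n" using eq assms by presburger
    then show ?thesis using assms eq unfolding agree_def by (auto simp: Let_def)
  qed
qed

lemma sum_diffs:
  "(\<Sum>t=1..2 * k + 1. a t *\<^sub>R diffs t \<omega>) = a 1 *\<^sub>R c + (\<Sum>n<k.
     a (2 * n + 2) *\<^sub>R (1 / 2) *\<^sub>R (H n (fst \<omega>) (fst \<omega> n) + H n (fst \<omega>) (snd \<omega> n)) +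
     a (2 * n + 3) *\<^sub>R (1 / 2) *\<^sub>R (H n (fst \<omega>) (fst \<omega> n) - H n (fst \<omega>) (snd \<omega> n)))"
proof (induction k)
  case 0 show ?case by (simp add: diffs_def)
next
  case (Suc k)
  have "2 * Suc k + 1 = Suc (Suc (2 * k + 1))" by simp
  then have "(\<Sum>t=1..2 * Suc k + 1. a t *\<^sub>R diffs t \<omega>) =
      (\<Sum>t=1..2 * k + 1. a t *\<^sub>R diffs t \<omega>) + a (2 * k + 2) *\<^sub>R diffs (2 * k + 2) \<omega>
      + a (2 * k + 3) *\<^sub>R diffs (2 * k + 3) \<omega>"
    by (simp add: numeral_3_eq_3)
  also have "diffs (2 * k + 2) \<omega> = (1 / 2) *\<^sub>R (H k (fst \<omega>) (fst \<omega> k) + H k (fst \<omega>) (snd \<omega> k))"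
    by (simp add: diffs_def Let_def)
  also have "diffs (2 * k + 3) \<omega> = (1 / 2) *\<^sub>R (H k (fst \<omega>) (fst \<omega> k) - H k (fst \<omega>) (snd \<omega> k))"
    by (simp add: diffs_def Let_def)
  finally show ?case unfolding Suc.IH by (simp add: algebra_simps)
qed

lemma agree_diffs:
  assumes t: "t \<in> {1..2 * N + 1}" and a: "agree t \<omega> \<omega>'"
  shows "diffs t \<omega> = diffs t \<omega>'"
proof -
  consider "t = 1" | n where "t = 2 * n + 2" "n < N" | n where "t = 2 * n + 3" "n < N"
  proof -
    have "t = 1 \<or> (\<exists>n. t = 2 * n + 2 \<and> n < N) \<or> (\<exists>n. t = 2 * n + 3 \<and> n < N)"
      using t by simp presburger
    then show thesis using that by blast
  qed
  then show ?thesis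
  proof cases
    case 1 then show ?thesis by (simp add: diffs_def)
  next
    case (2 n)
    have "H n (fst \<omega>) = H n (fst \<omega>')"
      using a 2 by (intro ext H_cong) (auto simp: agree_def)
    then show ?thesis using a 2 by (auto simp: diffs_def agree_def Let_def add.commute)
  next
    case (3 n)
    have "H n (fst \<omega>) = H n (fst \<omega>')"
      using a 3 by (intro ext H_cong) (auto simp: agree_def)
    then show ?thesis using a 3 by (auto simp: diffs_def agree_def Let_def)
  qed
qed

text \<open>A saturated set at an odd time does not constrain the letters with index n, so either
  may be resampled, and \<open>H_sum\<close> makes both sums vanish. At an even time it is invariant
  under exchanging these two letters, and the exchange negates the next difference.\<close>

lemma sum_diffs_saturated:
  assumes t: "t \<in> {1..<2 * N + 1}" and A: "A \<subseteq> words N C \<times> words N C"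
    and sat: "\<And>\<omega> \<omega>'. \<omega> \<in> A \<Longrightarrow> \<omega>' \<in> words N C \<times> words N C \<Longrightarrow> agree t \<omega> \<omega>' \<Longrightarrow> \<omega>' \<in> A"
  shows "(\<Sum>\<omega>\<in>A. diffs (Suc t) \<omega>) = 0"
proof -
  have fin: "finite A" using A finite_words[OF C(1)] by (meson finite_SigmaI finite_subset)
  have "(\<exists>n. t = 2 * n + 1 \<and> n < N) \<or> (\<exists>n. t = 2 * n + 2 \<and> n < N)"
    using t by simp presburger
  then show ?thesis
  proof (elim disjE exE conjE)
    fix n assume n: "t = 2 * n + 1" "n < N"
    have upd1: "(x(n := z), y) \<in> A" and upd2: "(x, y(n := z)) \<in> A" if "(x, y) \<in> A" "z \<in> C" for x y z
      using that n A by (auto intro!: sat[of "(x, y)"] words_upd simp: agree_def)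
    have "real (card C) *\<^sub>R (\<Sum>\<omega>\<in>A. H n (fst \<omega>) (fst \<omega> n)) = (\<Sum>\<omega>\<in>A. \<Sum>z\<in>C. H n ((fst \<omega>)(n := z)) (((fst \<omega>)(n := z)) n))"
      by (subst sum_resample[where get = "\<lambda>\<omega>. fst \<omega> n" and upd = "\<lambda>\<omega> z. ((fst \<omega>)(n := z), snd \<omega>)" and A = A and C = C
          and \<Phi> = "\<lambda>\<omega>. H n (fst \<omega>) (fst \<omega> n)", unfolded fst_conv, symmetric])
        (use fin C upd1 A n in \<open>auto dest!: subsetD[OF A] simp: words_nth\<close>)
    \<comment> \<open>\<open>H n\<close> looks only at letters before n in its word argument, so
      overwriting letter n affects the last argument alone.\<close>
    also have "\<dots> = (\<Sum>\<omega>\<in>A. \<Sum>z\<in>C. H n (fst \<omega>) z)"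
      using n by (intro sum.cong refl) (simp, rule H_cong, auto)
    also have "\<dots> = 0" using A n by (intro sum.neutral ballI H_sum) auto
    finally have 1: "(\<Sum>\<omega>\<in>A. H n (fst \<omega>) (fst \<omega> n)) = 0" using C by simp
    have "real (card C) *\<^sub>R (\<Sum>\<omega>\<in>A. H n (fst \<omega>) (snd \<omega> n)) = (\<Sum>\<omega>\<in>A. \<Sum>z\<in>C. H n (fst \<omega>) (((snd \<omega>)(n := z)) n))"
      by (subst sum_resample[where get = "\<lambda>\<omega>. snd \<omega> n" and upd = "\<lambda>\<omega> z. (fst \<omega>, (snd \<omega>)(n := z))" and A = A and C = C
          and \<Phi> = "\<lambda>\<omega>. H n (fst \<omega>) (snd \<omega> n)", unfolded fst_conv snd_conv, symmetric])
        (use fin C upd2 A n in \<open>auto dest!: subsetD[OF A] simp: words_nth\<close>)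
    also have "\<dots> = (\<Sum>\<omega>\<in>A. 0)"
      by (rule sum.cong) (use A n in \<open>auto intro!: H_sum\<close>)
    also have "\<dots> = 0" by simp
    finally have 2: "(\<Sum>\<omega>\<in>A. H n (fst \<omega>) (snd \<omega> n)) = 0" using C by simp
    have "diffs (Suc t) \<omega> = (1 / 2) *\<^sub>R (H n (fst \<omega>) (fst \<omega> n) + H n (fst \<omega>) (snd \<omega> n))" for \<omega>
      using n by (simp add: diffs_def Let_def)
    then show ?thesis using 1 2 by (simp add: sum.distrib flip: scaleR_sum_right)
  next
    fix n assume n: "t = 2 * n + 2" "n < N"
    define sw :: "(nat \<Rightarrow> 'c) \<times> (nat \<Rightarrow> 'c) \<Rightarrow> (nat \<Rightarrow> 'c) \<times> (nat \<Rightarrow> 'c)"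
      where "sw \<omega> = ((fst \<omega>)(n := snd \<omega> n), (snd \<omega>)(n := fst \<omega> n))" for \<omega>
    have sw: "sw \<omega> \<in> A" if "\<omega> \<in> A" for \<omega>
    proof (rule sat[OF that])
      show "sw \<omega> \<in> words N C \<times> words N C"
        using subsetD[OF A that] n unfolding sw_def mem_Times_iff fst_conv snd_conv
        by (intro conjI words_upd words_nth[of _ N C n]) blast+
    qed (use n in \<open>auto simp: agree_def sw_def\<close>)
    have sw2: "sw (sw \<omega>) = \<omega>" for \<omega> by (simp add: sw_def)
    have "diffs (Suc t) (sw \<omega>) = - diffs (Suc t) \<omega>" for \<omega>
    proof -
      have "H n ((fst \<omega>)(n := z)) = H n (fst \<omega>)" for z using n by (intro ext H_cong) auto
      then show ?thesis using n by (simp add: diffs_def Let_def sw_def algebra_simps)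
    qed
    then have "(\<Sum>\<omega>\<in>A. diffs (Suc t) \<omega>) = (\<Sum>\<omega>\<in>A. - diffs (Suc t) \<omega>)"
      by (intro sum.reindex_bij_witness[where i = sw and j = sw]) (auto simp: sw sw2)
    then have "2 *\<^sub>R (\<Sum>\<omega>\<in>A. diffs (Suc t) \<omega>) = 0"
      by (simp add: sum_negf scaleR_2 eq_neg_iff_add_eq_0)
    then show ?thesis by simp
  qed
qed

text \<open>The weights \<delta> serve to obtain both directions: \<delta> = 1 passes from the
  original sum to the signed one, \<delta> = \<epsilon> passes back, since signs square to
  1.\<close>

lemma decoupling_signs:
  assumes "\<And>t. t \<in> {1..2 * N + 1} \<Longrightarrow> \<epsilon> t \<in> {-1, 1}"
  shows "(\<Sum>\<omega>\<in>words N C \<times> words N C. norm (\<Sum>t=1..2 * N + 1. \<epsilon> t *\<^sub>R \<delta> t *\<^sub>R diffs t \<omega>) powr p)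
    \<le> \<beta> powr p * (\<Sum>\<omega>\<in>words N C \<times> words N C. norm (\<Sum>t=1..2 * N + 1. \<delta> t *\<^sub>R diffs t \<omega>) powr p)"
proof (rule UMD_finite[OF umd p, where r = agree])
  show "finite (words N C \<times> words N C)" "words N C \<times> words N C \<noteq> {}"
    using C by (auto simp: finite_words words_nonempty)
  show "agree t \<omega>' \<omega>" if "agree t \<omega> \<omega>'" for t \<omega> \<omega>'
    using that unfolding agree_def Let_def by metis
  show "agree m \<omega> \<omega>'" if "1 \<le> m" "m \<le> n" "agree n \<omega> \<omega>'" for m n \<omega> \<omega>'
    using that by (rule agree_mono)
  show "\<delta> t *\<^sub>R diffs t \<omega> = \<delta> t *\<^sub>R diffs t \<omega>'" if "t \<in> {1..2 * N + 1}" "agree t \<omega> \<omega>'" for t \<omega> \<omega>'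
    using agree_diffs[OF that] by simp
  show "(\<Sum>\<omega>\<in>A. \<delta> (Suc t) *\<^sub>R diffs (Suc t) \<omega>) = 0"
    if "t \<in> {1..<2 * N + 1}" "A \<subseteq> words N C \<times> words N C"
    "\<And>\<omega> \<omega>'. \<omega> \<in> A \<Longrightarrow> \<omega>' \<in> words N C \<times> words N C \<Longrightarrow> agree t \<omega> \<omega>' \<Longrightarrow> \<omega>' \<in> A" for t A
    using sum_diffs_saturated[OF that] by (simp flip: scaleR_sum_right)
qed (use assms in auto)

text \<open>Passing from \<open>H n x (x n)\<close> to \<open>\<epsilon> n *\<^sub>R H n x (y n)\<close> changes only signs in the martingale difference
  sequence made of the symmetric and antisymmetric parts in \<open>(x n, y n)\<close>.\<close>

lemma decoupling:
  assumes \<epsilon>: "\<And>n. n < N \<Longrightarrow> \<epsilon> n \<in> {-1, 1}" and \<sigma>: "\<sigma> \<in> {-1, 1}"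
  shows "(\<Sum>x\<in>words N C. \<Sum>y\<in>words N C. norm (\<sigma> *\<^sub>R c + (\<Sum>n<N. \<epsilon> n *\<^sub>R H n x (y n))) powr p)
      \<le> \<beta> powr p * (\<Sum>x\<in>words N C. \<Sum>y\<in>words N C. norm (c + (\<Sum>n<N. H n x (x n))) powr p)" (is "?Y \<le> \<beta> powr p * ?X")
    and "(\<Sum>x\<in>words N C. \<Sum>y\<in>words N C. norm (c + (\<Sum>n<N. H n x (x n))) powr p)
      \<le> \<beta> powr p * (\<Sum>x\<in>words N C. \<Sum>y\<in>words N C. norm (\<sigma> *\<^sub>R c + (\<Sum>n<N. \<epsilon> n *\<^sub>R H n x (y n))) powr p)"
proof -
  \<comment> \<open>If s and a are the two halves, then \<open>H n x (x n)\<close> is s + a and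
    \<open>H n x (y n)\<close> is s - a; hence the sign \<epsilon> n at even times and its negative
    at odd ones.\<close>
  define e where "e t = (if t \<le> 1 then \<sigma> else if even t then \<epsilon> ((t - 1) div 2) else - \<epsilon> ((t - 1) div 2 - 1))" for t :: nat
  have e: "e t \<in> {-1, 1}" if t: "t \<in> {1..2 * N + 1}" for t
  proof -
    consider "t \<le> 1" | "even t" "1 < t" "(t - 1) div 2 < N" | "odd t" "1 < t" "(t - 1) div 2 - 1 < N"
    proof -
      have "t \<le> 1 \<or> even t \<and> 1 < t \<and> (t - 1) div 2 < N \<or> odd t \<and> 1 < t \<and> (t - 1) div 2 - 1 < N"
        using t by simp presburger
      then show thesis using that by blast
    qed
    then show ?thesis
    proof cases
      case 2 then show ?thesis using \<epsilon>[of "(t - 1) div 2"] by (simp add: e_def)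
    next
      case 3 then show ?thesis using \<epsilon>[of "(t - 1) div 2 - 1"] by (auto simp: e_def)
    qed (use \<sigma> in \<open>simp add: e_def\<close>)
  qed
  have e_eq: "e 1 = \<sigma>" "\<And>n. e (2 * n + 2) = \<epsilon> n" "\<And>n. e (2 * n + 3) = - \<epsilon> n"
    unfolding e_def by simp_all
  have Y: "(\<Sum>t=1..2 * N + 1. e t *\<^sub>R diffs t \<omega>) = \<sigma> *\<^sub>R c + (\<Sum>n<N. \<epsilon> n *\<^sub>R H n (fst \<omega>) (snd \<omega> n))" for \<omega>
    unfolding sum_diffs e_eq
    by (auto intro!: sum.cong simp: algebra_simps simp flip: scaleR_add_left)
  have X: "(\<Sum>t=1..2 * N + 1. 1 *\<^sub>R diffs t \<omega>) = c + (\<Sum>n<N. H n (fst \<omega>) (fst \<omega> n))" for \<omega>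
    unfolding sum_diffs 
    by (auto intro!: sum.cong simp: algebra_simps simp flip: scaleR_add_left)
  have X': "(\<Sum>t=1..2 * N + 1. diffs t \<omega>) = c + (\<Sum>n<N. H n (fst \<omega>) (fst \<omega> n))" for \<omega>
    using X by simp
  have X'': "(\<Sum>t=1..2 * N + 1. e t *\<^sub>R e t *\<^sub>R diffs t \<omega>) = c + (\<Sum>n<N. H n (fst \<omega>) (fst \<omega> n))" for \<omega>
    unfolding X'[symmetric]
  proof (rule sum.cong)
    fix t assume "t \<in> {1..2 * N + 1}"
    from e[OF this] show "e t *\<^sub>R e t *\<^sub>R diffs t \<omega> = diffs t \<omega>" by auto
  qed simp
  have prod: "(\<Sum>x\<in>words N C. \<Sum>y\<in>words N C. f x y) = (\<Sum>\<omega>\<in>words N C \<times> words N C. f (fst \<omega>) (snd \<omega>))"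
    for f :: "_ \<Rightarrow> _ \<Rightarrow> real" by (simp add: sum.cartesian_product case_prod_beta)
  show "?Y \<le> \<beta> powr p * ?X"
    using decoupling_signs[of e "\<lambda>t. 1", OF e] unfolding prod by (simp only: scaleR_one Y X')
  show "?X \<le> \<beta> powr p * ?Y"
    using decoupling_signs[of e e, OF e] unfolding prod by (simp only: Y X'')
qed

end

section \<open>Random signs, symmetric convex hulls and \<open>R\<close>-bounds\<close>

lemma convex_on_powr_nonneg:
  assumes "1 \<le> p"
  shows "convex_on {0..} (\<lambda>x::real. x powr p)"
proof (rule convex_onI)
  fix t x y :: real assume t: "0 < t" "t < 1" and xy: "x \<in> {0..}" "y \<in> {0..}"
  \<comment> \<open>When one of the two points is 0, convexity reduces to this inequality, which
    holds because \<open>s powr p\<close> is at most s for s between 0 and 1.\<close>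
  have small: "(s * z) powr p \<le> s * z powr p" if "0 < s" "s < 1" "0 \<le> z" for s z :: real
  proof -
    have "s powr p \<le> s powr 1" using that assms by (intro powr_mono') auto
    then show ?thesis using that by (simp add: powr_mult mult_right_mono)
  qed
  show "((1 - t) *\<^sub>R x + t *\<^sub>R y) powr p \<le> (1 - t) * x powr p + t * y powr p"
  proof (cases "x = 0 \<or> y = 0")
    case True
    then show ?thesis using small[of t y] small[of "1 - t" x] t xy assms by auto
  next
    case False
    then show ?thesis using convex_onD[OF powr_convex[OF assms], of t x y] t xy by auto
  qed
qed simp

lemma convex_on_norm_powr:
  assumes "1 \<le> p"
  shows "convex_on UNIV (\<lambda>x::'e::real_normed_vector. norm x powr p)"
proof (rule convex_onI)
  fix t :: real and x y :: 'e assume t: "0 < t" "t < 1"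
  have "norm ((1 - t) *\<^sub>R x + t *\<^sub>R y) \<le> (1 - t) * norm x + t * norm y"
    using t by (intro norm_triangle_le) simp
  then have "norm ((1 - t) *\<^sub>R x + t *\<^sub>R y) powr p \<le> ((1 - t) * norm x + t * norm y) powr p"
    using assms by (intro powr_mono2) auto
  also have "\<dots> \<le> (1 - t) * norm x powr p + t * norm y powr p"
    using convex_onD[OF convex_on_powr_nonneg[OF assms], of t "norm x" "norm y"] t by simp
  finally show "norm ((1 - t) *\<^sub>R x + t *\<^sub>R y) powr p \<le> (1 - t) * norm x powr p + t * norm y powr p" .
qed simp

lemma convex_on_norm_affine_powr:
  assumes "1 \<le> p"
  shows "convex_on UNIV (\<lambda>x::'e::real_normed_vector. norm (w + s *\<^sub>R x) powr p)"
proof (rule convex_onI)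
  fix t :: real and x y :: 'e assume t: "0 < t" "t < 1"
  have "w + s *\<^sub>R ((1 - t) *\<^sub>R x + t *\<^sub>R y) = (1 - t) *\<^sub>R (w + s *\<^sub>R x) + t *\<^sub>R (w + s *\<^sub>R y)"
    by (simp add: algebra_simps)
  then show "norm (w + s *\<^sub>R ((1 - t) *\<^sub>R x + t *\<^sub>R y)) powr p
      \<le> (1 - t) * norm (w + s *\<^sub>R x) powr p + t * norm (w + s *\<^sub>R y) powr p"
    using convex_onD[OF convex_on_norm_powr[OF assms], of t "w + s *\<^sub>R x" "w + s *\<^sub>R y"] t by simp
qed simp

text \<open>Jensen for the mean of the \<open>u i\<close> with equal weights, rescaled by
  \<open>card I\<close>.\<close>

lemma norm_sum_powr_le:
  fixes u :: "'i \<Rightarrow> 'e::real_normed_vector"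
  assumes "1 \<le> p" "finite I"
  shows "norm (\<Sum>i\<in>I. u i) powr p \<le> real (card I) powr (p - 1) * (\<Sum>i\<in>I. norm (u i) powr p)"
proof (cases "I = {}")
  case False
  define m where "m = real (card I)"
  have m: "0 < m" using False assms by (simp add: m_def card_gt_0_iff)
  have "norm (\<Sum>i\<in>I. (1 / m) *\<^sub>R u i) powr p \<le> (\<Sum>i\<in>I. (1 / m) * norm (u i) powr p)"
    by (rule convex_on_sum[OF assms(2) False convex_on_norm_powr[OF assms(1)]]) (use m in \<open>auto simp: m_def\<close>)
  then have "m powr p * norm (\<Sum>i\<in>I. (1 / m) *\<^sub>R u i) powr p \<le> m powr p * (\<Sum>i\<in>I. (1 / m) * norm (u i) powr p)"
    by (rule mult_left_mono) simp
  moreover have "m powr p * norm (\<Sum>i\<in>I. (1 / m) *\<^sub>R u i) powr p = norm (\<Sum>i\<in>I. u i) powr p"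
    using m by (subst powr_mult[symmetric]) (auto simp flip: scaleR_sum_right)
  moreover have "m powr p * (\<Sum>i\<in>I. (1 / m) * norm (u i) powr p) = m powr (p - 1) * (\<Sum>i\<in>I. norm (u i) powr p)"
    using m by (simp add: powr_diff flip: sum_distrib_left sum_divide_distrib)
  ultimately show ?thesis by (simp add: m_def)
qed simp

section \<open>Rademacher sums and symmetric convex hulls\<close>

definition signs :: "nat \<Rightarrow> (nat \<Rightarrow> real) set" where
  "signs N = words N {-1, 1}"

text \<open>This is 2 ^ N times the p-th moment of a Rademacher sum. Without normalisation, moments
  over signs and over words are plain finite sums that can be interchanged.\<close>

definition sign_sum :: "real \<Rightarrow> nat \<Rightarrow> (nat \<Rightarrow> 'e::real_normed_vector) \<Rightarrow> real" where
  "sign_sum p N v = (\<Sum>\<epsilon>\<in>signs N. norm (\<Sum>n<N. \<epsilon> n *\<^sub>R v n) powr p)"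

lemma finite_signs [simp]: "finite (signs N)"
  by (simp add: signs_def finite_words)

lemma signs_nth: "\<epsilon> \<in> signs N \<Longrightarrow> n < N \<Longrightarrow> \<epsilon> n \<in> {-1, 1}"
  unfolding signs_def by (rule words_nth)

lemma sum_signs_flip:
  assumes "n < N"
  shows "(\<Sum>\<epsilon>\<in>signs N. f (\<epsilon>(n := - \<epsilon> n))) = (\<Sum>\<epsilon>\<in>signs N. f \<epsilon>)"
proof -
  have flip: "\<epsilon>(n := - \<epsilon> n) \<in> signs N" if "\<epsilon> \<in> signs N" for \<epsilon>
  proof -
    have "- \<epsilon> n \<in> {-1, 1}" using signs_nth[OF that assms] by auto
    then show ?thesis using that assms unfolding signs_def by (intro words_upd)
  qed
  show ?thesis
    by (rule sum.reindex_bij_witness[where i = "\<lambda>\<epsilon>. \<epsilon>(n := - \<epsilon> n)" and j = "\<lambda>\<epsilon>. \<epsilon>(n := - \<epsilon> n)"])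
      (simp_all add: flip)
qed

lemma sum_upd:
  assumes "(n::nat) < N"
  shows "(\<Sum>m<N. a m *\<^sub>R (v(n := u)) m) = (\<Sum>m\<in>{..<N} - {n}. a m *\<^sub>R v m) + a n *\<^sub>R u"
proof -
  have "(\<Sum>m<N. a m *\<^sub>R (v(n := u)) m) = a n *\<^sub>R (v(n := u)) n + (\<Sum>m\<in>{..<N} - {n}. a m *\<^sub>R (v(n := u)) m)"
    using assms by (intro sum.remove) auto
  also have "(\<Sum>m\<in>{..<N} - {n}. a m *\<^sub>R (v(n := u)) m) = (\<Sum>m\<in>{..<N} - {n}. a m *\<^sub>R v m)"
    by (intro sum.cong) auto
  finally show ?thesis by (simp add: add.commute)
qed

lemma sign_sum_uminus:
  assumes "n < N"
  shows "sign_sum p N (v(n := - u)) = sign_sum p N (v(n := u))"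
proof -
  define F where "F \<epsilon> = norm ((\<Sum>m\<in>{..<N} - {n}. \<epsilon> m *\<^sub>R v m) + \<epsilon> n *\<^sub>R u) powr p" for \<epsilon>
  have "(\<Sum>m\<in>{..<N} - {n}. (\<epsilon>(n := s)) m *\<^sub>R v m) = (\<Sum>m\<in>{..<N} - {n}. \<epsilon> m *\<^sub>R v m)" for \<epsilon> s
    by (intro sum.cong) auto
  then have "norm ((\<Sum>m\<in>{..<N} - {n}. \<epsilon> m *\<^sub>R v m) + \<epsilon> n *\<^sub>R - u) powr p = F (\<epsilon>(n := - \<epsilon> n))" for \<epsilon>
    unfolding F_def by simp
  then have "sign_sum p N (v(n := - u)) = (\<Sum>\<epsilon>\<in>signs N. F (\<epsilon>(n := - \<epsilon> n)))"
    unfolding sign_sum_def sum_upd[OF assms] by simp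
  also have "\<dots> = (\<Sum>\<epsilon>\<in>signs N. F \<epsilon>)" by (rule sum_signs_flip[OF assms])
  also have "\<dots> = sign_sum p N (v(n := u))"
    unfolding sign_sum_def sum_upd[OF assms] F_def ..
  finally show ?thesis .
qed

lemma sign_sum_convex:
  fixes v :: "nat \<Rightarrow> 'e::real_normed_vector"
  assumes "n < N" "1 \<le> p"
  shows "convex_on UNIV (\<lambda>u. sign_sum p N (v(n := u)))"
proof -
  have "convex_on UNIV (\<lambda>u. \<Sum>\<epsilon>\<in>S. norm ((\<Sum>m\<in>{..<N} - {n}. \<epsilon> m *\<^sub>R v m) + \<epsilon> n *\<^sub>R u) powr p)"
    if "finite S" for S
    using that
    by (induction S rule: finite_induct)
      (auto simp: convex_on_const intro!: convex_on_add convex_on_norm_affine_powr assms)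
  from this[OF finite_signs] show ?thesis unfolding sign_sum_def sum_upd[OF assms(1)] .
qed

lemma sign_sum_continuous:
  fixes v :: "nat \<Rightarrow> 'e::real_normed_vector"
  assumes "n < N" "0 < p"
  shows "continuous_on UNIV (\<lambda>u. sign_sum p N (v(n := u)))"
  unfolding sign_sum_def sum_upd[OF assms(1)]
proof (rule continuous_on_sum)
  fix \<epsilon> :: "nat \<Rightarrow> real"
  show "continuous_on UNIV (\<lambda>u. norm ((\<Sum>m\<in>{..<N} - {n}. \<epsilon> m *\<^sub>R v m) + \<epsilon> n *\<^sub>R u) powr p)"
    by (rule continuous_on_powr') (use assms in \<open>auto intro!: continuous_intros\<close>)
qed

text \<open>The closed absolutely convex hull, written as an intersection so that a property spreads
  from \<open>S\<close> to the hull once it defines a closed, convex, symmetric set.\<close>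

definition sym_hull :: "'e::real_normed_vector set \<Rightarrow> 'e set" where
  "sym_hull S = \<Inter>{C. closed C \<and> convex C \<and> uminus ` C \<subseteq> C \<and> S \<subseteq> C}"

lemma closed_sym_hull: "closed (sym_hull S)"
  unfolding sym_hull_def by (auto intro: closed_Inter)

lemma convex_sym_hull: "convex (sym_hull S)"
  unfolding sym_hull_def by (auto intro: convex_Inter)

lemma subset_sym_hull: "S \<subseteq> sym_hull S"
  unfolding sym_hull_def by auto

lemma sym_hull_uminus: "x \<in> sym_hull S \<Longrightarrow> - x \<in> sym_hull S"
  unfolding sym_hull_def by auto

lemma sym_hull_half_diff:
  assumes "x \<in> sym_hull S" "y \<in> sym_hull S"
  shows "(1 / 2) *\<^sub>R (x - y) \<in> sym_hull S"
proof -
  have "(1 / 2) *\<^sub>R x + (1 / 2) *\<^sub>R (- y) \<in> sym_hull S"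
    using assms by (intro convexD[OF convex_sym_hull] sym_hull_uminus) auto
  then show ?thesis by (simp add: algebra_simps)
qed

text \<open>Zero is half of x - x. Nonemptiness matters: the empty set is closed, convex and
  symmetric, so the hull of the empty set is empty.\<close>

lemma zero_in_sym_hull: "S \<noteq> {} \<Longrightarrow> 0 \<in> sym_hull S"
  using sym_hull_half_diff subset_sym_hull by fastforce

text \<open>As a function of one slot, \<open>sign_sum\<close> is continuous, convex and even, so
  its sublevel set at \<open>c\<close> absorbs the hull as soon as it contains the generators. The
  slots are enlarged one after another.\<close>

lemma sign_sum_sym_hull:
  fixes S :: "nat \<Rightarrow> 'e::real_normed_vector set"
  assumes p: "1 \<le> p" and S: "\<And>v. (\<And>n. n < N \<Longrightarrow> v n \<in> S n) \<Longrightarrow> sign_sum p N v \<le> c"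
    and v: "\<And>n. n < N \<Longrightarrow> v n \<in> sym_hull (S n)"
  shows "sign_sum p N v \<le> c"
proof -
  have "sign_sum p N v \<le> c" if "k \<le> N" "\<And>n. n < k \<Longrightarrow> v n \<in> sym_hull (S n)"
     "\<And>n. k \<le> n \<Longrightarrow> n < N \<Longrightarrow> v n \<in> S n" for k v
    using that
  proof (induction k arbitrary: v)
    case 0 then show ?case using S by auto
  next
    case (Suc k)
    define D where "D = {u. sign_sum p N (v(k := u)) \<le> c}"
    have k: "k < N" using Suc by simp
    have "closed D" unfolding D_def
      by (rule closed_Collect_le) (use sign_sum_continuous[OF k, of p v] p in auto)
    moreover have "convex D"
    proof (rule convexI)
      fix x y :: 'e and s t :: real assume *: "x \<in> D" "y \<in> D" "0 \<le> s" "0 \<le> t" "s + t = 1"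
      have "sign_sum p N (v(k := s *\<^sub>R x + t *\<^sub>R y)) \<le> s * sign_sum p N (v(k := x)) + t * sign_sum p N (v(k := y))"
      proof -
        have s: "s = 1 - t" using * by simp
        show ?thesis using convex_onD[OF sign_sum_convex[OF k p, of v], of t x y] * unfolding s by simp
      qed
      also have "\<dots> \<le> s * c + t * c" using * by (intro add_mono mult_left_mono) (auto simp: D_def)
      also have "\<dots> = c" using * by (simp flip: distrib_right)
      finally show "s *\<^sub>R x + t *\<^sub>R y \<in> D" by (simp add: D_def)
    qed
    moreover have "uminus ` D \<subseteq> D" by (auto simp: D_def sign_sum_uminus[OF k])
    moreover have "S k \<subseteq> D"
    proof
      fix u assume "u \<in> S k"
      then have "sign_sum p N (v(k := u)) \<le> c"
        using Suc.prems by (intro Suc.IH) auto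
      then show "u \<in> D" by (simp add: D_def)
    qed
    moreover have "v k \<in> sym_hull (S k)" using Suc by simp
    ultimately have "v k \<in> D" unfolding sym_hull_def by blast
    then show ?case by (simp add: D_def)
  qed
  from this[of N] v show ?thesis by simp
qed

text \<open>Two encodings of N signs are matched: \<open>random_signs\<close> uses the indices 1 to
  N with value 0 elsewhere, \<open>signs\<close> uses the indices below N and extensional
  functions.\<close>

lemma expectation_random_signs:
  fixes f :: "(nat \<Rightarrow> real) \<Rightarrow> real"
  shows "measure_pmf.expectation (random_signs N) f = (\<Sum>\<epsilon>\<in>signs N. f (\<lambda>n. if n \<in> {1..N} then \<epsilon> (n - 1) else 0)) / 2 ^ N"
proof -
  define P where "P = PiE_dflt {1..N} 0 (\<lambda>_. {-1, 1::real})"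
  have fin: "finite P" unfolding P_def by (intro finite_PiE_dflt) auto
  have ne: "P \<noteq> {}" by (simp add: P_def PiE_dflt_empty_iff)
  have eq: "random_signs N = pmf_of_set P"
    unfolding random_signs_def P_def by (rule Pi_pmf_of_set) auto
  have "measure_pmf.expectation (random_signs N) f = (\<Sum>\<epsilon>\<in>P. f \<epsilon>) / card P"
    unfolding eq by (rule integral_pmf_of_set[OF ne fin])
  also have "card P = 2 ^ N" unfolding P_def by (subst card_PiE_dflt) (auto simp: numeral_2_eq_2)
  also have "(\<Sum>\<epsilon>\<in>P. f \<epsilon>) = (\<Sum>\<epsilon>\<in>signs N. f (\<lambda>n. if n \<in> {1..N} then \<epsilon> (n - 1) else 0))"
  proof (rule sum.reindex_bij_witness)
    fix \<epsilon> assume "\<epsilon> \<in> P"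
    then have \<epsilon>: "\<And>n. n \<in> {1..N} \<Longrightarrow> \<epsilon> n \<in> {-1, 1}" "\<And>n. n \<notin> {1..N} \<Longrightarrow> \<epsilon> n = 0"
      by (auto simp: P_def PiE_dflt_def)
    show "restrict (\<lambda>n. \<epsilon> (Suc n)) {..<N} \<in> signs N"
      unfolding signs_def words_def using \<epsilon>(1) by (intro restrict_PiE_iff[THEN iffD2] ballI) auto
    show eq: "(\<lambda>n. if n \<in> {1..N} then restrict (\<lambda>n. \<epsilon> (Suc n)) {..<N} (n - 1) else 0) = \<epsilon>"
      using \<epsilon>(2) by (intro ext) auto
    show "f (\<lambda>n. if n \<in> {1..N} then restrict (\<lambda>n. \<epsilon> (Suc n)) {..<N} (n - 1) else 0) = f \<epsilon>"
      unfolding eq ..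
  next
    fix \<epsilon> assume \<epsilon>: "\<epsilon> \<in> signs N"
    have "\<epsilon> (n - 1) \<in> {-1, 1}" if "n \<in> {1..N}" for n
      using signs_nth[OF \<epsilon>, of "n - 1"] that by auto
    then show "(\<lambda>n. if n \<in> {1..N} then \<epsilon> (n - 1) else 0) \<in> P"
      unfolding P_def PiE_dflt_def by auto
    show "restrict (\<lambda>n. (\<lambda>n. if n \<in> {1..N} then \<epsilon> (n - 1) else 0) (Suc n)) {..<N} = \<epsilon>"
      using \<epsilon> by (intro ext) (auto simp: signs_def words_def PiE_iff extensional_def)
  qed
  finally show ?thesis by simp
qed

text \<open>Taking p-th powers in the \<open>R\<close>-bound removes the roots, and the weight 2 ^ N
  of the uniform law cancels.\<close>

lemma sign_sum_R_bound:
  fixes T :: "nat \<Rightarrow> 'e::banach \<Rightarrow>\<^sub>L 'e"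
  assumes R: "R_bound p \<T> C" and p: "0 < p" and T: "\<And>n. n < N \<Longrightarrow> T n \<in> \<T>"
  shows "sign_sum p N (\<lambda>n. blinfun_apply (T n) (e n)) \<le> C powr p * sign_sum p N e"
proof -
  have nn: "0 \<le> sign_sum p N v" for v :: "nat \<Rightarrow> 'e" by (auto simp: sign_sum_def intro!: sum_nonneg)
  have C: "0 \<le> C" using R by (simp add: R_bound_def)
  have T': "\<forall>n\<in>{1..N}. T (n - 1) \<in> \<T>" using T by auto
  have "(sign_sum p N (\<lambda>n. blinfun_apply (T n) (e n)) / 2 ^ N) powr (1 / p)
    \<le> C * (sign_sum p N e / 2 ^ N) powr (1 / p)"
    using R[unfolded R_bound_def, THEN conjunct2, rule_format, of N "\<lambda>n. T (n - 1)" "\<lambda>n. e (n - 1)",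
        unfolded expectation_random_signs] T'
    by (simp add: sign_sum_def sum.atLeast1_atMost_eq)
  then have "((sign_sum p N (\<lambda>n. blinfun_apply (T n) (e n)) / 2 ^ N) powr (1 / p)) powr p
    \<le> (C * (sign_sum p N e / 2 ^ N) powr (1 / p)) powr p"
    using p by (intro powr_mono2) auto
  then show ?thesis
    using p C nn[of e] nn[of "\<lambda>n. blinfun_apply (T n) (e n)"]
    by (subst (asm) powr_mult) (auto simp: powr_powr field_simps)
qed

text \<open>The random vector \<open>\<epsilon> h(y)\<close> is a symmetric independent summand that may be replaced by \<open>\<epsilon> f(y)\<close>.\<close>

definition sign_dominated :: "real \<Rightarrow> 'c set \<Rightarrow> ('c \<Rightarrow> 'e::real_normed_vector) \<Rightarrow> ('c \<Rightarrow> 'e) \<Rightarrow> bool" where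
  "sign_dominated p C h f \<longleftrightarrow> (\<forall>w. (\<Sum>y\<in>C. norm (w + h y) powr p + norm (w - h y) powr p)
     \<le> (\<Sum>y\<in>C. norm (w + f y) powr p + norm (w - f y) powr p))"

lemma convex_on_sym_norm_powr:
  assumes "1 \<le> p"
  shows "convex_on UNIV (\<lambda>u::'e::real_normed_vector. norm (w + u) powr p + norm (w - u) powr p)"
  using convex_on_add[OF convex_on_norm_affine_powr[OF assms, of w 1] convex_on_norm_affine_powr[OF assms, of w "-1"]]
  by simp

text \<open>The function \<open>norm (w + u) powr p + norm (w - u) powr p\<close> of u is convex and
  even, and the new vector is the midpoint of \<open>h y\<close> and \<open>- g y\<close>. This is
  the mechanism by which a difference of two averages costs a factor 2.\<close>

lemma sign_dominated_half_diff:
  assumes p: "1 \<le> p" and h: "sign_dominated p C h f" and g: "sign_dominated p C g f"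
  shows "sign_dominated p C (\<lambda>y. (1 / 2) *\<^sub>R (h y - g y)) f"
  unfolding sign_dominated_def
proof
  fix w :: 'b
  let ?\<phi> = "\<lambda>u. norm (w + u) powr p + norm (w - u) powr p"
  have "?\<phi> ((1 / 2) *\<^sub>R (h y - g y)) \<le> (1 / 2) * ?\<phi> (h y) + (1 / 2) * ?\<phi> (g y)" for y
    using convex_onD[OF convex_on_sym_norm_powr[OF p, of w], of "1 / 2" "h y" "- g y"]
    by (simp add: algebra_simps)
  then have "(\<Sum>y\<in>C. ?\<phi> ((1 / 2) *\<^sub>R (h y - g y))) \<le> (\<Sum>y\<in>C. (1 / 2) * ?\<phi> (h y) + (1 / 2) * ?\<phi> (g y))"
    by (rule sum_mono)
  also have "\<dots> = (1 / 2) * (\<Sum>y\<in>C. ?\<phi> (h y)) + (1 / 2) * (\<Sum>y\<in>C. ?\<phi> (g y))"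
    by (subst sum.distrib) (simp only: sum_distrib_left)
  also have "\<dots> \<le> (1 / 2) * (\<Sum>y\<in>C. ?\<phi> (f y)) + (1 / 2) * (\<Sum>y\<in>C. ?\<phi> (f y))"
    using h g unfolding sign_dominated_def by (intro add_mono mult_left_mono) auto
  also have "\<dots> = (\<Sum>y\<in>C. ?\<phi> (f y))" by simp
  finally show "(\<Sum>y\<in>C. ?\<phi> ((1 / 2) *\<^sub>R (h y - g y))) \<le> (\<Sum>y\<in>C. ?\<phi> (f y))" .
qed

text \<open>The sets \<open>B y\<close> are the cells of a partition of \<open>C\<close> into cells
  of size \<open>s\<close>, and replacing \<open>f\<close> by its cell averages is a conditional
  expectation. Jensen acts in each cell; after exchanging the sums, each z is counted s times with
  weight 1 / s.\<close>

lemma sign_dominated_average: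
  assumes p: "1 \<le> p" and C: "finite C" and s: "0 < s"
    and B: "\<And>y. y \<in> C \<Longrightarrow> y \<in> B y" "\<And>y. y \<in> C \<Longrightarrow> B y \<subseteq> C" "\<And>y. y \<in> C \<Longrightarrow> card (B y) = s"
      "\<And>y z. y \<in> C \<Longrightarrow> z \<in> B y \<Longrightarrow> B z = B y"
  shows "sign_dominated p C (\<lambda>y. (1 / s) *\<^sub>R (\<Sum>z\<in>B y. f z)) f"
  unfolding sign_dominated_def
proof
  fix w :: 'b
  let ?\<phi> = "\<lambda>u. norm (w + u) powr p + norm (w - u) powr p"
  have "?\<phi> ((1 / s) *\<^sub>R (\<Sum>z\<in>B y. f z)) \<le> (\<Sum>z\<in>B y. (1 / s) * ?\<phi> (f z))" if "y \<in> C" for y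
    unfolding scaleR_sum_right
  proof (rule convex_on_sum[OF _ _ convex_on_sym_norm_powr[OF p]])
    show "finite (B y)" using B(2)[OF that] C by (rule finite_subset)
    show "B y \<noteq> {}" "(\<Sum>z\<in>B y. 1 / real s) = 1" using B(1,3)[OF that] s by auto
  qed auto
  then have "(\<Sum>y\<in>C. ?\<phi> ((1 / s) *\<^sub>R (\<Sum>z\<in>B y. f z))) \<le> (\<Sum>y\<in>C. \<Sum>z\<in>B y. (1 / s) * ?\<phi> (f z))"
    by (rule sum_mono)
  also have "\<dots> = (\<Sum>y\<in>C. \<Sum>z\<in>{z \<in> C. z \<in> B y}. (1 / s) * ?\<phi> (f z))"
    by (intro sum.cong refl) (use B(2) in auto)
  also have "\<dots> = (\<Sum>z\<in>C. \<Sum>y\<in>{y \<in> C. z \<in> B y}. (1 / s) * ?\<phi> (f z))"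
    by (rule sum.swap_restrict[OF C C])
  also have "\<dots> = (\<Sum>z\<in>C. ?\<phi> (f z))"
  proof (rule sum.cong[OF refl])
    fix z assume z: "z \<in> C"
    have "{y \<in> C. z \<in> B y} = B z"
    proof (intro set_eqI iffI)
      fix y assume "y \<in> {y \<in> C. z \<in> B y}"
      then show "y \<in> B z" using B(1)[of y] B(4)[of y z] by auto
    next
      fix y assume y: "y \<in> B z"
      then show "y \<in> {y \<in> C. z \<in> B y}" using B(4)[OF z y] B(1)[OF z] B(2)[OF z] by auto
    qed
    then show "(\<Sum>y\<in>{y \<in> C. z \<in> B y}. (1 / s) * ?\<phi> (f z)) = ?\<phi> (f z)"
      using B(3)[OF z] s by simp
  qed
  finally show "(\<Sum>y\<in>C. ?\<phi> ((1 / s) *\<^sub>R (\<Sum>z\<in>B y. f z))) \<le> (\<Sum>z\<in>C. ?\<phi> (f z))" .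
qed

text \<open>A replacement argument, passing from \<open>f\<close> to \<open>h\<close> one slot at a
  time. Summing over the letter and the sign of that slot alone leaves exactly the form compared in
  \<open>sign_dominated\<close>, with the other slots making up the fixed vector w.\<close>

lemma sign_sum_dominated:
  fixes h f :: "nat \<Rightarrow> 'c \<Rightarrow> 'e::real_normed_vector"
  assumes C: "finite C" "C \<noteq> {}" and dom: "\<And>n. n < N \<Longrightarrow> sign_dominated p C (h n) (f n)"
  shows "(\<Sum>y\<in>words N C. sign_sum p N (\<lambda>n. h n (y n))) \<le> (\<Sum>y\<in>words N C. sign_sum p N (\<lambda>n. f n (y n)))"
proof -
  define G where "G g = (\<Sum>y\<in>words N C. sign_sum p N (\<lambda>n. g n (y n)))" for g :: "nat \<Rightarrow> 'c \<Rightarrow> 'e"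
  \<comment> \<open>Letter k and sign k are resampled independently; the factor
    \<open>2 * real (card C)\<close> counts the resamplings.\<close>
  have G_eq: "2 * real (card C) * G g = (\<Sum>y\<in>words N C. \<Sum>\<epsilon>\<in>signs N.
      \<Sum>z\<in>C. norm ((\<Sum>m\<in>{..<N} - {k}. \<epsilon> m *\<^sub>R g m (y m)) + g k z) powr p +
              norm ((\<Sum>m\<in>{..<N} - {k}. \<epsilon> m *\<^sub>R g m (y m)) - g k z) powr p)"
    if k: "k < N" for g k
  proof -
    let ?w = "\<lambda>\<epsilon> y. \<Sum>m\<in>{..<N} - {k}. \<epsilon> m *\<^sub>R g m (y m)"
    have upd: "sign_sum p N (\<lambda>n. g n ((y(k := z)) n)) = (\<Sum>\<epsilon>\<in>signs N. norm (?w \<epsilon> y + \<epsilon> k *\<^sub>R g k z) powr p)" for y z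
    proof -
      have "(\<lambda>n. g n ((y(k := z)) n)) = (\<lambda>n. g n (y n))(k := g k z)" by auto
      then have "sign_sum p N (\<lambda>n. g n ((y(k := z)) n)) = sign_sum p N ((\<lambda>n. g n (y n))(k := g k z))"
        by (simp only:)
      then show ?thesis unfolding sign_sum_def sum_upd[OF k] .
    qed
    have two: "2 * (\<Sum>\<epsilon>\<in>signs N. norm (?w \<epsilon> y + \<epsilon> k *\<^sub>R g k z) powr p)
       = (\<Sum>\<epsilon>\<in>signs N. norm (?w \<epsilon> y + g k z) powr p + norm (?w \<epsilon> y - g k z) powr p)" for y z
    proof -
      have w: "?w (\<epsilon>(k := s)) y = ?w \<epsilon> y" for \<epsilon> s by (intro sum.cong) auto
      have "real (card {-1, 1::real}) *\<^sub>R (\<Sum>\<epsilon>\<in>signs N. norm (?w \<epsilon> y + \<epsilon> k *\<^sub>R g k z) powr p)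
        = (\<Sum>\<epsilon>\<in>signs N. \<Sum>s\<in>{-1,1}. norm (?w (\<epsilon>(k := s)) y + (\<epsilon>(k := s)) k *\<^sub>R g k z) powr p)"
        unfolding signs_def by (rule sum_words_resample[OF _ k, symmetric]) simp
      then show ?thesis unfolding w by (simp add: add.commute)
    qed
    have "real (card C) *\<^sub>R G g = (\<Sum>y\<in>words N C. \<Sum>z\<in>C. sign_sum p N (\<lambda>n. g n ((y(k := z)) n)))"
      unfolding G_def by (rule sum_words_resample[OF C(1) k, symmetric])
    also have "2 * \<dots> = (\<Sum>y\<in>words N C. \<Sum>z\<in>C. \<Sum>\<epsilon>\<in>signs N. norm (?w \<epsilon> y + g k z) powr p + norm (?w \<epsilon> y - g k z) powr p)"
      by (subst sum_distrib_left, rule sum.cong[OF refl], subst sum_distrib_left, rule sum.cong[OF refl])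
        (simp only: upd two)
    also have "\<dots> = (\<Sum>y\<in>words N C. \<Sum>\<epsilon>\<in>signs N. \<Sum>z\<in>C. norm (?w \<epsilon> y + g k z) powr p + norm (?w \<epsilon> y - g k z) powr p)"
      by (intro sum.cong refl sum.swap)
    finally show ?thesis by simp
  qed
  \<comment> \<open>Interpolates between \<open>f\<close> at k = 0 and \<open>h\<close> at k =
    N.\<close>
  define mix where "mix k n = (if n < k then h n else f n)" for k n :: nat
  have step: "G (mix (Suc k)) \<le> G (mix k)" if k: "k < N" for k
  proof -
    have w: "(\<Sum>m\<in>{..<N} - {k}. \<epsilon> m *\<^sub>R mix (Suc k) m (y m)) = (\<Sum>m\<in>{..<N} - {k}. \<epsilon> m *\<^sub>R mix k m (y m))"
      for \<epsilon> :: "nat \<Rightarrow> real" and y :: "nat \<Rightarrow> 'c"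
      by (intro sum.cong) (auto simp: mix_def less_Suc_eq)
    have "2 * real (card C) * G (mix (Suc k)) \<le> 2 * real (card C) * G (mix k)"
      unfolding G_eq[OF k] w
      by (rule sum_mono, rule sum_mono) (use dom[OF k] in \<open>simp add: mix_def sign_dominated_def\<close>)
    moreover have "0 < 2 * real (card C)" using C by (simp add: card_gt_0_iff)
    ultimately show ?thesis by (simp add: mult_le_cancel_left_pos)
  qed
  have "G (mix k) \<le> G (mix 0)" if "k \<le> N" for k
    using that
  proof (induction k)
    case (Suc k) then show ?case using step[of k] by simp
  qed simp
  from this[of N] have "G (mix N) \<le> G (mix 0)" by simp
  moreover have "G (mix N) = G h" unfolding G_def sign_sum_def mix_def by (intro sum.cong refl) auto
  moreover have "mix 0 = f" by (auto simp: mix_def)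
  ultimately show ?thesis by (simp add: G_def)
qed

section \<open>Averages\<close>

lemma strongly_integrable_linear:
  fixes f g :: "'a \<Rightarrow> 'e::banach"
  assumes f: "strongly_integrable M f" and g: "strongly_integrable M g"
  shows "strongly_integrable M (\<lambda>x. a *\<^sub>R f x + b *\<^sub>R g x)"
    and "strong_integral M (\<lambda>x. a *\<^sub>R f x + b *\<^sub>R g x) = a *\<^sub>R strong_integral M f + b *\<^sub>R strong_integral M g"
proof -
  have cmult: "(\<integral>\<^sup>+x. norm (c *\<^sub>R u x) \<partial>M) < \<infinity>" if "strongly_integrable M u" for c and u :: "'a \<Rightarrow> 'e"
  proof -
    have u: "strongly_measurable M u" "(\<integral>\<^sup>+x. norm (u x) \<partial>M) < \<infinity>" using that by (auto simp: strongly_integrable_def)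
    obtain h where h [measurable]: "h \<in> borel_measurable M" and h': "AE x in M. h x = norm (u x)"
      using strongly_measurable_norm[OF u(1)] by metis
    have "(\<integral>\<^sup>+x. norm (c *\<^sub>R u x) \<partial>M) = (\<integral>\<^sup>+x. ennreal \<bar>c\<bar> * ennreal (h x) \<partial>M)"
      using h' by (intro nn_integral_cong_AE) (auto simp: ennreal_mult)
    also have "\<dots> = ennreal \<bar>c\<bar> * (\<integral>\<^sup>+x. h x \<partial>M)" by (rule nn_integral_cmult) auto
    also have "(\<integral>\<^sup>+x. h x \<partial>M) = (\<integral>\<^sup>+x. norm (u x) \<partial>M)"
      using h' by (intro nn_integral_cong_AE) auto
    finally show ?thesis using u(2) by (simp add: ennreal_mult_less_top)
  qed
  have sm: "strongly_measurable M f" "strongly_measurable M g"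
    using f g by (auto simp: strongly_integrable_def)
  have "(\<integral>\<^sup>+x. norm (a *\<^sub>R f x + b *\<^sub>R g x) \<partial>M) \<le> (\<integral>\<^sup>+x. norm (a *\<^sub>R f x) \<partial>M) + (\<integral>\<^sup>+x. norm (b *\<^sub>R g x) \<partial>M)"
    by (rule nn_integral_norm_add_le[OF strongly_measurable_cmult[OF sm(1)] strongly_measurable_cmult[OF sm(2)]])
      (rule norm_triangle_ineq)
  also have "\<dots> < \<infinity>" using cmult f g by simp
  finally show "strongly_integrable M (\<lambda>x. a *\<^sub>R f x + b *\<^sub>R g x)"
    unfolding strongly_integrable_def by (intro conjI strongly_measurable_add strongly_measurable_cmult sm)
  show "strong_integral M (\<lambda>x. a *\<^sub>R f x + b *\<^sub>R g x) = a *\<^sub>R strong_integral M f + b *\<^sub>R strong_integral M g"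
    by (rule strong_integral_eqI[OF has_strong_integral_linear[OF has_strong_integral_strong_integral[OF f]
          has_strong_integral_strong_integral[OF g]]])
qed

lemma strongly_integrable_zero: "strongly_integrable M (\<lambda>x. 0 :: 'e::banach)"
  by (simp add: strongly_integrable_def strongly_measurable_const)

lemma strongly_integrable_sum:
  fixes f :: "'i \<Rightarrow> 'a \<Rightarrow> 'e::banach"
  assumes "finite I" "\<And>i. i \<in> I \<Longrightarrow> strongly_integrable M (f i)"
  shows "strongly_integrable M (\<lambda>x. \<Sum>i\<in>I. f i x) \<and>
    strong_integral M (\<lambda>x. \<Sum>i\<in>I. f i x) = (\<Sum>i\<in>I. strong_integral M (f i))"
  using assms
proof (induction I rule: finite_induct)
  case empty
  show ?case using strongly_integrable_zero[of M] strongly_integrable_linear(2)[OF strongly_integrable_zero strongly_integrable_zero, of M 0 0]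
    by simp
next
  case (insert i I)
  then show ?case using strongly_integrable_linear[of M "f i" "\<lambda>x. \<Sum>i\<in>I. f i x" 1 1] by simp
qed

lemma strongly_integrable_set:
  assumes "strongly_integrable M f" "A \<in> sets M"
  shows "strongly_integrable M (\<lambda>x. indicator A x *\<^sub>R f x)"
proof -
  have "(\<integral>\<^sup>+x. norm (indicat_real A x *\<^sub>R f x) \<partial>M) \<le> (\<integral>\<^sup>+x. norm (f x) \<partial>M)"
    by (intro nn_integral_mono) (auto simp: indicator_def)
  then show ?thesis using assms unfolding strongly_integrable_def
    by (auto intro!: strongly_measurable_set)
qed

text \<open>Rests on t \<le> 1 + t^p for t \<ge> 0 and p \<ge> 1: the first summand is integrable on
  sets of finite measure, the second everywhere.\<close>

lemma in_Lp_strongly_integrable_set: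
  assumes f: "in_Lp M p f" and p: "1 \<le> p" and A: "A \<in> sets M" "emeasure M A < \<infinity>"
  shows "strongly_integrable M (\<lambda>x. indicator A x *\<^sub>R f x)"
proof -
  have sm: "strongly_measurable M f" and fin: "(\<integral>\<^sup>+x. norm (f x) powr p \<partial>M) < \<infinity>"
    using f by (auto simp: in_Lp_def)
  obtain h where h [measurable]: "h \<in> borel_measurable M" and h': "AE x in M. h x = norm (f x)" "\<And>x. 0 \<le> h x"
    using strongly_measurable_norm[OF sm] by metis
  note A [measurable]
  have "(\<integral>\<^sup>+x. norm (indicat_real A x *\<^sub>R f x) \<partial>M) \<le> (\<integral>\<^sup>+x. indicator A x + ennreal (h x powr p) \<partial>M)"
  proof (rule nn_integral_mono_AE)
    show "AE x in M. ennreal (norm (indicat_real A x *\<^sub>R f x)) \<le> indicator A x + ennreal (h x powr p)"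
      using h'(1)
    proof eventually_elim
      case (elim x)
      have "norm (f x) \<le> 1 + norm (f x) powr p"
      proof (cases "norm (f x) \<le> 1")
        case False
        then have "norm (f x) powr 1 \<le> norm (f x) powr p" using p by (intro powr_mono) auto
        then show ?thesis by simp
      qed (simp add: add_increasing2)
      then show ?case using elim
        by (auto simp: indicator_def ennreal_leI simp flip: ennreal_1 ennreal_plus)
    qed
  qed
  also have "\<dots> = emeasure M A + (\<integral>\<^sup>+x. ennreal (h x powr p) \<partial>M)"
    by (subst nn_integral_add) auto
  also have "(\<integral>\<^sup>+x. ennreal (h x powr p) \<partial>M) = (\<integral>\<^sup>+x. norm (f x) powr p \<partial>M)"
    using h'(1) by (intro nn_integral_cong_AE) auto
  also have "emeasure M A + \<dots> < \<infinity>" using fin A by simp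
  finally show ?thesis unfolding strongly_integrable_def using sm A by (auto intro!: strongly_measurable_set)
qed

section \<open>Jensen's inequality for averages\<close>

text \<open>The tangent of the convex power function at s, with all terms moved so that no
  subtraction occurs and the inequality can be integrated in \<open>ennreal\<close>.\<close>

lemma powr_above_tangent:
  fixes s t p :: real
  assumes "0 < s" "0 \<le> t" "1 \<le> p"
  shows "s powr p + p * s powr (p - 1) * t \<le> t powr p + p * s powr p"
proof -
  have "p * s powr (p - 1) * (t - s) \<le> t powr p - s powr p"
  proof (rule convex_on_imp_above_tangent[OF convex_on_powr_nonneg[OF assms(3)]])
    show "((\<lambda>x. x powr p) has_real_derivative p * s powr (p - 1)) (at s within {0..})"
      by (rule has_field_derivative_at_within[OF has_real_derivative_powr[OF assms(1)]])
    show "s \<in> interior {0..}" 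
      using assms by (intro interiorI[of "{0<..}"]) auto
  qed (use assms in auto)
  moreover have "s powr (p - 1) * s = s powr p" using assms by (simp add: powr_diff)
  moreover have "p * s powr (p - 1) * (t - s) = p * s powr (p - 1) * t - p * (s powr (p - 1) * s)"
    by (simp add: algebra_simps)
  ultimately show ?thesis by simp
qed

text \<open>The tangent inequality at \<open>s = norm (average Q f)\<close> is integrated over Q.
  Since \<open>s * \<mu>\<close> is at most the integral of the norm over Q, the term
  \<open>p * s powr p * \<mu>\<close> cancels from both sides and Jensen's inequality
  remains.\<close>

lemma average_powr_le:
  fixes f :: "real ^ 'd \<Rightarrow> 'e::banach"
  assumes p: "1 \<le> p" and Q: "Q \<in> sets lebesgue" "0 < measure lebesgue Q" "emeasure lebesgue Q < \<infinity>"
    and int: "strongly_integrable lebesgue (\<lambda>x. indicator Q x *\<^sub>R f x)"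
  shows "ennreal (measure lebesgue Q * norm (average Q f) powr p) \<le> (\<integral>\<^sup>+x. indicator Q x * ennreal (norm (f x) powr p) \<partial>lebesgue)"
proof (cases "average Q f = 0")
  case False
  define s \<mu> where "s = norm (average Q f)" and "\<mu> = measure lebesgue Q"
  have s: "0 < s" using False by (simp add: s_def)
  have \<mu>: "0 < \<mu>" "emeasure lebesgue Q = ennreal \<mu>"
    using Q by (simp_all add: \<mu>_def emeasure_eq_ennreal_measure less_top)
  note Q [measurable]
  obtain h where h [measurable]: "h \<in> borel_measurable lebesgue" and h': "AE x in lebesgue. h x = norm (indicat_real Q x *\<^sub>R f x)" "\<And>x. 0 \<le> h x"
    using strongly_measurable_norm[OF int[unfolded strongly_integrable_def, THEN conjunct1]] by metis
  have "ennreal (s * \<mu>) = ennreal (norm (strong_integral lebesgue (\<lambda>x. indicator Q x *\<^sub>R f x)))"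
    unfolding s_def average_def set_strong_integral_def using \<mu> by (simp add: \<mu>_def)
  also have "\<dots> \<le> (\<integral>\<^sup>+x. norm (indicat_real Q x *\<^sub>R f x) \<partial>lebesgue)"
    by (rule has_strong_integral_norm_le[OF has_strong_integral_strong_integral[OF int]])
  also have "\<dots> = (\<integral>\<^sup>+x. indicator Q x * ennreal (h x) \<partial>lebesgue)"
    using h'(1) by (intro nn_integral_cong_AE) (auto simp: indicator_def)
  finally have 1: "ennreal (s * \<mu>) \<le> (\<integral>\<^sup>+x. indicator Q x * ennreal (h x) \<partial>lebesgue)" .
  define c where "c = p * s powr (p - 1)"
  have c: "0 \<le> c" using p by (simp add: c_def)
  have cs: "c * s = p * s powr p" using s p by (simp add: c_def powr_diff)
  have "ennreal (s powr p * \<mu>) + ennreal (p * s powr p * \<mu>) = ennreal (s powr p) * ennreal \<mu> + ennreal c * ennreal (s * \<mu>)"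
    using s \<mu> c cs by (simp add: mult.assoc flip: ennreal_mult' cs)
  also have "\<dots> \<le> ennreal (s powr p) * ennreal \<mu> + ennreal c * (\<integral>\<^sup>+x. indicator Q x * ennreal (h x) \<partial>lebesgue)"
    using 1 by (intro add_left_mono mult_left_mono) auto
  also have "\<dots> = (\<integral>\<^sup>+x. ennreal (s powr p) * indicator Q x + ennreal c * (indicator Q x * ennreal (h x)) \<partial>lebesgue)"
    by (subst nn_integral_add) (auto simp: nn_integral_cmult \<mu>)
  also have "\<dots> \<le> (\<integral>\<^sup>+x. indicator Q x * ennreal (h x powr p) + ennreal (p * s powr p) * indicator Q x \<partial>lebesgue)"
    using powr_above_tangent[OF s h'(2) p] p s h'(2) c
    by (intro nn_integral_mono) (auto simp: indicator_def c_def intro!: ennreal_leI simp flip: ennreal_plus ennreal_mult')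
  also have "\<dots> = (\<integral>\<^sup>+x. indicator Q x * ennreal (h x powr p) \<partial>lebesgue) + ennreal (p * s powr p * \<mu>)"
    using \<mu> p by (subst nn_integral_add) (auto simp: nn_integral_cmult ennreal_mult)
  also have "(\<integral>\<^sup>+x. indicator Q x * ennreal (h x powr p) \<partial>lebesgue) = (\<integral>\<^sup>+x. indicator Q x * ennreal (norm (f x) powr p) \<partial>lebesgue)"
    using h'(1) by (intro nn_integral_cong_AE) (auto simp: indicator_def)
  finally show ?thesis
    using p s \<mu> by (simp add: s_def \<mu>_def mult.commute ennreal_add_left_cancel_le add.commute[of "ennreal (_ * measure _ _)"])
qed (use p in simp)

text \<open>Near-minimisers for x and for y combine to a point of C. Convexity of the distance takes
  the place of a separation argument when averages have to stay in a closed convex set.\<close>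

lemma infdist_convex_on:
  fixes C :: "'e::real_normed_vector set"
  assumes "convex C"
  shows "convex_on UNIV (\<lambda>x. infdist x C)"
proof (cases "C = {}")
  case False
  show ?thesis
  proof (rule convex_onI)
    fix t :: real and x y :: 'e assume t: "0 < t" "t < 1"
    show "infdist ((1 - t) *\<^sub>R x + t *\<^sub>R y) C \<le> (1 - t) * infdist x C + t * infdist y C"
    proof (rule field_le_epsilon)
      fix e :: real assume "0 < e"
      have near: "\<exists>c\<in>C. dist z c < infdist z C + e" for z
      proof -
        have "(INF a\<in>C. dist z a) < infdist z C + e" using False \<open>0 < e\<close> by (simp add: infdist_notempty)
        then show ?thesis using False by (subst (asm) cINF_less_iff) auto
      qed
      obtain c d where c: "c \<in> C" "dist x c < infdist x C + e" and d: "d \<in> C" "dist y d < infdist y C + e"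
        using near by metis
      have "infdist ((1 - t) *\<^sub>R x + t *\<^sub>R y) C \<le> dist ((1 - t) *\<^sub>R x + t *\<^sub>R y) ((1 - t) *\<^sub>R c + t *\<^sub>R d)"
        using c d t assms by (intro infdist_le convexD) auto
      also have "\<dots> = norm ((1 - t) *\<^sub>R (x - c) + t *\<^sub>R (y - d))" by (simp add: dist_norm algebra_simps)
      also have "\<dots> \<le> (1 - t) * dist x c + t * dist y d"
        using t by (intro norm_triangle_le) (simp add: dist_norm)
      also have "\<dots> \<le> (1 - t) * (infdist x C + e) + t * (infdist y C + e)"
        using c d t by (intro add_mono mult_left_mono) auto
      also have "\<dots> = (1 - t) * infdist x C + t * infdist y C + e" by (simp add: algebra_simps)
      finally show "infdist ((1 - t) *\<^sub>R x + t *\<^sub>R y) C \<le> (1 - t) * infdist x C + t * infdist y C + e" .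
    qed
  qed simp
qed (simp add: infdist_def convex_on_const)

text \<open>The average is a finite convex combination of the values that \<open>t\<close> takes on
  \<open>J\<close>, so convexity of the distance applies directly.\<close>

lemma simple_average_infdist:
  fixes t :: "'a \<Rightarrow> 'e::real_normed_vector"
  assumes t: "Bochner_Integration.simple_bochner_integrable M t" and J: "J \<in> sets M" "0 < measure M J" "emeasure M J < \<infinity>"
    and out: "\<And>x. x \<notin> J \<Longrightarrow> t x = 0" and C: "convex C"
  shows "ennreal (measure M J * infdist ((1 / measure M J) *\<^sub>R Bochner_Integration.simple_bochner_integral M t) C)
     \<le> (\<integral>\<^sup>+x. indicator J x * ennreal (infdist (t x) C) \<partial>M)"
proof -
  let ?\<mu> = "measure M J"
  \<comment> \<open>Recording membership in J next to the value separates points of J where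
    \<open>t\<close> vanishes from points outside J.\<close>
  define h where "h x = (t x, indicat_real J x)" for x
  have st: "simple_function M t" using t by (auto elim: Bochner_Integration.simple_bochner_integrable.cases)
  have sJ: "simple_function M (indicat_real J)" using J by simp
  have sh: "simple_function M h" unfolding h_def[abs_def] by (rule simple_function_compose2[OF st sJ])
  have iJ: "Bochner_Integration.simple_bochner_integrable M (indicat_real J)"
  proof (rule Bochner_Integration.simple_bochner_integrable.intros[OF sJ])
    have "{y \<in> space M. indicat_real J y \<noteq> 0} = J" using sets.sets_into_space[OF J(1)] by (auto simp: indicator_def)
    then show "emeasure M {y \<in> space M. indicat_real J y \<noteq> 0} \<noteq> \<infinity>" using J(3) by simp
  qed
  have ig: "Bochner_Integration.simple_bochner_integrable M (\<lambda>x. indicat_real J x * infdist (t x) C)"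
    using Bochner_Integration.simple_bochner_integrable_compose2[of "\<lambda>a b. a * infdist b C", OF _ iJ t] by simp
  define a where "a z = measure M {x \<in> space M. h x = z}" for z
  define Z where "Z = {z \<in> h ` space M. snd z = 1}"
  have fin: "finite (h ` space M)" using sh by (simp add: simple_function_def)
  have Zc: "z = (0, 0)" if z: "z \<in> h ` space M - Z" for z
  proof -
    obtain x where "z = h x" "snd z \<noteq> 1" using z by (auto simp: Z_def)
    then show ?thesis using out[of x] by (cases "x \<in> J") (auto simp: h_def)
  qed
  have ZS: "Z \<subseteq> h ` space M" by (auto simp: Z_def)
  have int_t: "Bochner_Integration.simple_bochner_integral M t = (\<Sum>z\<in>Z. a z *\<^sub>R fst z)"
  proof -
    have "Bochner_Integration.simple_bochner_integral M t = (\<Sum>z\<in>h ` space M. a z *\<^sub>R fst z)"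
      unfolding a_def by (rule Bochner_Integration.simple_bochner_integral_partition[OF t sh]) (auto simp: h_def)
    also have "\<dots> = (\<Sum>z\<in>Z. a z *\<^sub>R fst z)"
      by (rule sum.mono_neutral_right[OF fin ZS]) (auto dest!: Zc)
    finally show ?thesis .
  qed
  have int_J: "Bochner_Integration.simple_bochner_integral M (indicat_real J) = (\<Sum>z\<in>Z. a z *\<^sub>R snd z)"
  proof -
    have "Bochner_Integration.simple_bochner_integral M (indicat_real J) = (\<Sum>z\<in>h ` space M. a z *\<^sub>R snd z)"
      unfolding a_def by (rule Bochner_Integration.simple_bochner_integral_partition[OF iJ sh]) (auto simp: h_def)
    also have "\<dots> = (\<Sum>z\<in>Z. a z *\<^sub>R snd z)"
      by (rule sum.mono_neutral_right[OF fin ZS]) (auto dest!: Zc)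
    finally show ?thesis .
  qed
  have int_g: "Bochner_Integration.simple_bochner_integral M (\<lambda>x. indicat_real J x * infdist (t x) C)
      = (\<Sum>z\<in>Z. a z *\<^sub>R (snd z * infdist (fst z) C))"
  proof -
    have "Bochner_Integration.simple_bochner_integral M (\<lambda>x. indicat_real J x * infdist (t x) C)
        = (\<Sum>z\<in>h ` space M. a z *\<^sub>R (snd z * infdist (fst z) C))"
      unfolding a_def by (rule Bochner_Integration.simple_bochner_integral_partition[OF ig sh]) (auto simp: h_def)
    also have "\<dots> = (\<Sum>z\<in>Z. a z *\<^sub>R (snd z * infdist (fst z) C))"
      by (rule sum.mono_neutral_right[OF fin ZS]) (auto dest!: Zc)
    finally show ?thesis .
  qed
  have "ennreal (Bochner_Integration.simple_bochner_integral M (indicat_real J)) = (\<integral>\<^sup>+x. ennreal (indicat_real J x) \<partial>M)"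
    by (rule Bochner_Integration.simple_bochner_integral_eq_nn_integral[OF iJ]) simp
  also have "\<dots> = emeasure M J" using J(1) by (simp add: ennreal_indicator)
  finally have "Bochner_Integration.simple_bochner_integral M (indicat_real J) = ?\<mu>"
    using J by (simp add: emeasure_eq_ennreal_measure)
  then have sum_a: "(\<Sum>z\<in>Z. a z) = ?\<mu>" unfolding int_J by (simp add: Z_def)
  have "Z \<noteq> {}" using sum_a J by auto
  have "infdist (\<Sum>z\<in>Z. (a z / ?\<mu>) *\<^sub>R fst z) C \<le> (\<Sum>z\<in>Z. (a z / ?\<mu>) * infdist (fst z) C)"
    by (rule convex_on_sum[OF _ \<open>Z \<noteq> {}\<close> infdist_convex_on[OF C]])
      (use fin J sum_a in \<open>auto simp: Z_def a_def simp flip: sum_divide_distrib\<close>)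
  also have "(\<Sum>z\<in>Z. (a z / ?\<mu>) *\<^sub>R fst z) = (1 / ?\<mu>) *\<^sub>R Bochner_Integration.simple_bochner_integral M t"
    unfolding int_t by (simp add: scaleR_sum_right)
  also have "(\<Sum>z\<in>Z. (a z / ?\<mu>) * infdist (fst z) C)
      = Bochner_Integration.simple_bochner_integral M (\<lambda>x. indicat_real J x * infdist (t x) C) / ?\<mu>"
    unfolding int_g by (simp add: sum_divide_distrib Z_def)
  finally have "ennreal (?\<mu> * infdist ((1 / ?\<mu>) *\<^sub>R Bochner_Integration.simple_bochner_integral M t) C)
    \<le> ennreal (Bochner_Integration.simple_bochner_integral M (\<lambda>x. indicat_real J x * infdist (t x) C))"
    using J by (intro ennreal_leI) (simp add: pos_le_divide_eq mult.commute)
  also have "\<dots> = (\<integral>\<^sup>+x. ennreal (indicat_real J x * infdist (t x) C) \<partial>M)"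
    by (rule Bochner_Integration.simple_bochner_integral_eq_nn_integral[OF ig]) (simp add: infdist_nonneg)
  also have "\<dots> = (\<integral>\<^sup>+x. indicator J x * ennreal (infdist (t x) C) \<partial>M)"
    by (intro nn_integral_cong) (simp add: indicator_def)
  finally show ?thesis .
qed

text \<open>No integrability is assumed: a divergent average is \<open>0\<close>.\<close>

lemma average_in_closed_convex:
  fixes F :: "real ^ 'd \<Rightarrow> 'e::banach"
  assumes C: "closed C" "convex C" "0 \<in> C" and J: "J \<in> sets lebesgue" "0 < measure lebesgue J" "emeasure lebesgue J < \<infinity>"
    and F: "\<And>x. x \<in> J \<Longrightarrow> F x \<in> C"
  shows "average J F \<in> C"
proof (cases "\<exists>v. has_strong_integral lebesgue (\<lambda>x. indicat_real J x *\<^sub>R F x) v")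
  case False
  then show ?thesis using C by (simp add: average_def set_strong_integral_def strong_integral_def)
next
  case True
  then obtain v where v: "has_strong_integral lebesgue (\<lambda>x. indicat_real J x *\<^sub>R F x) v" by blast
  let ?F = "\<lambda>x. indicat_real J x *\<^sub>R F x" and ?\<mu> = "measure lebesgue J"
  obtain s where s: "\<And>n. Bochner_Integration.simple_bochner_integrable lebesgue (s n)"
     "(\<lambda>n. \<integral>\<^sup>+x. norm (?F x - s n x) \<partial>lebesgue) \<longlonglongrightarrow> 0"
     "(\<lambda>n. Bochner_Integration.simple_bochner_integral lebesgue (s n)) \<longlonglongrightarrow> v"
    and sm: "strongly_measurable lebesgue ?F"
    using v unfolding has_strong_integral_def by blast
  \<comment> \<open>Cutting off to J does not increase the L^1 distance to the integrand, which
    vanishes off J.\<close>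
  define t where "t n x = indicat_real J x *\<^sub>R s n x" for n x
  have sJ: "Bochner_Integration.simple_bochner_integrable lebesgue (indicat_real J)"
  proof (rule Bochner_Integration.simple_bochner_integrable.intros)
    have "{y \<in> space lebesgue. indicat_real J y \<noteq> 0} = J" by (auto simp: indicator_def)
    then show "emeasure lebesgue {y \<in> space lebesgue. indicat_real J y \<noteq> 0} \<noteq> \<infinity>" using J(3) by simp
  qed (use J in simp)
  have t: "Bochner_Integration.simple_bochner_integrable lebesgue (t n)" for n
    unfolding t_def[abs_def]
    using Bochner_Integration.simple_bochner_integrable_compose2[of "\<lambda>a b. a *\<^sub>R b", OF _ sJ s(1)] by simp
  define r where "r n = (\<integral>\<^sup>+x. norm (?F x - s n x) \<partial>lebesgue)" for n
  have r: "(\<integral>\<^sup>+x. norm (?F x - t n x) \<partial>lebesgue) \<le> r n" for n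
    unfolding r_def t_def by (intro nn_integral_mono) (auto simp: indicator_def)
  define q where "q n = Bochner_Integration.simple_bochner_integral lebesgue (t n)" for n
  have "(\<lambda>n. q n - Bochner_Integration.simple_bochner_integral lebesgue (s n)) \<longlonglongrightarrow> 0"
  proof -
    have "(\<lambda>n. ennreal (norm (q n - Bochner_Integration.simple_bochner_integral lebesgue (s n)))) \<longlonglongrightarrow> 0"
    proof (rule tendsto_sandwich[OF _ _ tendsto_const])
      show "(\<lambda>n. r n + r n) \<longlonglongrightarrow> 0" using tendsto_add[OF s(2) s(2)] by (simp add: r_def)
      have "ennreal (norm (q n - Bochner_Integration.simple_bochner_integral lebesgue (s n))) \<le> r n + r n" for n
        unfolding q_def
        by (rule order.trans[OF simple_bochner_integral_dist_le[OF sm t s(1)] add_mono[OF r]]) (simp add: r_def)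
      then show "\<forall>\<^sub>F n in sequentially. ennreal (norm (q n - Bochner_Integration.simple_bochner_integral lebesgue (s n))) \<le> r n + r n"
        by simp
    qed auto
    then show ?thesis
      by (simp add: tendsto_norm_zero_iff ennreal_tendsto_0_iff)
  qed
  from tendsto_add[OF this s(3)] have q: "q \<longlonglongrightarrow> v" by simp
  \<comment> \<open>On J the values of \<open>F\<close> lie in C, so the distance of
    \<open>t n x\<close> to C is at most \<open>norm (F x - t n x)\<close>. Hence the approximate
    averages approach C, and closedness captures the limit.\<close>
  have "ennreal (?\<mu> * infdist ((1 / ?\<mu>) *\<^sub>R q n) C) \<le> r n" for n
  proof -
    have "ennreal (?\<mu> * infdist ((1 / ?\<mu>) *\<^sub>R q n) C) \<le> (\<integral>\<^sup>+x. indicator J x * ennreal (infdist (t n x) C) \<partial>lebesgue)"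
      unfolding q_def by (rule simple_average_infdist[OF t J _ C(2)]) (simp add: t_def)
    also have "\<dots> \<le> (\<integral>\<^sup>+x. norm (?F x - t n x) \<partial>lebesgue)"
    proof (rule nn_integral_mono)
      fix x :: "real ^ 'd"
      show "indicator J x * ennreal (infdist (t n x) C) \<le> ennreal (norm (?F x - t n x))"
        using infdist_le[OF F, of x "t n x"] by (auto simp: indicator_def dist_norm norm_minus_commute intro!: ennreal_leI)
    qed
    finally show ?thesis using r[of n] by simp
  qed
  then have "(\<lambda>n. ennreal (?\<mu> * infdist ((1 / ?\<mu>) *\<^sub>R q n) C)) \<longlonglongrightarrow> 0"
    by (intro tendsto_sandwich[OF _ _ tendsto_const s(2)]) (auto simp: r_def)
  then have "(\<lambda>n. ?\<mu> * infdist ((1 / ?\<mu>) *\<^sub>R q n) C) \<longlonglongrightarrow> 0"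
    by (subst (asm) ennreal_tendsto_0_iff) (auto simp: infdist_nonneg)
  moreover have "(\<lambda>n. ?\<mu> * infdist ((1 / ?\<mu>) *\<^sub>R q n) C) \<longlonglongrightarrow> ?\<mu> * infdist ((1 / ?\<mu>) *\<^sub>R v) C"
    by (intro tendsto_intros q)
  ultimately have "?\<mu> * infdist ((1 / ?\<mu>) *\<^sub>R v) C = 0" by (rule LIMSEQ_unique[symmetric])
  then have "infdist ((1 / ?\<mu>) *\<^sub>R v) C = 0" using J by simp
  then have "(1 / ?\<mu>) *\<^sub>R v \<in> C" using C by (subst in_closed_iff_infdist_zero) auto
  then show ?thesis using strong_integral_eqI[OF v] by (simp add: average_def set_strong_integral_def)
qed

lemma average_in_sym_hull:
  assumes "J \<in> sets lebesgue" "0 < measure lebesgue J" "emeasure lebesgue J < \<infinity>" "S \<noteq> {}"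
    and "\<And>x. x \<in> J \<Longrightarrow> F x \<in> sym_hull S"
  shows "average J F \<in> sym_hull S"
  by (rule average_in_closed_convex[OF closed_sym_hull convex_sym_hull zero_in_sym_hull]) (use assms in auto)

section \<open>Dyadic cubes\<close>

lemma half_open_cube_borel: "half_open_cube a l \<in> sets borel"
proof -
  have "half_open_cube a l = (\<Inter>i\<in>UNIV. {x. a $ i \<le> x $ i} \<inter> {x. x $ i < a $ i + l})"
    by (auto simp: half_open_cube_def)
  also have "\<dots> \<in> sets borel"
    by (intro sets.finite_INT sets.Int borel_closed borel_open closed_Collect_le open_Collect_less continuous_intros) auto
  finally show ?thesis .
qed

text \<open>The half-open cube lies between the open and the closed box with the same corners, and
  these have equal volume.\<close>

lemma emeasure_half_open_cube:
  fixes a :: "real ^ 'd"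
  assumes "0 < l"
  shows "emeasure lebesgue (half_open_cube a l) = ennreal (l ^ CARD('d))"
proof -
  let ?b = "a + (\<chi> i. l)"
  have prod: "(\<Prod>b\<in>Basis. (?b - a) \<bullet> b) = l ^ CARD('d)"
  proof -
    have "(\<Prod>b\<in>Basis. (?b - a) \<bullet> b) = (\<Prod>b\<in>(Basis :: (real ^ 'd) set). l)"
      by (rule prod.cong) (auto simp: Basis_vec_def inner_axis)
    then show ?thesis by (simp add: prod_constant)
  qed
  have le: "a \<bullet> b \<le> ?b \<bullet> b" if "b \<in> Basis" for b
    using that assms by (auto simp: Basis_vec_def inner_axis)
  have "box a ?b \<subseteq> half_open_cube a l"
    by (auto simp: half_open_cube_def interval_cbox_cart mem_box_cart less_imp_le)
  then have "emeasure lborel (box a ?b) \<le> emeasure lborel (half_open_cube a l)"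
    using half_open_cube_borel by (intro emeasure_mono) auto
  moreover have "half_open_cube a l \<subseteq> cbox a ?b"
    by (auto simp: half_open_cube_def mem_box_cart less_imp_le)
  then have "emeasure lborel (half_open_cube a l) \<le> emeasure lborel (cbox a ?b)"
    by (intro emeasure_mono) auto
  moreover have "emeasure lborel (box a ?b) = ennreal (l ^ CARD('d))"
    by (simp only: emeasure_lborel_box[OF le] prod)
  moreover have "emeasure lborel (cbox a ?b) = ennreal (l ^ CARD('d))"
    by (simp only: emeasure_lborel_cbox[OF le] prod)
  ultimately have "emeasure lborel (half_open_cube a l) = ennreal (l ^ CARD('d))" by simp
  moreover have "half_open_cube a l \<in> sets lborel" using half_open_cube_borel by simp
  ultimately show ?thesis by simp
qed

text \<open>The volume determines the side length, which gives uniqueness in the description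
  defining \<open>side_length\<close>.\<close>

lemma side_length_half_open_cube:
  fixes a :: "real ^ 'd"
  assumes "0 < l"
  shows "side_length (half_open_cube a l) = l"
  unfolding side_length_def
proof (rule the_equality)
  fix l' assume l': "0 < l' \<and> (\<exists>b. half_open_cube a l = half_open_cube b l')"
  then obtain b where b: "half_open_cube a l = half_open_cube b l'" by blast
  have "ennreal (l ^ CARD('d)) = ennreal (l' ^ CARD('d))"
    using emeasure_half_open_cube[OF assms, of a] emeasure_half_open_cube[of l' b] b l' by simp
  then have "l ^ CARD('d) = l' ^ CARD('d)" using assms l' by simp
  then show "l' = l" using assms l' by (auto dest: power_eq_imp_eq_base)
qed (use assms in auto)

lemma two_powi_inject: "(2::real) powi a = 2 powi b \<longleftrightarrow> a = b"
  using power_int_strict_increasing[of a b "2::real"] power_int_strict_increasing[of b a "2::real"]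
  by (cases a b rule: linorder_cases) auto

text \<open>A dyadic system with its generations made explicit: \<open>k\<close> grows towards finer
  cubes, and integer levels replace side lengths in all bookkeeping.\<close>

locale dyadic_levels =
  fixes G :: "int \<Rightarrow> (real ^ 'd) set set"
  assumes part: "partition_on UNIV (G k)"
    and cube: "Q \<in> G k \<Longrightarrow> \<exists>a. Q = half_open_cube a (2 powi (- k))"
    and nested1: "Q \<in> G (k + 1) \<Longrightarrow> \<exists>P\<in>G k. Q \<subseteq> P"
begin

definition vol :: "int \<Rightarrow> real" where
  "vol k = (2 powi (- k)) ^ CARD('d)"

definition cb :: "int \<Rightarrow> real ^ 'd \<Rightarrow> (real ^ 'd) set" where
  "cb k x = (THE Q. Q \<in> G k \<and> x \<in> Q)"

definition desc :: "nat \<Rightarrow> int \<Rightarrow> (real ^ 'd) set \<Rightarrow> (real ^ 'd) set set" where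
  "desc q k K = {J \<in> G (k + int q). J \<subseteq> K}"

lemma vol_pos: "0 < vol k"
  by (simp add: vol_def)

lemma vol_add: "vol k = 2 ^ (CARD('d) * q) * vol (k + int q)"
proof -
  have "(2::real) powi (- k) = 2 ^ q * 2 powi (- (k + int q))"
    by (simp add: power_int_add[symmetric] flip: power_int_of_nat)
  then show ?thesis by (simp add: vol_def power_mult_distrib power_mult mult.commute[of "CARD('d)"])
qed

lemma ex1_cube: "\<exists>!Q. Q \<in> G k \<and> x \<in> Q"
proof -
  have "x \<in> \<Union> (G k)" using part[of k] by (simp add: partition_on_def)
  moreover have "Q = Q'" if "Q \<in> G k" "x \<in> Q" "Q' \<in> G k" "x \<in> Q'" for Q Q'
    using part[of k] that unfolding partition_on_def disjoint_def by blast
  ultimately show ?thesis by blast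
qed

lemma cb_in: "cb k x \<in> G k" and mem_cb: "x \<in> cb k x"
  using theI'[OF ex1_cube[of k x]] by (auto simp: cb_def)

lemma cb_unique: "Q \<in> G k \<Longrightarrow> x \<in> Q \<Longrightarrow> cb k x = Q"
  using ex1_cube[of k x] cb_in mem_cb by blast

lemma cb_eq: "y \<in> cb k x \<Longrightarrow> cb k y = cb k x"
  by (rule cb_unique[OF cb_in])

lemma cube_nonempty: "Q \<in> G k \<Longrightarrow> Q \<noteq> {}"
  using part[of k] by (auto simp: partition_on_def)

lemma cb_mono: "k \<le> k' \<Longrightarrow> cb k' x \<subseteq> cb k x"
proof (induction k' rule: int_ge_induct)
  case (step j)
  obtain P where P: "P \<in> G j" "cb (j + 1) x \<subseteq> P" using nested1[OF cb_in] by blast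
  then have "cb j x = P" using mem_cb by (intro cb_unique) auto
  with P step show ?case by blast
qed simp

lemma cube_sets: "Q \<in> G k \<Longrightarrow> Q \<in> sets lebesgue"
proof -
  assume "Q \<in> G k"
  then obtain a where Q: "Q = half_open_cube a (2 powi (- k))" using cube by blast
  have "Q \<in> sets lborel" using half_open_cube_borel unfolding Q by simp
  then show ?thesis by (rule sets_completionI_sets)
qed

lemma emeasure_cube: "Q \<in> G k \<Longrightarrow> emeasure lebesgue Q = ennreal (vol k)"
  using cube[of Q k] by (auto simp: vol_def emeasure_half_open_cube zero_less_power_int)

lemma measure_cube: "Q \<in> G k \<Longrightarrow> measure lebesgue Q = vol k"
  using emeasure_cube[of Q k] vol_pos[of k] by (simp add: measure_def)

lemma emeasure_cube_finite: "Q \<in> G k \<Longrightarrow> emeasure lebesgue Q < \<infinity>"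
  by (simp add: emeasure_cube)

lemma measure_cube_pos: "Q \<in> G k \<Longrightarrow> 0 < measure lebesgue Q"
  by (simp add: measure_cube vol_pos)

lemma side_length_cube: "Q \<in> G k \<Longrightarrow> side_length Q = 2 powi (- k)"
  using cube[of Q k] by (auto simp: side_length_half_open_cube zero_less_power_int)

lemma level_unique: "Q \<in> G k \<Longrightarrow> Q \<in> G k' \<Longrightarrow> k = k'"
  using side_length_cube[of Q k] side_length_cube[of Q k'] by (simp add: two_powi_inject)

lemma subset_cb: "K \<in> G k \<Longrightarrow> x \<in> K \<Longrightarrow> k \<le> k' \<Longrightarrow> cb k' x \<subseteq> K"
  using cb_mono[of k k' x] cb_unique[of K k x] by simp

lemma desc_iff: "K \<in> G k \<Longrightarrow> J \<in> desc q k K \<longleftrightarrow> (\<exists>x\<in>K. J = cb (k + int q) x)"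
proof
  assume K: "K \<in> G k" and J: "J \<in> desc q k K"
  then obtain x where "x \<in> J" using cube_nonempty[of J "k + int q"] by (auto simp: desc_def)
  then show "\<exists>x\<in>K. J = cb (k + int q) x"
    using J cb_unique[of J "k + int q" x] by (auto simp: desc_def)
next
  assume "K \<in> G k" "\<exists>x\<in>K. J = cb (k + int q) x"
  then show "J \<in> desc q k K" using cb_in subset_cb[of K k _ "k + int q"] by (auto simp: desc_def)
qed

lemma Union_desc: "K \<in> G k \<Longrightarrow> \<Union> (desc q k K) = K"
  using desc_iff[of K k _ q] mem_cb by (auto simp: desc_def)

lemma disjoint_level: "J \<in> G k \<Longrightarrow> J' \<in> G k \<Longrightarrow> J \<noteq> J' \<Longrightarrow> J \<inter> J' = {}"
  using part[of k] by (auto simp: partition_on_def disjoint_def)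

lemma measure_Union_level:
  assumes "finite F" "F \<subseteq> G k"
  shows "emeasure lebesgue (\<Union> F) = ennreal (card F * vol k)"
proof -
  have "emeasure lebesgue (\<Union> F) = (\<Sum>J\<in>F. emeasure lebesgue J)"
    using sum_emeasure[of "\<lambda>J. J" F lebesgue] assms disjoint_level[of _ k] cube_sets[of _ k]
    by (auto simp: disjoint_family_on_def subset_iff)
  also have "\<dots> = (\<Sum>J\<in>F. ennreal (vol k))"
    using assms emeasure_cube by (intro sum.cong) auto
  finally show ?thesis using vol_pos[of k] by (simp add: ennreal_of_nat_eq_real_of_nat ennreal_mult less_imp_le)
qed

text \<open>Volume counting: the descendants are pairwise disjoint subsets of K of equal volume, and
  K has \<open>2 ^ (CARD('d) * q)\<close> times the volume of one of them.\<close>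

lemma finite_desc: assumes K: "K \<in> G k" shows "finite (desc q k K)"
proof (rule finite_if_finite_subsets_card_bdd[THEN conjunct1])
  fix F assume F: "F \<subseteq> desc q k K" "finite F"
  have F': "F \<subseteq> G (k + int q)" "\<Union> F \<subseteq> K" using F by (auto simp: desc_def)
  have "emeasure lebesgue (\<Union> F) \<le> emeasure lebesgue K"
    by (rule emeasure_mono[OF F'(2) cube_sets[OF K]])
  then have "ennreal (card F * vol (k + int q)) \<le> ennreal (vol k)"
    by (simp only: measure_Union_level[OF F(2) F'(1)] emeasure_cube[OF K])
  then have "card F * vol (k + int q) \<le> vol k"
    using vol_pos[of k] by (simp add: ennreal_le_iff less_imp_le)
  also have "\<dots> = 2 ^ (CARD('d) * q) * vol (k + int q)" by (rule vol_add)
  finally have "real (card F) \<le> real (2 ^ (CARD('d) * q))" using vol_pos by (simp add: mult_le_cancel_right_pos)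
  then show "card F \<le> 2 ^ (CARD('d) * q)" by (simp only: of_nat_le_iff)
qed

lemma card_desc: assumes K: "K \<in> G k" shows "card (desc q k K) = 2 ^ (CARD('d) * q)"
proof -
  have "emeasure lebesgue (\<Union> (desc q k K)) = ennreal (card (desc q k K) * vol (k + int q))"
    by (rule measure_Union_level[OF finite_desc[OF K]]) (auto simp: desc_def)
  then have "ennreal (vol k) = ennreal (card (desc q k K) * vol (k + int q))"
    by (simp only: Union_desc[OF K] emeasure_cube[OF K])
  then have "card (desc q k K) * vol (k + int q) = 2 ^ (CARD('d) * q) * vol (k + int q)"
    using vol_pos[of k] vol_pos[of "k + int q"] unfolding vol_add[of k q, symmetric]
    by (subst (asm) ennreal_inj) (auto simp: less_imp_le)
  then have "real (card (desc q k K)) = real (2 ^ (CARD('d) * q))" using vol_pos[of "k + int q"] by simp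
  then show ?thesis by (simp only: of_nat_eq_iff)
qed

text \<open>Translates side lengths, in terms of which Haar projections are defined, into levels;
  the side length fixes the level because integer powers of 2 are distinct.\<close>

lemma desc_eq_level:
  assumes K: "K \<in> G k"
  shows "{I \<in> (\<Union>k. G k). I \<subseteq> K \<and> side_length I = side_length K / 2 ^ q} = desc q k K"
proof -
  have "(2::real) powi (- k) / 2 ^ q = 2 powi (- (k + int q))"
    by (simp add: power_int_diff flip: power_int_of_nat)
  then have "I \<in> G k' \<Longrightarrow> side_length I = side_length K / 2 ^ q \<longleftrightarrow> k' = k + int q" for I k'
    using side_length_cube[of I k'] side_length_cube[OF K] by (simp add: two_powi_inject) linarith
  then show ?thesis by (auto simp: desc_def)
qed

lemma children_eq_desc: "K \<in> G k \<Longrightarrow> children (\<Union>k. G k) K = desc 1 k K"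
  using desc_eq_level[of K k 1] by (simp add: children_def)

lemma sum_desc_indicator:
  fixes v :: "(real ^ 'd) set \<Rightarrow> 'v::real_vector"
  assumes K: "K \<in> G k"
  shows "(\<Sum>J\<in>desc q k K. indicator J x *\<^sub>R v J) = indicator K x *\<^sub>R v (cb (k + int q) x)"
proof (cases "x \<in> K")
  case True
  have "(\<Sum>J\<in>desc q k K. indicator J x *\<^sub>R v J) = (\<Sum>J\<in>{cb (k + int q) x}. indicator J x *\<^sub>R v J)"
  proof (rule sum.mono_neutral_right[OF finite_desc[OF K]])
    show "{cb (k + int q) x} \<subseteq> desc q k K" using True desc_iff[OF K] by auto
    show "\<forall>J\<in>desc q k K - {cb (k + int q) x}. indicator J x *\<^sub>R v J = 0"
      using cb_unique[of _ "k + int q" x] by (auto simp: desc_def indicator_def)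
  qed
  then show ?thesis using True mem_cb[of x "k + int q"] by simp
next
  case False
  then have "\<forall>J\<in>desc q k K. x \<notin> J" by (auto simp: desc_def)
  then show ?thesis using False by simp
qed

lemma haar_proj_eq:
  fixes f :: "real ^ 'd \<Rightarrow> 'e::banach"
  assumes K: "K \<in> G k"
  shows "haar_proj (\<Union>k. G k) K f x = indicator K x *\<^sub>R (average (cb (k + 1) x) f - average (cb k x) f)"
  unfolding haar_proj_def children_eq_desc[OF K]
  using sum_desc_indicator[OF K, where q = 1 and x = x and v = "\<lambda>J. average J f"] cb_unique[OF K, of x]
  by (cases "x \<in> K") auto

text \<open>The Haar projections of the descendants of K glue together to the difference of the
  averaging operators at two consecutive levels, restricted to K. Later arguments use the
  projections in this form.\<close>

lemma haar_proj_level_eq: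
  fixes f :: "real ^ 'd \<Rightarrow> 'e::banach"
  assumes K: "K \<in> G k"
  shows "haar_proj_level (\<Union>k. G k) i K f x =
    indicator K x *\<^sub>R (average (cb (k + int i + 1) x) f - average (cb (k + int i) x) f)"
proof -
  have "haar_proj_level (\<Union>k. G k) i K f x = (\<Sum>I\<in>desc i k K. haar_proj (\<Union>k. G k) I f x)"
    unfolding haar_proj_level_def desc_eq_level[OF K] ..
  also have "\<dots> = (\<Sum>I\<in>desc i k K. indicator I x *\<^sub>R (average (cb (k + int i + 1) x) f - average (cb (k + int i) x) f))"
    by (intro sum.cong refl haar_proj_eq) (auto simp: desc_def)
  also have "\<dots> = indicator K x *\<^sub>R (average (cb (k + int i + 1) x) f - average (cb (k + int i) x) f)"
    by (rule sum_desc_indicator[OF K])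
  finally show ?thesis .
qed

lemma average_desc:
  fixes F :: "real ^ 'd \<Rightarrow> 'e::banach"
  assumes K: "K \<in> G k" and F: "strongly_integrable lebesgue (\<lambda>x. indicator K x *\<^sub>R F x)"
  shows "average K F = (1 / 2 ^ (CARD('d) * q)) *\<^sub>R (\<Sum>J\<in>desc q k K. average J F)"
proof -
  have int: "strongly_integrable lebesgue (\<lambda>x. indicator J x *\<^sub>R F x)" if "J \<in> desc q k K" for J
  proof -
    have J: "J \<in> sets lebesgue" "J \<subseteq> K" using that cube_sets by (auto simp: desc_def)
    have "(\<lambda>x. indicator J x *\<^sub>R indicator K x *\<^sub>R F x) = (\<lambda>x. indicat_real J x *\<^sub>R F x)"
      using J by (auto simp: indicator_def fun_eq_iff)
    then show ?thesis using strongly_integrable_set[OF F J(1)] by simp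
  qed
  have "set_strong_integral lebesgue K F = strong_integral lebesgue (\<lambda>x. \<Sum>J\<in>desc q k K. indicator J x *\<^sub>R F x)"
    unfolding set_strong_integral_def
    by (subst sum_desc_indicator[OF K, where v = "\<lambda>_. F _"]) simp
  also have "\<dots> = (\<Sum>J\<in>desc q k K. set_strong_integral lebesgue J F)"
    unfolding set_strong_integral_def using strongly_integrable_sum[OF finite_desc[OF K] int] by simp
  finally have "average K F = (1 / vol k) *\<^sub>R (\<Sum>J\<in>desc q k K. set_strong_integral lebesgue J F)"
    by (simp add: average_def measure_cube[OF K])
  also have "\<dots> = (1 / vol k) *\<^sub>R (\<Sum>J\<in>desc q k K. vol (k + int q) *\<^sub>R average J F)"
    using vol_pos[of "k + int q"] measure_cube
    by (intro arg_cong[where f = "\<lambda>v. _ *\<^sub>R v"] sum.cong) (auto simp: average_def desc_def)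
  also have "\<dots> = (vol (k + int q) / vol k) *\<^sub>R (\<Sum>J\<in>desc q k K. average J F)"
    by (simp flip: scaleR_sum_right)
  also have "vol (k + int q) / vol k = 1 / 2 ^ (CARD('d) * q)"
    using vol_add[of k q] vol_pos[of "k + int q"] by simp
  finally show ?thesis .
qed

end

section \<open>Measurability of partial integrals\<close>

lemma has_strong_integral_indicator:
  fixes v :: "'e::banach"
  assumes B: "B \<in> sets M" "emeasure M B < \<infinity>"
  shows "strongly_integrable M (\<lambda>x. indicat_real B x *\<^sub>R v)"
    and "strong_integral M (\<lambda>x. indicat_real B x *\<^sub>R v) = measure M B *\<^sub>R v"
proof -
  have sf: "simple_function M (indicat_real B)" using B by simp
  have iB: "Bochner_Integration.simple_bochner_integrable M (indicat_real B)"
  proof (rule Bochner_Integration.simple_bochner_integrable.intros[OF sf])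
    have "{y \<in> space M. indicat_real B y \<noteq> 0} = B" using sets.sets_into_space[OF B(1)] by (auto simp: indicator_def)
    then show "emeasure M {y \<in> space M. indicat_real B y \<noteq> 0} \<noteq> \<infinity>" using B(2) by simp
  qed
  have lin: "linear (\<lambda>r::real. r *\<^sub>R v)" by (rule linearI) (auto simp: scaleR_add_left)
  have f: "Bochner_Integration.simple_bochner_integrable M (\<lambda>x. indicat_real B x *\<^sub>R v)"
    using Bochner_Integration.simple_bochner_integrable_compose2[of "\<lambda>a b. a *\<^sub>R v", OF _ iB iB] by simp
  have "ennreal (Bochner_Integration.simple_bochner_integral M (indicat_real B)) = (\<integral>\<^sup>+x. ennreal (indicat_real B x) \<partial>M)"
    by (rule Bochner_Integration.simple_bochner_integral_eq_nn_integral[OF iB]) simp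
  also have "\<dots> = emeasure M B" using B(1) by (simp add: ennreal_indicator)
  finally have "Bochner_Integration.simple_bochner_integral M (indicat_real B) = measure M B"
    using B by (simp add: emeasure_eq_ennreal_measure)
  then have I: "Bochner_Integration.simple_bochner_integral M (\<lambda>x. indicat_real B x *\<^sub>R v) = measure M B *\<^sub>R v"
    using Bochner_Integration.simple_bochner_integral_linear[OF lin iB] by simp
  have sm: "strongly_measurable M (\<lambda>x. indicat_real B x *\<^sub>R v)"
    by (rule strongly_measurable_set[OF B(1) strongly_measurable_const])
  have "has_strong_integral M (\<lambda>x. indicat_real B x *\<^sub>R v) (measure M B *\<^sub>R v)"
    unfolding has_strong_integral_def using f sm I by (intro conjI exI[of _ "\<lambda>_ x. indicat_real B x *\<^sub>R v"]) auto
  then show "strong_integral M (\<lambda>x. indicat_real B x *\<^sub>R v) = measure M B *\<^sub>R v" by (rule strong_integral_eqI)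
  have "(\<integral>\<^sup>+x. norm (indicat_real B x *\<^sub>R v) \<partial>M) = (\<integral>\<^sup>+x. ennreal (norm v) * indicator B x \<partial>M)"
    by (intro nn_integral_cong) (auto simp: indicator_def)
  also have "\<dots> < \<infinity>" using B by (simp add: nn_integral_cmult_indicator ennreal_mult_less_top)
  finally show "strongly_integrable M (\<lambda>x. indicat_real B x *\<^sub>R v)" using sm by (simp add: strongly_integrable_def)
qed

lemma strongly_integrable_bounded:
  fixes f :: "'a \<Rightarrow> 'e::banach"
  assumes f: "strongly_measurable M (\<lambda>x. indicator K x *\<^sub>R f x)" and K: "K \<in> sets M" "emeasure M K < \<infinity>"
    and C: "AE x in M. x \<in> K \<longrightarrow> norm (f x) \<le> C"
  shows "strongly_integrable M (\<lambda>x. indicator K x *\<^sub>R f x)"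
proof -
  have "(\<integral>\<^sup>+x. norm (indicat_real K x *\<^sub>R f x) \<partial>M) \<le> (\<integral>\<^sup>+x. ennreal C * indicator K x \<partial>M)"
  proof (rule nn_integral_mono_AE)
    show "AE x in M. ennreal (norm (indicat_real K x *\<^sub>R f x)) \<le> ennreal C * indicator K x"
      using C by eventually_elim (auto simp: indicator_def intro!: ennreal_leI)
  qed
  also have "\<dots> < \<infinity>" using K by (simp add: nn_integral_cmult_indicator ennreal_mult_less_top)
  finally show ?thesis using f by (simp add: strongly_integrable_def)
qed

text \<open>Measurable scalar coefficients are made simple by rounding down to a grid. Boundedness
  leaves finitely many rounded values, and the grid is chosen so fine that the total error against
  the finitely many vectors tends to 0.\<close>

lemma strongly_measurable_limit_sums:
  fixes I :: "'a \<Rightarrow> 'e::real_normed_vector" and r :: "nat \<Rightarrow> 'e \<Rightarrow> 'a \<Rightarrow> real"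
  assumes V: "\<And>n. finite (V n)" and r: "\<And>n v. r n v \<in> borel_measurable M" "\<And>n v x. 0 \<le> r n v x" "\<And>n v x. r n v x \<le> B"
    and lim: "AE x in M. (\<lambda>n. \<Sum>v\<in>V n. r n v x *\<^sub>R v) \<longlonglongrightarrow> I x"
  shows "strongly_measurable M I"
proof -
  \<comment> \<open>With grid size \<open>1 / m n\<close> the summed rounding error is at most 1 /
    (n + 1); adding 1 keeps \<open>m n\<close> positive.\<close>
  define m where "m n = (\<Sum>v\<in>V n. norm v) * real (Suc n) + 1" for n
  have m: "0 < m n" "(\<Sum>v\<in>V n. norm v) / m n \<le> 1 / real (Suc n)" for n
  proof -
    have "0 \<le> (\<Sum>v\<in>V n. norm v)" by (rule sum_nonneg) simp
    then show "0 < m n" by (simp add: m_def add_nonneg_pos)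
    then show "(\<Sum>v\<in>V n. norm v) / m n \<le> 1 / real (Suc n)" by (simp add: divide_simps) (simp add: m_def)
  qed
  define q where "q n v x = real_of_int \<lfloor>m n * r n v x\<rfloor> / m n" for n v x
  have q: "\<bar>r n v x - q n v x\<bar> \<le> 1 / m n" for n v x
  proof -
    have "\<bar>m n * r n v x - real_of_int \<lfloor>m n * r n v x\<rfloor>\<bar> \<le> 1" by linarith
    then have "\<bar>m n * r n v x - real_of_int \<lfloor>m n * r n v x\<rfloor>\<bar> / m n \<le> 1 / m n"
      using m(1)[of n] by (simp add: divide_right_mono)
    moreover have "\<bar>m n * r n v x - real_of_int \<lfloor>m n * r n v x\<rfloor>\<bar> / m n = \<bar>r n v x - q n v x\<bar>"
      using m(1)[of n] by (simp add: q_def field_simps abs_div_pos)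
    ultimately show ?thesis by simp
  qed
  have sq: "simple_function M (q n v)" for n v
  proof -
    have "(\<lambda>x. \<lfloor>m n * r n v x\<rfloor>) \<in> measurable M (count_space UNIV)"
      using r(1)[of n v] by measurable
    moreover have "finite ((\<lambda>x. \<lfloor>m n * r n v x\<rfloor>) ` space M)"
    proof (rule finite_subset)
      show "(\<lambda>x. \<lfloor>m n * r n v x\<rfloor>) ` space M \<subseteq> {0..\<lfloor>m n * B\<rfloor>}"
        using r(2,3)[of n v] m(1)[of n] by (auto intro!: floor_mono mult_left_mono)
    qed simp
    ultimately have "simple_function M (\<lambda>x. \<lfloor>m n * r n v x\<rfloor>)"
      by (simp add: simple_function_def measurable_sets)
    from simple_function_compose1[OF this, of "\<lambda>j. real_of_int j / m n"] show ?thesis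
      by (simp add: q_def[abs_def])
  qed
  have "simple_function M (\<lambda>x. \<Sum>v\<in>W. q n v x *\<^sub>R v)" if "finite W" for n W
    using that
  proof (induction W rule: finite_induct)
    case (insert v W)
    have "simple_function M (\<lambda>x. q n v x *\<^sub>R v)" by (rule simple_function_compose1[OF sq])
    from simple_function_compose2[OF this insert.IH, of "(+)"] insert.hyps show ?case by simp
  qed simp
  then have s: "simple_function M (\<lambda>x. \<Sum>v\<in>V n. q n v x *\<^sub>R v)" for n using V by blast
  have "AE x in M. (\<lambda>n. \<Sum>v\<in>V n. q n v x *\<^sub>R v) \<longlonglongrightarrow> I x"
    using lim
  proof eventually_elim
    case (elim x)
    have "(\<lambda>n. (\<Sum>v\<in>V n. r n v x *\<^sub>R v) - (\<Sum>v\<in>V n. q n v x *\<^sub>R v)) \<longlonglongrightarrow> 0"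
    proof (rule Lim_null_comparison[OF _ LIMSEQ_inverse_real_of_nat])
      have "norm ((\<Sum>v\<in>V n. r n v x *\<^sub>R v) - (\<Sum>v\<in>V n. q n v x *\<^sub>R v)) \<le> inverse (real (Suc n))" for n
      proof -
        have "norm ((\<Sum>v\<in>V n. r n v x *\<^sub>R v) - (\<Sum>v\<in>V n. q n v x *\<^sub>R v)) = norm (\<Sum>v\<in>V n. (r n v x - q n v x) *\<^sub>R v)"
          by (simp add: sum_subtractf scaleR_diff_left)
        also have "\<dots> \<le> (\<Sum>v\<in>V n. (1 / m n) * norm v)"
          by (rule sum_norm_le) (use q in \<open>auto intro!: mult_right_mono simp del: times_divide_eq_left\<close>)
        also have "\<dots> = (\<Sum>v\<in>V n. norm v) / m n" by (simp add: sum_divide_distrib)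
        also have "\<dots> \<le> inverse (real (Suc n))" using m(2)[of n] by (simp add: inverse_eq_divide)
        finally show ?thesis .
      qed
      then show "\<forall>\<^sub>F n in sequentially. norm ((\<Sum>v\<in>V n. r n v x *\<^sub>R v) - (\<Sum>v\<in>V n. q n v x *\<^sub>R v)) \<le> inverse (real (Suc n))"
        by simp
    qed
    from tendsto_diff[OF elim this] show ?case by simp
  qed
  then show ?thesis unfolding strongly_measurable_def
    by (intro exI[of _ "\<lambda>n x. \<Sum>v\<in>V n. q n v x *\<^sub>R v"] conjI allI s)
qed

text \<open>A Fubini-type argument. The approximants are replaced by Borel simple functions, whose
  sections are measurable for every x and have integrals depending measurably on x; bounded
  convergence on K passes to the limit for almost every x.\<close>

lemma strongly_measurable_partial_integral:
  fixes \<Phi> :: "(real ^ 'd) \<times> (real ^ 'd) \<Rightarrow> 'e::banach"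
  assumes \<Phi>: "strongly_measurable lebesgue \<Phi>" and K: "K \<in> sets borel" "emeasure lborel K < \<infinity>"
    and C: "\<And>x y. x \<in> K \<Longrightarrow> y \<in> K \<Longrightarrow> norm (\<Phi> (x, y)) \<le> C"
  shows "strongly_measurable lebesgue (\<lambda>x. indicator K x *\<^sub>R strong_integral lebesgue (\<lambda>y. indicator K y *\<^sub>R \<Phi> (x, y)))"
proof -
  let ?P = "lborel :: ((real ^ 'd) \<times> (real ^ 'd)) measure"
  have KK: "K \<times> K \<in> sets ?P" using K by (simp add: borel_Times)
  have KL: "K \<in> sets lebesgue" "emeasure lebesgue K < \<infinity>" using K by auto
  obtain s where s: "\<And>n. simple_function lebesgue (s n)" "AE z in lebesgue. (\<lambda>n. s n z) \<longlonglongrightarrow> \<Phi> z"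
    using \<Phi> unfolding strongly_measurable_def by blast
  \<comment> \<open>Values of \<Phi> on K x K have norm at most C, so cutting at C + 1 does not
    affect the limit there but makes the approximants uniformly bounded.\<close>
  define cut :: "real \<Rightarrow> 'e \<Rightarrow> 'e" where "cut i v = (if norm v \<le> C + 1 then i *\<^sub>R v else 0)" for i v
  define t where "t n z = cut (indicator (K \<times> K) z) (s n z)" for n z
  have t: "simple_function lebesgue (t n)" for n
    unfolding t_def[abs_def]
    by (rule simple_function_compose2[OF simple_function_indicator s(1)]) (use KK in auto)
  \<comment> \<open>Sections of Lebesgue measurable sets need not be measurable. A Borel version
    differs only on a null set, almost all of whose sections are null.\<close>
  have "\<forall>n. \<exists>t'. simple_function lborel t' \<and> (AE z in lborel. t n z = t' z)"
    using completion_ex_simple_function[OF t] by blast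
  then obtain t' where t': "\<And>n. simple_function lborel (t' n)" "\<And>n. AE z in lborel. t n z = t' n z" by metis
  have "AE z in ?P. (\<lambda>n. s n z) \<longlonglongrightarrow> \<Phi> z" using s(2) by (simp add: AE_completion_iff)
  moreover have "AE z in ?P. \<forall>n. t n z = t' n z" using t'(2) by (simp add: AE_all_countable)
  ultimately have "AE z in ?P. (z \<in> K \<times> K \<longrightarrow> (\<lambda>n. t' n z) \<longlonglongrightarrow> \<Phi> z \<and> (\<forall>n. norm (t' n z) \<le> \<bar>C\<bar> + 1))"
  proof eventually_elim
    case (elim z)
    show ?case
    proof
      assume z: "z \<in> K \<times> K"
      have "norm (\<Phi> z) < C + 1" using z C[of "fst z" "snd z"] by auto
      then have "\<forall>\<^sub>F n in sequentially. norm (s n z) < C + 1"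
        by (rule order_tendstoD(2)[OF tendsto_norm[OF elim(1)]])
      then have "\<forall>\<^sub>F n in sequentially. t n z = s n z"
        by eventually_elim (use z in \<open>auto simp: t_def cut_def\<close>)
      then have "(\<lambda>n. t n z) \<longlonglongrightarrow> \<Phi> z" using elim(1) by (simp add: tendsto_cong)
      moreover have "norm (t n z) \<le> \<bar>C\<bar> + 1" for n using z by (auto simp: t_def cut_def)
      ultimately show "(\<lambda>n. t' n z) \<longlonglongrightarrow> \<Phi> z \<and> (\<forall>n. norm (t' n z) \<le> \<bar>C\<bar> + 1)" using elim(2) by simp
    qed
  qed
  then have "AE z in (lborel :: (real ^ 'd) measure) \<Otimes>\<^sub>M lborel. (z \<in> K \<times> K \<longrightarrow> (\<lambda>n. t' n z) \<longlonglongrightarrow> \<Phi> z \<and> (\<forall>n. norm (t' n z) \<le> \<bar>C\<bar> + 1))"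
    by (simp only: lborel_prod)
  then have good: "AE x in lborel. AE y in lborel. ((x, y) \<in> K \<times> K \<longrightarrow> (\<lambda>n. t' n (x, y)) \<longlonglongrightarrow> \<Phi> (x, y) \<and> (\<forall>n. norm (t' n (x, y)) \<le> \<bar>C\<bar> + 1))"
    by (rule lborel_pair.AE_pair)
  \<comment> \<open>The measure \<open>r n v x\<close> of a section of this level set is the
    coefficient of v in the integral of the n-th approximant over the section at x.\<close>
  define E where "E n v = {z. t' n z = v \<and> snd z \<in> K}" for n v
  have E: "E n v \<in> sets ((lborel :: (real ^ 'd) measure) \<Otimes>\<^sub>M lborel)" for n v
  proof -
    have "t' n -` {v} \<inter> space ?P \<in> sets ?P" by (rule simple_functionD(2)[OF t'(1)])
    moreover have "UNIV \<times> K \<in> sets ?P" using K by (simp add: borel_Times)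
    ultimately have "(t' n -` {v} \<inter> space ?P) \<inter> (UNIV \<times> K) \<in> sets ?P" by (rule sets.Int)
    also have "(t' n -` {v} \<inter> space ?P) \<inter> (UNIV \<times> K) = E n v" by (auto simp: E_def)
    finally show ?thesis by (simp only: lborel_prod)
  qed
  define r where "r n v x = enn2real (emeasure lborel (Pair x -` E n v))" for n v x
  have rm: "r n v \<in> borel_measurable lborel" for n v
    unfolding r_def[abs_def]
    by (rule measurable_compose[OF lborel.measurable_emeasure_Pair[OF E]]) simp
  have Esec: "Pair x -` E n v \<in> sets lborel" for n v x by (rule sets_Pair1[OF E])
  have Esub: "Pair x -` E n v \<subseteq> K" for n v x by (auto simp: E_def)
  have Efin: "emeasure lborel (Pair x -` E n v) \<le> emeasure lborel K" for n v x
    by (rule emeasure_mono[OF Esub]) (use K in simp)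
  have r_le: "r n v x \<le> measure lborel K" for n v x
    unfolding r_def measure_def using Efin K(2) by (intro enn2real_mono) auto
  have S_eq: "(\<lambda>y. indicat_real K y *\<^sub>R t' n (x, y)) = (\<lambda>y. \<Sum>v\<in>range (t' n). indicat_real (Pair x -` E n v) y *\<^sub>R v)" for n x
  proof
    fix y
    have fin: "finite (range (t' n))" using t'(1)[of n] by (simp add: simple_function_def)
    have "(\<Sum>v\<in>range (t' n). indicat_real (Pair x -` E n v) y *\<^sub>R v) = (\<Sum>v\<in>range (t' n). if v = t' n (x, y) then indicat_real K y *\<^sub>R v else 0)"
      by (intro sum.cong) (auto simp: E_def indicator_def)
    also have "\<dots> = indicat_real K y *\<^sub>R t' n (x, y)" using fin by (simp add: sum.delta)
    finally show "indicat_real K y *\<^sub>R t' n (x, y) = (\<Sum>v\<in>range (t' n). indicat_real (Pair x -` E n v) y *\<^sub>R v)" by simp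
  qed
  have S: "strongly_integrable lebesgue (\<lambda>y. indicat_real K y *\<^sub>R t' n (x, y))"
    "strong_integral lebesgue (\<lambda>y. indicat_real K y *\<^sub>R t' n (x, y)) = (\<Sum>v\<in>range (t' n). r n v x *\<^sub>R v)" for n x
  proof -
    have fin: "finite (range (t' n))" using t'(1)[of n] by (simp add: simple_function_def)
    have B: "Pair x -` E n v \<in> sets lebesgue" "emeasure lebesgue (Pair x -` E n v) < \<infinity>" 
      "measure lebesgue (Pair x -` E n v) = r n v x" for v
      using Esec[of x n v] Efin[of x n v] K(2) by (auto simp: r_def measure_def intro: le_less_trans)
    have *: "strongly_integrable lebesgue (\<lambda>y. \<Sum>v\<in>range (t' n). indicat_real (Pair x -` E n v) y *\<^sub>R v) \<and>
      strong_integral lebesgue (\<lambda>y. \<Sum>v\<in>range (t' n). indicat_real (Pair x -` E n v) y *\<^sub>R v) = (\<Sum>v\<in>range (t' n). r n v x *\<^sub>R v)"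
      using strongly_integrable_sum[where f = "\<lambda>v y. indicat_real (Pair x -` E n v) y *\<^sub>R v",
          OF fin has_strong_integral_indicator(1)[OF B(1,2)]]
      unfolding has_strong_integral_indicator(2)[OF B(1,2)] B(3) .
    show "strongly_integrable lebesgue (\<lambda>y. indicat_real K y *\<^sub>R t' n (x, y))"
      "strong_integral lebesgue (\<lambda>y. indicat_real K y *\<^sub>R t' n (x, y)) = (\<Sum>v\<in>range (t' n). r n v x *\<^sub>R v)"
      unfolding S_eq using * by auto
  qed
  show ?thesis
  proof (rule strongly_measurable_limit_sums[where V = "\<lambda>n. range (t' n)" and r = "\<lambda>n v x. indicator K x * r n v x" and B = "measure lborel K"])
    show "finite (range (t' n))" for n using t'(1)[of n] by (simp add: simple_function_def)
    show "(\<lambda>x. indicator K x * r n v x) \<in> borel_measurable lebesgue" for n v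
      using rm[of n v] K by (intro measurable_completion borel_measurable_times borel_measurable_indicator) auto
    show "0 \<le> indicator K x * r n v x" "indicator K x * r n v x \<le> measure lborel K" for n v x
      using r_le[of n v x] by (auto simp: r_def indicator_def)
    have "AE x in lebesgue. AE y in lebesgue. ((x, y) \<in> K \<times> K \<longrightarrow> (\<lambda>n. t' n (x, y)) \<longlonglongrightarrow> \<Phi> (x, y) \<and> (\<forall>n. norm (t' n (x, y)) \<le> \<bar>C\<bar> + 1))"
      using good by (simp add: AE_completion_iff)
    then show "AE x in lebesgue. (\<lambda>n. \<Sum>v\<in>range (t' n). (indicator K x * r n v x) *\<^sub>R v)
       \<longlonglongrightarrow> indicat_real K x *\<^sub>R strong_integral lebesgue (\<lambda>y. indicator K y *\<^sub>R \<Phi> (x, y))"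
    proof eventually_elim
      case (elim x)
      show ?case
      proof (cases "x \<in> K")
        case True
        have lim: "AE y in lebesgue. (\<lambda>n. indicat_real K y *\<^sub>R t' n (x, y)) \<longlonglongrightarrow> indicat_real K y *\<^sub>R \<Phi> (x, y)"
          using elim by eventually_elim (use True in \<open>auto simp: indicator_def\<close>)
        have "simple_function lebesgue (\<lambda>y. indicat_real K y *\<^sub>R t' n (x, y))" for n
        proof -
          have "finite (range (\<lambda>y. indicat_real K y *\<^sub>R t' n (x, y)))"
          proof (rule finite_subset)
            show "range (\<lambda>y. indicat_real K y *\<^sub>R t' n (x, y)) \<subseteq> insert 0 (range (t' n))" by (auto simp: indicator_def)
          qed (use t'(1)[of n] in \<open>simp add: simple_function_def\<close>)
          moreover have "(\<lambda>y. indicat_real K y *\<^sub>R t' n (x, y)) -` {v} \<in> sets lebesgue" for v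
          proof -
            have "(\<lambda>y. indicat_real K y *\<^sub>R t' n (x, y)) -` {v} = Pair x -` E n v \<union> (if v = 0 then - K else {})"
              by (auto simp: E_def indicator_def)
            also have "\<dots> \<in> sets lebesgue" using Esec[of x n v] K by (auto intro!: sets.Un)
            finally show ?thesis .
          qed
          ultimately show ?thesis by (auto simp: simple_function_def)
        qed
        then have "strongly_measurable lebesgue (\<lambda>y. indicat_real K y *\<^sub>R \<Phi> (x, y))"
          using lim unfolding strongly_measurable_def
          by (intro exI[of _ "\<lambda>n y. indicat_real K y *\<^sub>R t' n (x, y)"] conjI allI)
        then have int: "strongly_integrable lebesgue (\<lambda>y. indicat_real K y *\<^sub>R \<Phi> (x, y))"
          by (rule strongly_integrable_bounded[OF _ KL, of _ C]) (use C[OF True] in auto)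
        define \<delta> where "\<delta> n y = indicat_real K y *\<^sub>R t' n (x, y) - indicat_real K y *\<^sub>R \<Phi> (x, y)" for n y
        have \<delta>: "strongly_integrable lebesgue (\<delta> n)" "strong_integral lebesgue (\<delta> n) = (\<Sum>v\<in>range (t' n). r n v x *\<^sub>R v)
            - strong_integral lebesgue (\<lambda>y. indicator K y *\<^sub>R \<Phi> (x, y))" for n
          using strongly_integrable_linear[OF S(1)[of n x] int, of 1 "-1"] S(2)[of n x] by (simp_all add: \<delta>_def[abs_def])
        \<comment> \<open>The dominating constant adds the bound |C| + 1 for the approximant to the
          bound |C| for \<Phi>.\<close>
        have d0: "(\<lambda>n. \<integral>\<^sup>+y. norm (\<delta> n y) powr 1 \<partial>lebesgue) \<longlonglongrightarrow> 0"
        proof (rule nn_integral_dominated_tendsto_0[where C = "2 * \<bar>C\<bar> + 1" and g = "\<lambda>y. indicat_real K y *\<^sub>R (1::real)"])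
          show "strongly_measurable lebesgue (\<delta> n)" for n using \<delta>(1) by (simp add: strongly_integrable_def)
          show "AE y in lebesgue. (\<lambda>n. \<delta> n y) \<longlonglongrightarrow> 0"
            using lim by eventually_elim (simp only: \<delta>_def LIM_zero)
          show "AE y in lebesgue. norm (\<delta> n y) \<le> (2 * \<bar>C\<bar> + 1) * norm (indicat_real K y *\<^sub>R (1::real))" for n
            using elim
          proof eventually_elim
            case (elim y)
            show ?case
            proof (cases "y \<in> K")
              case K: True
              then have "norm (t' n (x, y)) \<le> \<bar>C\<bar> + 1" "norm (\<Phi> (x, y)) \<le> \<bar>C\<bar>"
                using elim True C[OF True K] by auto
              then show ?thesis using K norm_triangle_ineq4[of "t' n (x, y)" "\<Phi> (x, y)"] by (simp add: \<delta>_def)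
            qed (simp add: \<delta>_def)
          qed
          show "strongly_measurable lebesgue (\<lambda>y. indicat_real K y *\<^sub>R (1::real))"
            by (rule strongly_measurable_set[OF KL(1) strongly_measurable_const])
          show "(\<integral>\<^sup>+y. norm (indicat_real K y *\<^sub>R (1::real)) powr 1 \<partial>lebesgue) < \<infinity>"
            using KL by (simp add: ennreal_indicator)
        qed auto
        have "(\<lambda>n. ennreal (norm (strong_integral lebesgue (\<delta> n)))) \<longlonglongrightarrow> 0"
        proof (rule tendsto_sandwich[OF _ _ tendsto_const])
          show "(\<lambda>n. \<integral>\<^sup>+y. norm (\<delta> n y) \<partial>lebesgue) \<longlonglongrightarrow> 0" using d0 by simp
          show "\<forall>\<^sub>F n in sequentially. ennreal (norm (strong_integral lebesgue (\<delta> n))) \<le> (\<integral>\<^sup>+y. norm (\<delta> n y) \<partial>lebesgue)"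
            by (intro always_eventually allI has_strong_integral_norm_le has_strong_integral_strong_integral \<delta>(1))
        qed auto
        then have "(\<lambda>n. strong_integral lebesgue (\<delta> n)) \<longlonglongrightarrow> 0"
          by (simp add: ennreal_tendsto_0_iff tendsto_norm_zero_iff)
        then have "(\<lambda>n. \<Sum>v\<in>range (t' n). r n v x *\<^sub>R v) \<longlonglongrightarrow> strong_integral lebesgue (\<lambda>y. indicator K y *\<^sub>R \<Phi> (x, y))"
          unfolding \<delta>(2) by (rule LIM_zero_cancel)
        then show ?thesis using True by simp
      qed simp
    qed
  qed
qed

section \<open>Comparison of decoupled sums\<close>

lemma sign_sum_scaleR: "sign_sum p N (\<lambda>n. c *\<^sub>R v n) = \<bar>c\<bar> powr p * sign_sum p N v"
proof -
  have "(\<Sum>n<N. \<epsilon> n *\<^sub>R c *\<^sub>R v n) = c *\<^sub>R (\<Sum>n<N. \<epsilon> n *\<^sub>R v n)" for \<epsilon> :: "nat \<Rightarrow> real"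
    unfolding scaleR_sum_right by (intro sum.cong) (auto simp: mult.commute)
  then show ?thesis unfolding sign_sum_def by (simp add: powr_mult sum_distrib_left)
qed

lemma card_signs: "card (signs N) = 2 ^ N"
  by (simp add: signs_def card_words numeral_2_eq_2)

text \<open>Both sides are decoupled; the hypothesis compares the decoupled sums.\<close>

lemma decoupled_comparison:
  fixes g f :: "nat \<Rightarrow> (nat \<Rightarrow> 'c) \<Rightarrow> 'c \<Rightarrow> 'e::banach"
  assumes umd: "UMD_bound TYPE('e) p \<beta>" and p: "1 \<le> p" and C: "finite C" "C \<noteq> {}" and D: "0 \<le> D"
    and g_cong: "\<And>n x x' y. n < N \<Longrightarrow> (\<And>i. i < n \<Longrightarrow> x i = x' i) \<Longrightarrow> g n x y = g n x' y"
    and g_sum: "\<And>n x. n < N \<Longrightarrow> x \<in> words N C \<Longrightarrow> (\<Sum>y\<in>C. g n x y) = 0"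
    and f_cong: "\<And>n x x' y. n < N \<Longrightarrow> (\<And>i. i < n \<Longrightarrow> x i = x' i) \<Longrightarrow> f n x y = f n x' y"
    and f_sum: "\<And>n x. n < N \<Longrightarrow> x \<in> words N C \<Longrightarrow> (\<Sum>y\<in>C. f n x y) = 0"
    and le: "\<And>x z. x \<in> words N C \<Longrightarrow> z \<in> words N C \<Longrightarrow>
      real (card (words N C)) * sign_sum p N (\<lambda>n. g n x (z n)) \<le> D powr p * (\<Sum>y\<in>words N C. sign_sum p N (\<lambda>n. f n x (y n)))"
  shows "(\<Sum>x\<in>words N C. norm (\<Sum>n<N. g n x (x n)) powr p)
    \<le> (D * \<beta>\<^sup>2) powr p * (\<Sum>x\<in>words N C. norm (c + (\<Sum>n<N. f n x (x n))) powr p)"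
proof -
  let ?W = "words N C" and ?B = "\<beta> powr p"
  define w where "w = real (card ?W)"
  have w: "0 < w" using C by (simp add: w_def card_gt_0_iff finite_words words_nonempty)
  have p0: "0 < p" and \<beta>: "0 \<le> \<beta>" using p umd by (auto simp: UMD_bound_def)
  have swap: "(\<Sum>x\<in>?W. \<Sum>y\<in>?W. sign_sum p N (\<lambda>n. u n x (y n)))
      = (\<Sum>\<epsilon>\<in>signs N. \<Sum>x\<in>?W. \<Sum>y\<in>?W. norm (\<Sum>n<N. \<epsilon> n *\<^sub>R u n x (y n)) powr p)"
    for u :: "nat \<Rightarrow> (nat \<Rightarrow> 'c) \<Rightarrow> 'c \<Rightarrow> 'e"
  proof -
    have "(\<Sum>x\<in>?W. \<Sum>y\<in>?W. sign_sum p N (\<lambda>n. u n x (y n)))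
      = (\<Sum>x\<in>?W. \<Sum>\<epsilon>\<in>signs N. \<Sum>y\<in>?W. norm (\<Sum>n<N. \<epsilon> n *\<^sub>R u n x (y n)) powr p)"
      unfolding sign_sum_def by (intro sum.cong refl sum.swap)
    also have "\<dots> = (\<Sum>\<epsilon>\<in>signs N. \<Sum>x\<in>?W. \<Sum>y\<in>?W. norm (\<Sum>n<N. \<epsilon> n *\<^sub>R u n x (y n)) powr p)"
      by (rule sum.swap)
    finally show ?thesis .
  qed
  define X Y where "X = (\<Sum>x\<in>?W. norm (\<Sum>n<N. g n x (x n)) powr p)"
    and "Y = (\<Sum>x\<in>?W. norm (c + (\<Sum>n<N. f n x (x n))) powr p)"
  \<comment> \<open>Decoupling holds for each fixed choice of signs; summing over all choices
    produces the Rademacher sums on one side and a factor 2 ^ N on the other.\<close>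
  have "w * X \<le> ?B * (\<Sum>x\<in>?W. \<Sum>y\<in>?W. norm (\<Sum>n<N. \<epsilon> n *\<^sub>R g n x (y n)) powr p)" if "\<epsilon> \<in> signs N" for \<epsilon>
  proof -
    have "(\<Sum>x\<in>?W. \<Sum>y\<in>?W. norm (0 + (\<Sum>n<N. g n x (x n))) powr p)
      \<le> ?B * (\<Sum>x\<in>?W. \<Sum>y\<in>?W. norm (1 *\<^sub>R 0 + (\<Sum>n<N. \<epsilon> n *\<^sub>R g n x (y n))) powr p)"
      by (rule decoupling(2)[OF umd p0 C g_cong g_sum signs_nth[OF that]]) auto
    then show ?thesis by (simp add: X_def w_def sum_distrib_left)
  qed
  then have "(\<Sum>\<epsilon>\<in>signs N. w * X) \<le> (\<Sum>\<epsilon>\<in>signs N. ?B * (\<Sum>x\<in>?W. \<Sum>y\<in>?W. norm (\<Sum>n<N. \<epsilon> n *\<^sub>R g n x (y n)) powr p))"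
    by (rule sum_mono)
  then have 1: "2 ^ N * (w * X) \<le> ?B * (\<Sum>x\<in>?W. \<Sum>y\<in>?W. sign_sum p N (\<lambda>n. g n x (y n)))"
    by (simp add: card_signs swap sum_distrib_left)
  have 2: "w * (\<Sum>x\<in>?W. \<Sum>z\<in>?W. sign_sum p N (\<lambda>n. g n x (z n)))
      \<le> D powr p * w * (\<Sum>x\<in>?W. \<Sum>y\<in>?W. sign_sum p N (\<lambda>n. f n x (y n)))"
  proof -
    have "w * (\<Sum>x\<in>?W. \<Sum>z\<in>?W. sign_sum p N (\<lambda>n. g n x (z n))) = (\<Sum>x\<in>?W. \<Sum>z\<in>?W. w * sign_sum p N (\<lambda>n. g n x (z n)))"
      by (simp add: sum_distrib_left)
    also have "\<dots> \<le> (\<Sum>x\<in>?W. \<Sum>z\<in>?W. D powr p * (\<Sum>y\<in>?W. sign_sum p N (\<lambda>n. f n x (y n))))"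
      unfolding w_def by (intro sum_mono le)
    also have "\<dots> = D powr p * w * (\<Sum>x\<in>?W. \<Sum>y\<in>?W. sign_sum p N (\<lambda>n. f n x (y n)))"
      by (simp add: w_def sum_distrib_left mult.assoc mult.left_commute)
    finally show ?thesis .
  qed
  then have 2: "(\<Sum>x\<in>?W. \<Sum>z\<in>?W. sign_sum p N (\<lambda>n. g n x (z n)))
      \<le> D powr p * (\<Sum>x\<in>?W. \<Sum>y\<in>?W. sign_sum p N (\<lambda>n. f n x (y n)))"
    using w by (simp add: mult.assoc mult.left_commute[of _ w])
  have "(\<Sum>x\<in>?W. \<Sum>y\<in>?W. norm (\<Sum>n<N. \<epsilon> n *\<^sub>R f n x (y n)) powr p) \<le> ?B * (w * Y)" if "\<epsilon> \<in> signs N" for \<epsilon>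
  proof -
    let ?u = "\<lambda>x y. \<Sum>n<N. \<epsilon> n *\<^sub>R f n x (y n)"
    have *: "(\<Sum>x\<in>?W. \<Sum>y\<in>?W. norm (\<sigma> *\<^sub>R c + ?u x y) powr p) \<le> ?B * (w * Y)" if \<sigma>: "\<sigma> \<in> {-1, 1}" for \<sigma>
    proof -
      have "(\<Sum>x\<in>?W. \<Sum>y\<in>?W. norm (\<sigma> *\<^sub>R c + ?u x y) powr p)
        \<le> ?B * (\<Sum>x\<in>?W. \<Sum>y\<in>?W. norm (c + (\<Sum>n<N. f n x (x n))) powr p)"
        by (rule decoupling(1)[OF umd p0 C f_cong f_sum signs_nth[OF \<open>\<epsilon> \<in> signs N\<close>] \<sigma>]) auto
      then show ?thesis by (simp add: Y_def w_def sum_distrib_left)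
    qed
    \<comment> \<open>The constant \<open>c\<close> is absent from the decoupled sums that are
      compared. It is removed by averaging the bounds for c and - c and using convexity.\<close>
    have "norm (?u x y) powr p \<le> (1 / 2) * norm (1 *\<^sub>R c + ?u x y) powr p + (1 / 2) * norm ((-1) *\<^sub>R c + ?u x y) powr p" for x y
      using convex_onD[OF convex_on_norm_affine_powr[OF p, of "?u x y" 1], of "1 / 2" c "- c"]
      by (simp add: add.commute)
    then have "(\<Sum>x\<in>?W. \<Sum>y\<in>?W. norm (?u x y) powr p)
       \<le> (\<Sum>x\<in>?W. \<Sum>y\<in>?W. (1 / 2) * norm (1 *\<^sub>R c + ?u x y) powr p + (1 / 2) * norm ((-1) *\<^sub>R c + ?u x y) powr p)"
      by (intro sum_mono)
    also have "\<dots> = (1 / 2) * (\<Sum>x\<in>?W. \<Sum>y\<in>?W. norm (1 *\<^sub>R c + ?u x y) powr p) + (1 / 2) * (\<Sum>x\<in>?W. \<Sum>y\<in>?W. norm ((-1) *\<^sub>R c + ?u x y) powr p)"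
      by (simp only: sum.distrib sum_distrib_left)
    also have "\<dots> \<le> ?B * (w * Y)" using *[of 1] *[of "-1"] by simp
    finally show ?thesis .
  qed
  then have "(\<Sum>\<epsilon>\<in>signs N. \<Sum>x\<in>?W. \<Sum>y\<in>?W. norm (\<Sum>n<N. \<epsilon> n *\<^sub>R f n x (y n)) powr p) \<le> (\<Sum>\<epsilon>\<in>signs N. ?B * (w * Y))"
    by (rule sum_mono)
  then have 3: "(\<Sum>x\<in>?W. \<Sum>y\<in>?W. sign_sum p N (\<lambda>n. f n x (y n))) \<le> 2 ^ N * (?B * (w * Y))"
    by (simp add: card_signs swap)
  have "2 ^ N * (w * X) \<le> ?B * (D powr p * (2 ^ N * (?B * (w * Y))))"
    using order.trans[OF 1 mult_left_mono[OF order.trans[OF 2 mult_left_mono[OF 3]]]] by simp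
  then have "(2 ^ N * w) * X \<le> (2 ^ N * w) * (?B * ?B * D powr p * Y)"
    by (simp add: mult_ac)
  then have "X \<le> ?B * ?B * D powr p * Y"
    using w by (subst (asm) mult_le_cancel_left_pos) auto
  also have "?B * ?B * D powr p = (D * \<beta>\<^sup>2) powr p"
    using D \<beta> by (simp add: powr_mult power2_eq_square mult_ac)
  finally show ?thesis by (simp add: X_def Y_def)
qed

section \<open>Words and cubes\<close>

context dyadic_levels
begin

text \<open>An arbitrary enumeration of the descendants m levels below. All cubes share one alphabet
  with \<open>2 ^ (CARD('d) * m)\<close> letters, so that words of length N form a product
  space.\<close>

definition label :: "nat \<Rightarrow> int \<Rightarrow> (real ^ 'd) set \<Rightarrow> nat \<Rightarrow> (real ^ 'd) set" where
  "label m k K = (SOME b. bij_betw b {..<(2::nat) ^ (CARD('d) * m)} (desc m k K))"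

text \<open>A word spells a descending chain of cubes. The cube with index n depends only on the
  letters before n, which is the predictability required for decoupling.\<close>

primrec path :: "nat \<Rightarrow> int \<Rightarrow> (real ^ 'd) set \<Rightarrow> nat \<Rightarrow> (nat \<Rightarrow> nat) \<Rightarrow> (real ^ 'd) set" where
  "path m k Q 0 x = Q"
| "path m k Q (Suc n) x = label m (k + int (n * m)) (path m k Q n x) (x n)"

text \<open>A representative point lets averages over all ancestors of a cube be written, through
  \<open>cb\<close>, as functions of that cube.\<close>

definition point :: "(real ^ 'd) set \<Rightarrow> real ^ 'd" where
  "point J = (SOME \<xi>. \<xi> \<in> J)"

lemma point_in: "J \<in> G k \<Longrightarrow> point J \<in> J"
  unfolding point_def using cube_nonempty by (metis ex_in_conv someI)

lemma bij_label: assumes "K \<in> G k" shows "bij_betw (label m k K) {..<(2::nat) ^ (CARD('d) * m)} (desc m k K)"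
proof -
  have "\<exists>b. bij_betw b {..<(2::nat) ^ (CARD('d) * m)} (desc m k K)"
    using ex_bij_betw_nat_finite[OF finite_desc[OF assms, of m]] card_desc[OF assms, of m]
    by (simp add: atLeast0LessThan)
  then show ?thesis unfolding label_def by (rule someI_ex)
qed

lemma label_in: "K \<in> G k \<Longrightarrow> y < 2 ^ (CARD('d) * m) \<Longrightarrow> label m k K y \<in> desc m k K"
  using bij_betwE[OF bij_label] by auto

lemma sum_label:
  assumes "K \<in> G k"
  shows "(\<Sum>y<(2::nat) ^ (CARD('d) * m). \<Phi> (label m k K y)) = (\<Sum>J\<in>desc m k K. \<Phi> J)"
  by (rule sum.reindex_bij_betw[OF bij_label[OF assms]])

lemma path_in:
  assumes Q: "Q \<in> G k" and x: "x \<in> words N {..<(2::nat) ^ (CARD('d) * m)}"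
  shows "n \<le> N \<Longrightarrow> path m k Q n x \<in> G (k + int (n * m)) \<and> path m k Q n x \<subseteq> Q"
proof (induction n)
  case (Suc n)
  then have "path m k Q (Suc n) x \<in> desc m (k + int (n * m)) (path m k Q n x)"
    using words_nth[OF x, of n] label_in[of "path m k Q n x" "k + int (n * m)" "x n" m] by simp
  moreover have lev: "k + int (n * m) + int m = k + int (Suc n * m)" by (simp add: algebra_simps)
  ultimately have "path m k Q (Suc n) x \<in> G (k + int (Suc n * m))" "path m k Q (Suc n) x \<subseteq> path m k Q n x"
    unfolding desc_def lev by blast+
  with Suc show ?case by (meson Suc_leD order_trans)
qed (use Q in simp)

lemma path_cong: "(\<And>i. i < n \<Longrightarrow> x i = x' i) \<Longrightarrow> path m k Q n x = path m k Q n x'"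
  by (induction n) auto

lemma path_antimono:
  assumes Q: "Q \<in> G k" and x: "x \<in> words N {..<(2::nat) ^ (CARD('d) * m)}" and "n \<le> n'" "n' \<le> N"
  shows "path m k Q n' x \<subseteq> path m k Q n x"
  using assms(3,4)
proof (induction n' rule: dec_induct)
  case (step l)
  then have "path m k Q (Suc l) x \<in> desc m (k + int (l * m)) (path m k Q l x)"
    using words_nth[OF x, of l] path_in[OF Q x, of l] label_in[of "path m k Q l x" "k + int (l * m)" "x l" m] by simp
  then show ?case using step by (auto simp: desc_def)
qed simp

lemma cb_path:
  assumes Q: "Q \<in> G k" and x: "x \<in> words N {..<(2::nat) ^ (CARD('d) * m)}" and "n \<le> N" "\<xi> \<in> path m k Q N x"
  shows "cb (k + int (n * m)) \<xi> = path m k Q n x"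
  using path_in[OF Q x, of n] path_antimono[OF Q x, of n N] assms(3,4) by (intro cb_unique) auto

text \<open>The last cube determines all earlier cubes of the chain and hence all letters;
  surjectivity follows by counting.\<close>

lemma bij_path:
  assumes Q: "Q \<in> G k"
  shows "bij_betw (path m k Q N) (words N {..<(2::nat) ^ (CARD('d) * m)}) (desc (N * m) k Q)"
proof -
  let ?W = "words N {..<(2::nat) ^ (CARD('d) * m)}"
  have "inj_on (path m k Q N) ?W"
  proof (rule inj_onI)
    fix x x' assume x: "x \<in> ?W" and x': "x' \<in> ?W" and eq: "path m k Q N x = path m k Q N x'"
    have p: "path m k Q n x = path m k Q n x'" if n: "n \<le> N" for n
    proof -
      have "path m k Q N x \<in> G (k + int (N * m))" using path_in[OF Q x, of N] by simp
      then obtain \<xi> where "\<xi> \<in> path m k Q N x" using cube_nonempty by blast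
      then show ?thesis using cb_path[OF Q x n] cb_path[OF Q x' n] eq by metis
    qed
    have "x n = x' n" if n: "n < N" for n
    proof -
      have K: "path m k Q n x \<in> G (k + int (n * m))" using path_in[OF Q x, of n] n by simp
      have "label m (k + int (n * m)) (path m k Q n x) (x n) = label m (k + int (n * m)) (path m k Q n x) (x' n)"
        using p[of n] p[of "Suc n"] n by simp
      then show ?thesis
        using bij_label[OF K, of m] words_nth[OF x n] words_nth[OF x' n] unfolding bij_betw_def inj_on_def by blast
    qed
    then show "x = x'" using x x' unfolding words_def by (intro PiE_ext[OF x[unfolded words_def] x'[unfolded words_def]]) auto
  qed
  moreover have "path m k Q N ` ?W = desc (N * m) k Q"
  proof (rule card_subset_eq[OF finite_desc[OF Q]])
    show "path m k Q N ` ?W \<subseteq> desc (N * m) k Q"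
      using path_in[OF Q, of _ N m N] by (auto simp: desc_def)
    show "card (path m k Q N ` ?W) = card (desc (N * m) k Q)"
      using card_image[OF calculation] card_desc[OF Q, of "N * m"]
      by (simp add: card_words power_mult[symmetric] mult.assoc mult.commute[of m N])
  qed
  ultimately show ?thesis by (simp add: bij_betw_def)
qed

lemma cb_point: "J \<in> G k \<Longrightarrow> \<xi> \<in> J \<Longrightarrow> k' \<le> k \<Longrightarrow> cb k' (point J) = cb k' \<xi>"
proof -
  assume J: "J \<in> G k" "\<xi> \<in> J" "k' \<le> k"
  have "J \<subseteq> cb k' \<xi>" using cb_mono[OF J(3), of \<xi>] cb_unique[OF J(1,2)] by simp
  then show ?thesis using point_in[OF J(1)] by (intro cb_eq) auto
qed

lemma desc_subset_eq:
  assumes K: "K \<in> G k" and I: "I \<in> desc q k K" and q: "q \<le> m"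
  shows "{J \<in> desc m k K. cb (k + int q) (point J) = I} = desc (m - q) (k + int q) I"
proof -
  have lev: "k + int q + int (m - q) = k + int m" using q by simp
  have "cb (k + int q) (point J) = I \<longleftrightarrow> J \<subseteq> I" if J: "J \<in> G (k + int m)" for J
  proof
    assume "cb (k + int q) (point J) = I"
    then have "J \<subseteq> I" using cb_mono[of "k + int q" "k + int m" "point J"] cb_unique[OF J point_in[OF J]] q by auto
    then show "J \<subseteq> I" .
  next
    assume "J \<subseteq> I"
    then show "cb (k + int q) (point J) = I" using I point_in[OF J] by (intro cb_unique) (auto simp: desc_def)
  qed
  moreover have "I \<subseteq> K" using I by (simp add: desc_def)
  ultimately show ?thesis unfolding desc_def lev by auto
qed

text \<open>Each intermediate cube \<open>I\<close> has \<open>2 ^ (CARD('d) * (m - q))\<close>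
  descendants at the bottom level, and this is its multiplicity in the sum on the left.\<close>

lemma sum_desc_cb:
  fixes \<Phi> :: "(real ^ 'd) set \<Rightarrow> 'v::real_vector"
  assumes K: "K \<in> G k" and q: "q \<le> m"
  shows "(\<Sum>J\<in>desc m k K. \<Phi> (cb (k + int q) (point J))) = (2 ^ (CARD('d) * (m - q))) *\<^sub>R (\<Sum>I\<in>desc q k K. \<Phi> I)"
proof -
  have sub: "(\<lambda>J. cb (k + int q) (point J)) ` desc m k K \<subseteq> desc q k K"
  proof safe
    fix J assume "J \<in> desc m k K"
    then have "point J \<in> K" using point_in[of J "k + int m"] by (auto simp: desc_def)
    then show "cb (k + int q) (point J) \<in> desc q k K" using desc_iff[OF K] by blast
  qed
  have "(\<Sum>J\<in>desc m k K. \<Phi> (cb (k + int q) (point J)))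
    = (\<Sum>I\<in>desc q k K. \<Sum>J\<in>{J \<in> desc m k K. cb (k + int q) (point J) = I}. \<Phi> (cb (k + int q) (point J)))"
    by (rule sum.group[OF finite_desc[OF K] finite_desc[OF K] sub, symmetric])
  also have "\<dots> = (\<Sum>I\<in>desc q k K. \<Sum>J\<in>{J \<in> desc m k K. cb (k + int q) (point J) = I}. \<Phi> I)"
    by (intro sum.cong) auto
  also have "\<dots> = (\<Sum>I\<in>desc q k K. (2 ^ (CARD('d) * (m - q))) *\<^sub>R \<Phi> I)"
  proof (rule sum.cong[OF refl])
    fix I assume I: "I \<in> desc q k K"
    have "I \<in> G (k + int q)" using I by (simp add: desc_def)
    then show "(\<Sum>J\<in>{J \<in> desc m k K. cb (k + int q) (point J) = I}. \<Phi> I) = (2 ^ (CARD('d) * (m - q))) *\<^sub>R \<Phi> I"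
      unfolding desc_subset_eq[OF K I q] by (simp add: sum_constant_scaleR card_desc)
  qed
  finally show ?thesis by (simp add: scaleR_sum_right)
qed

lemma sum_average_cb:
  fixes F :: "real ^ 'd \<Rightarrow> 'e::banach"
  assumes K: "K \<in> G k" and F: "strongly_integrable lebesgue (\<lambda>x. indicator K x *\<^sub>R F x)" and q: "q \<le> m"
  shows "(\<Sum>J\<in>desc m k K. average (cb (k + int q) (point J)) F) = (2 ^ (CARD('d) * m)) *\<^sub>R average K F"
proof -
  have "(\<Sum>J\<in>desc m k K. average (cb (k + int q) (point J)) F) = (2 ^ (CARD('d) * (m - q))) *\<^sub>R (\<Sum>I\<in>desc q k K. average I F)"
    by (rule sum_desc_cb[OF K q])
  also have "(\<Sum>I\<in>desc q k K. average I F) = (2 ^ (CARD('d) * q)) *\<^sub>R average K F"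
    using average_desc[OF K F, of q] by simp
  also have "(2 ^ (CARD('d) * (m - q))) *\<^sub>R (2 ^ (CARD('d) * q)) *\<^sub>R average K F = (2 ^ (CARD('d) * m)) *\<^sub>R average K F"
    using q by (simp add: power_add[symmetric] distrib_left[symmetric])
  finally show ?thesis .
qed

text \<open>For \<open>q < m\<close> and a cube K of level k, this is the constant value of the Haar
  projection of order q at K on a descendant \<open>J\<close> of level k + m.\<close>

definition incr :: "int \<Rightarrow> nat \<Rightarrow> (real ^ 'd \<Rightarrow> 'e::banach) \<Rightarrow> (real ^ 'd) set \<Rightarrow> 'e" where
  "incr k q F J = average (cb (k + int q + 1) (point J)) F - average (cb (k + int q) (point J)) F"

lemma haar_proj_level_incr:
  assumes K: "K \<in> G k" and q: "q < m" and J: "J \<in> desc m k K" and \<xi>: "\<xi> \<in> J"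
  shows "haar_proj_level (\<Union>k. G k) q K F \<xi> = incr k q F J"
proof -
  have "J \<in> G (k + int m)" "\<xi> \<in> K" using J \<xi> by (auto simp: desc_def)
  then show ?thesis unfolding haar_proj_level_eq[OF K] incr_def
    using cb_point[of J "k + int m" \<xi>] \<xi> q by simp
qed

text \<open>Averages over intermediate cubes have the same total at every level, so their
  differences sum to 0. This yields the martingale property of a block.\<close>

lemma sum_incr:
  assumes K: "K \<in> G k" and F: "strongly_integrable lebesgue (\<lambda>x. indicator K x *\<^sub>R F x)" and q: "q < m"
  shows "(\<Sum>J\<in>desc m k K. incr k q F J) = 0"
  using sum_average_cb[OF K F, of q m] sum_average_cb[OF K F, of "Suc q" m] q
  by (simp add: incr_def sum_subtractf add.assoc add.commute[of 1])

lemma strongly_integrable_subset: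
  assumes F: "strongly_integrable lebesgue (\<lambda>x. indicator K x *\<^sub>R F x)" and J: "J \<in> G k" "J \<subseteq> K"
  shows "strongly_integrable lebesgue (\<lambda>x. indicator J x *\<^sub>R F x)"
proof -
  have "(\<lambda>x. indicator J x *\<^sub>R indicator K x *\<^sub>R F x) = (\<lambda>x. indicat_real J x *\<^sub>R F x)"
    using J by (auto simp: indicator_def fun_eq_iff)
  then show ?thesis using strongly_integrable_set[OF F cube_sets[OF J(1)]] by simp
qed

text \<open>Letters whose cubes share an ancestor at level k + q form the cells of a partition into
  cells of equal size, and the cell average of the bottom values is the average over that ancestor.
  Subtracting \<open>c\<close> commutes with averaging.\<close>

lemma sign_dominated_cb_average:
  fixes F :: "real ^ 'd \<Rightarrow> 'e::banach"
  assumes K: "K \<in> G k" and F: "strongly_integrable lebesgue (\<lambda>x. indicator K x *\<^sub>R F x)" and q: "q \<le> m" and p: "1 \<le> p"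
  shows "sign_dominated p {..<(2::nat) ^ (CARD('d) * m)} (\<lambda>y. average (cb (k + int q) (point (label m k K y))) F - c)
    (\<lambda>y. average (label m k K y) F - c)"
proof -
  let ?C = "{..<(2::nat) ^ (CARD('d) * m)} :: nat set" and ?s = "2 ^ (CARD('d) * (m - q)) :: nat"
  let ?I = "\<lambda>y. cb (k + int q) (point (label m k K y))"
  define B where "B y = {z \<in> ?C. ?I z = ?I y}" for y
  have I: "?I y \<in> desc q k K" if "y \<in> ?C" for y
  proof -
    have "label m k K y \<in> desc m k K" using label_in[OF K] that by simp
    then have "point (label m k K y) \<in> K" using point_in[of "label m k K y" "k + int m"] by (auto simp: desc_def)
    then show ?thesis using desc_iff[OF K] by blast
  qed
  have bij: "bij_betw (label m k K) (B y) (desc (m - q) (k + int q) (?I y))" if y: "y \<in> ?C" for y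
  proof -
    have "label m k K ` B y = {J \<in> desc m k K. cb (k + int q) (point J) = ?I y}"
      unfolding B_def bij_betw_imp_surj_on[OF bij_label[OF K, of m], symmetric] by blast
    moreover have "inj_on (label m k K) (B y)"
      using bij_betw_imp_inj_on[OF bij_label[OF K, of m]] by (rule inj_on_subset) (auto simp: B_def)
    ultimately show ?thesis unfolding desc_subset_eq[OF K I[OF y] q] by (simp add: bij_betw_def)
  qed
  have card_B: "card (B y) = ?s" if y: "y \<in> ?C" for y
    using bij_betw_same_card[OF bij[OF y]] I[OF y] card_desc[of "?I y" "k + int q" "m - q"] by (auto simp: desc_def)
  have dom: "sign_dominated p ?C (\<lambda>y. (1 / ?s) *\<^sub>R (\<Sum>z\<in>B y. average (label m k K z) F - c)) (\<lambda>y. average (label m k K y) F - c)"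
  proof (rule sign_dominated_average[OF p])
    show "card (B y) = ?s" if "y \<in> ?C" for y by (rule card_B[OF that])
  qed (auto simp: B_def)
  have eq: "(1 / ?s) *\<^sub>R (\<Sum>z\<in>B y. average (label m k K z) F - c) = average (?I y) F - c" if y: "y \<in> ?C" for y
  proof -
    have Ik: "?I y \<in> G (k + int q)" "?I y \<subseteq> K" using I[OF y] by (auto simp: desc_def)
    have "(\<Sum>z\<in>B y. average (label m k K z) F) = (\<Sum>J\<in>desc (m - q) (k + int q) (?I y). average J F)"
      by (rule sum.reindex_bij_betw[OF bij[OF y]])
    also have "\<dots> = real ?s *\<^sub>R average (?I y) F"
      using average_desc[OF Ik(1) strongly_integrable_subset[OF F Ik], of "m - q"] by simp
    finally show ?thesis
      by (simp add: sum_subtractf card_B[OF y] sum_constant_scaleR scaleR_diff_right)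
  qed
  have "sign_dominated p ?C (\<lambda>y. (1 / ?s) *\<^sub>R (\<Sum>z\<in>B y. average (label m k K z) F - c)) (\<lambda>y. average (label m k K y) F - c)
    \<longleftrightarrow> sign_dominated p ?C (\<lambda>y. average (?I y) F - c) (\<lambda>y. average (label m k K y) F - c)"
    unfolding sign_dominated_def using eq by (intro iff_allI arg_cong2[where f = "(\<le>)"] sum.cong refl) simp
  with dom show ?thesis by simp
qed

text \<open>The levels k + q + 1 and k + q are treated with the same constant, the average over K,
  which cancels in the difference. The 1 / 2 here is the source of one of the two factors 2 in the
  final constant.\<close>

lemma sign_dominated_incr:
  fixes F :: "real ^ 'd \<Rightarrow> 'e::banach"
  assumes K: "K \<in> G k" and F: "strongly_integrable lebesgue (\<lambda>x. indicator K x *\<^sub>R F x)" and q: "q < m" and p: "1 \<le> p"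
  shows "sign_dominated p {..<(2::nat) ^ (CARD('d) * m)} (\<lambda>y. (1 / 2) *\<^sub>R incr k q F (label m k K y))
    (\<lambda>y. average (label m k K y) F - average K F)"
  using sign_dominated_half_diff[OF p sign_dominated_cb_average[OF K F _ p, of "Suc q" m "average K F"]
      sign_dominated_cb_average[OF K F _ p, of q m "average K F"]] q
  by (simp add: incr_def add.assoc add.commute[of 1])

end

section \<open>The shift on a single cube\<close>

text \<open>One simple approximant at L^1 distance below 1 already bounds the L^1 norm.\<close>

lemma has_strong_integral_integrable:
  assumes "has_strong_integral M f v"
  shows "strongly_integrable M f"
proof -
  obtain s where s: "\<And>n. Bochner_Integration.simple_bochner_integrable M (s n)"
     "(\<lambda>n. \<integral>\<^sup>+x. norm (f x - s n x) \<partial>M) \<longlonglongrightarrow> 0" and f: "strongly_measurable M f"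
    using assms(1) unfolding has_strong_integral_def by blast
  have "\<forall>\<^sub>F n in sequentially. (\<integral>\<^sup>+x. norm (f x - s n x) \<partial>M) < 1"
    by (rule order_tendstoD(2)[OF s(2)]) simp
  then obtain n where n: "(\<integral>\<^sup>+x. norm (f x - s n x) \<partial>M) < 1" by (auto simp: eventually_sequentially)
  have sf: "simple_function M (s n)"
    using s(1)[of n] by (auto elim: Bochner_Integration.simple_bochner_integrable.cases)
  have ns: "Bochner_Integration.simple_bochner_integrable M (\<lambda>x. norm (s n x))"
    using Bochner_Integration.simple_bochner_integrable_compose2[of "\<lambda>x y. norm x", OF _ s(1) s(1)] by simp
  have "(\<integral>\<^sup>+x. norm (s n x) \<partial>M) < \<infinity>"
    by (subst Bochner_Integration.simple_bochner_integral_eq_nn_integral[OF ns, symmetric]) auto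
  moreover have "(\<integral>\<^sup>+x. norm (f x) \<partial>M) \<le> (\<integral>\<^sup>+x. norm (f x - s n x) \<partial>M) + (\<integral>\<^sup>+x. norm (s n x) \<partial>M)"
  proof (rule nn_integral_norm_add_le)
    show "norm (f x) \<le> norm (f x - s n x) + norm (s n x)" for x
      using norm_triangle_ineq[of "f x - s n x" "s n x"] by simp
  qed (intro strongly_measurable_diff strongly_measurable_simple f sf)+
  moreover have "(\<integral>\<^sup>+x. norm (f x - s n x) \<partial>M) < \<infinity>"
    by (rule less_trans[OF n]) simp
  ultimately have "(\<integral>\<^sup>+x. norm (f x) \<partial>M) < \<infinity>"
    by (metis ennreal_add_less_top infinity_ennreal_def le_less_trans)
  then show ?thesis using f by (simp add: strongly_integrable_def)
qed

text \<open>The case N = 1 of the \<open>R\<close>-bound: a single random sign does not change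
  norms.\<close>

lemma R_bound_norm:
  fixes T :: "'e::banach \<Rightarrow>\<^sub>L 'e"
  assumes R: "R_bound p \<T> R" and p: "0 < p" and T: "T \<in> \<T>"
  shows "norm (blinfun_apply T e) \<le> R * norm e"
proof (rule ccontr)
  have R0: "0 \<le> R" using R by (simp add: R_bound_def)
  have eq: "sign_sum p 1 (\<lambda>n. v) = 2 * norm v powr p" for v :: 'e
  proof -
    have "sign_sum p 1 (\<lambda>n. v) = (\<Sum>\<epsilon>\<in>signs 1. norm v powr p)"
      unfolding sign_sum_def
    proof (rule sum.cong[OF refl])
      fix \<epsilon> assume "\<epsilon> \<in> signs 1"
      from signs_nth[OF this, of 0] show "norm (\<Sum>n<1. \<epsilon> n *\<^sub>R v) powr p = norm v powr p" by auto
    qed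
    then show ?thesis by (simp add: card_signs)
  qed
  assume "\<not> norm (blinfun_apply T e) \<le> R * norm e"
  then have "(R * norm e) powr p < norm (blinfun_apply T e) powr p"
    using p R0 by (intro powr_less_mono2) auto
  moreover have "sign_sum p 1 (\<lambda>n. blinfun_apply T e) \<le> R powr p * sign_sum p 1 (\<lambda>n. e)"
    by (rule sign_sum_R_bound[OF R p]) (rule T)
  ultimately show False using R0 unfolding eq by (simp add: powr_mult)
qed

context dyadic_levels
begin

lemma haar_proj_level_sum:
  fixes f :: "real ^ 'd \<Rightarrow> 'e::banach"
  assumes K: "K \<in> G k" and i: "i < m"
  shows "haar_proj_level (\<Union>k. G k) i K f x = (\<Sum>J\<in>desc m k K. indicator J x *\<^sub>R incr k i f J)"
proof (cases "x \<in> K")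
  case True
  then have "cb (k + int m) x \<in> desc m k K" using desc_iff[OF K] by blast
  then show ?thesis unfolding sum_desc_indicator[OF K]
    using haar_proj_level_incr[OF K i _ mem_cb] True by simp
next
  case False
  then show ?thesis unfolding sum_desc_indicator[OF K] haar_proj_level_eq[OF K] by simp
qed

lemma in_kernel_values: "K \<in> G k \<Longrightarrow> x \<in> K \<Longrightarrow> x' \<in> K \<Longrightarrow> a K x x' \<in> kernel_values (\<Union>k. G k) a"
  unfolding kernel_values_def by blast

lemma averaging_op_eq_average:
  assumes "x \<in> K"
  shows "averaging_op a K h x = average K (\<lambda>x'. blinfun_apply (a K x x') (h x'))"
  using assms by (simp add: averaging_op_def average_def)

text \<open>The Haar projection of \<open>f\<close> takes finitely many values, so the integrand is
  a finite sum of kernels applied to fixed vectors, which is what measurability in the strong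
  operator topology controls. Boundedness comes from the \<open>R\<close>-bound with one
  operator.\<close>

lemma strongly_integrable_averaging_op:
  fixes a :: "(real ^ 'd) set \<Rightarrow> real ^ 'd \<Rightarrow> real ^ 'd \<Rightarrow> 'e::banach \<Rightarrow>\<^sub>L 'e"
  assumes K: "K \<in> G k" and ker: "strongly_measurable_kernel (a K)" and p: "0 < p"
    and R: "R_bound p (kernel_values (\<Union>k. G k) a) R"
  shows "strongly_integrable lebesgue (\<lambda>x. indicator K x *\<^sub>R averaging_op a K (haar_proj_level (\<Union>k. G k) i K f) x)"
proof -
  let ?h = "haar_proj_level (\<Union>k. G k) i K f" and ?D = "desc (Suc i) k K"
  define e where "e J = incr k i f J" for J
  have h: "?h x = (\<Sum>J\<in>?D. indicator J x *\<^sub>R e J)" for x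
    unfolding e_def by (rule haar_proj_level_sum[OF K]) simp
  define \<Phi> where "\<Phi> z = (\<Sum>J\<in>?D. indicator (UNIV \<times> J) z *\<^sub>R blinfun_apply (a K (fst z) (snd z)) (e J))" for z
  have \<Phi>_eq: "\<Phi> (x, x') = blinfun_apply (a K x x') (?h x')" for x x'
    unfolding \<Phi>_def h by (simp add: blinfun.sum_right blinfun.scaleR_right indicator_times)
  obtain b where b: "K = half_open_cube b (2 powi (- k))" using cube[OF K] by blast
  have Kb: "K \<in> sets borel" unfolding b by (rule half_open_cube_borel)
  have Kfin: "emeasure lborel K < \<infinity>" using emeasure_cube_finite[OF K] Kb by simp
  have sm: "strongly_measurable lebesgue \<Phi>"
    unfolding \<Phi>_def[abs_def]
  proof (intro strongly_measurable_sum strongly_measurable_set)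
    fix J assume J: "J \<in> ?D"
    then obtain c where c: "J = half_open_cube c (2 powi (- (k + int (Suc i))))" 
      using cube[of J "k + int (Suc i)"] by (auto simp: desc_def)
    have "UNIV \<times> J \<in> sets (borel :: ((real ^ 'd) \<times> (real ^ 'd)) measure)"
      by (rule borel_Times) (simp_all add: c half_open_cube_borel)
    then have "UNIV \<times> J \<in> sets (lborel :: ((real ^ 'd) \<times> (real ^ 'd)) measure)" by simp
    then show "UNIV \<times> J \<in> sets (lebesgue :: ((real ^ 'd) \<times> (real ^ 'd)) measure)" by (rule sets_completionI_sets)
    show "strongly_measurable lebesgue (\<lambda>z. blinfun_apply (a K (fst z) (snd z)) (e J))"
      using ker unfolding strongly_measurable_kernel_def by blast
  qed
  define C where "C = (\<Sum>J\<in>?D. R * norm (e J))"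
  have R0: "0 \<le> R" using R by (simp add: R_bound_def)
  have bound: "norm (\<Phi> (x, y)) \<le> C" if "x \<in> K" "y \<in> K" for x y
    unfolding \<Phi>_def C_def
    using R_bound_norm[OF R p in_kernel_values[of K k x y a, OF K that]] R0
    by (intro sum_norm_le) (auto simp: indicator_def)
  have C0: "0 \<le> C" unfolding C_def using R0 by (intro sum_nonneg) auto
  let ?I = "\<lambda>x. strong_integral lebesgue (\<lambda>y. indicator K y *\<^sub>R \<Phi> (x, y))"
  have "strongly_measurable lebesgue (\<lambda>x. indicator K x *\<^sub>R ?I x)"
    by (rule strongly_measurable_partial_integral[OF sm Kb Kfin bound])
  \<comment> \<open>Where a section has no integral the value is 0 by convention, so the bound holds
    at every x of K.\<close>
  moreover have "norm (?I x) \<le> C * measure lebesgue K" if x: "x \<in> K" for x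
  proof (cases "\<exists>v. has_strong_integral lebesgue (\<lambda>y. indicator K y *\<^sub>R \<Phi> (x, y)) v")
    case True
    then obtain v where v: "has_strong_integral lebesgue (\<lambda>y. indicat_real K y *\<^sub>R \<Phi> (x, y)) v" by blast
    have "ennreal (norm v) \<le> (\<integral>\<^sup>+y. norm (indicat_real K y *\<^sub>R \<Phi> (x, y)) \<partial>lebesgue)"
      by (rule has_strong_integral_norm_le[OF v])
    also have "\<dots> \<le> (\<integral>\<^sup>+y. ennreal C * indicator K y \<partial>lebesgue)"
      using bound[OF x] by (intro nn_integral_mono) (auto simp: indicator_def intro!: ennreal_leI)
    also have "\<dots> = ennreal (C * measure lebesgue K)"
      using cube_sets[OF K] emeasure_cube[OF K] measure_cube[OF K] C0
      by (simp add: nn_integral_cmult_indicator ennreal_mult vol_pos less_imp_le)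
    finally show ?thesis using strong_integral_eqI[OF v] C0 by (simp add: ennreal_le_iff)
  qed (use C0 in \<open>simp add: strong_integral_def\<close>)
  ultimately have "strongly_integrable lebesgue (\<lambda>x. indicator K x *\<^sub>R ?I x)"
    by (intro strongly_integrable_bounded[OF _ cube_sets[OF K] emeasure_cube_finite[OF K]]) auto
  from strongly_integrable_linear(1)[OF this this, of "1 / measure lebesgue K" 0]
  moreover have "(1 / measure lebesgue K) *\<^sub>R indicat_real K x *\<^sub>R ?I x + 0 *\<^sub>R indicat_real K x *\<^sub>R ?I x
      = indicator K x *\<^sub>R averaging_op a K ?h x" for x
    by (cases "x \<in> K") (simp_all add: averaging_op_def set_strong_integral_def \<Phi>_eq)
  ultimately show ?thesis by simp
qed

text \<open>The Haar projection is constant on each descendant m levels down, so the average over K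
  splits into averages over these cubes, each of kernel operators applied to one fixed vector. Such
  averages stay in the closed symmetric convex hull.\<close>

lemma averaging_op_mean:
  fixes a :: "(real ^ 'd) set \<Rightarrow> real ^ 'd \<Rightarrow> real ^ 'd \<Rightarrow> 'e::banach \<Rightarrow>\<^sub>L 'e"
  assumes K: "K \<in> G k" and i: "i < m" and x: "x \<in> K"
  obtains c where "averaging_op a K (haar_proj_level (\<Union>k. G k) i K f) x
      = (1 / 2 ^ (CARD('d) * m)) *\<^sub>R (\<Sum>y<(2::nat) ^ (CARD('d) * m). c y)"
    "\<And>y. y < 2 ^ (CARD('d) * m) \<Longrightarrow> c y \<in> sym_hull {blinfun_apply (a K x x') (incr k i f (label m k K y)) | x'. x' \<in> K}"
proof -
  let ?h = "haar_proj_level (\<Union>k. G k) i K f" and ?M = "2 ^ (CARD('d) * m) :: nat"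
  define F where "F x' = blinfun_apply (a K x x') (?h x')" for x'
  let ?S = "\<lambda>y. {blinfun_apply (a K x x') (incr k i f (label m k K y)) | x'. x' \<in> K}"
  have ne: "?S y \<noteq> {}" for y using x by blast
  show thesis
  proof (cases "\<exists>v. has_strong_integral lebesgue (\<lambda>x'. indicator K x' *\<^sub>R F x') v")
    case True
    then have int: "strongly_integrable lebesgue (\<lambda>x'. indicator K x' *\<^sub>R F x')"
      using has_strong_integral_integrable by blast
    show thesis
    proof (rule that[of "\<lambda>y. average (label m k K y) F"])
      show "averaging_op a K ?h x = (1 / 2 ^ (CARD('d) * m)) *\<^sub>R (\<Sum>y<?M. average (label m k K y) F)"
        unfolding averaging_op_eq_average[OF x] F_def[symmetric]
        using average_desc[OF K int, of m] sum_label[OF K, where \<Phi> = "\<lambda>J. average J F" and m = m] by simp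
      fix y assume y: "y < ?M"
      have J: "label m k K y \<in> desc m k K" using label_in[OF K y] .
      then have J': "label m k K y \<in> G (k + int m)" "label m k K y \<subseteq> K" by (auto simp: desc_def)
      show "average (label m k K y) F \<in> sym_hull (?S y)"
      proof (rule average_in_sym_hull[OF cube_sets[OF J'(1)] measure_cube_pos[OF J'(1)] emeasure_cube_finite[OF J'(1)] ne])
        fix x' assume x': "x' \<in> label m k K y"
        have "F x' = blinfun_apply (a K x x') (incr k i f (label m k K y))"
          by (simp only: F_def haar_proj_level_incr[OF K i J x'])
        moreover have "x' \<in> K" using x' J'(2) by (rule subsetD[rotated])
        ultimately have "F x' \<in> ?S y" unfolding mem_Collect_eq by (intro exI conjI)
        then show "F x' \<in> sym_hull (?S y)" by (rule subsetD[OF subset_sym_hull])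
      qed
    qed
  next
    \<comment> \<open>A divergent integral counts as 0, which is the mean of zeros, and 0 lies in
      each of the hulls.\<close>
    case False
    show thesis
    proof (rule that[of "\<lambda>y. 0"])
      show "averaging_op a K ?h x = (1 / 2 ^ (CARD('d) * m)) *\<^sub>R (\<Sum>y<?M. 0)"
        unfolding averaging_op_eq_average[OF x]
        using False by (simp add: average_def set_strong_integral_def strong_integral_def F_def[symmetric])
    qed (rule zero_in_sym_hull[OF ne])
  qed
qed

text \<open>Each \<open>v n\<close> is a uniform mean over the alphabet, hence dominated in the
  sense of \<open>sign_dominated\<close> by the letterwise vectors. These lie in hulls of kernel
  operators applied to the increments of \<open>f\<close>, so \<open>sign_sum_sym_hull\<close>
  reduces the claim to the \<open>R\<close>-bound itself.\<close>

lemma sign_sum_averaging_op: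
  fixes a :: "(real ^ 'd) set \<Rightarrow> real ^ 'd \<Rightarrow> real ^ 'd \<Rightarrow> 'e::banach \<Rightarrow>\<^sub>L 'e"
  assumes K: "\<And>n. n < N \<Longrightarrow> K n \<in> G (k n)" and i: "i < m" and p: "1 \<le> p"
    and R: "R_bound p (kernel_values (\<Union>k. G k) a) R"
    and v: "\<And>n. n < N \<Longrightarrow> v n \<in> averaging_op a (K n) (haar_proj_level (\<Union>k. G k) i (K n) f) ` K n"
  shows "real (card (words N {..<(2::nat) ^ (CARD('d) * m)})) * sign_sum p N v
    \<le> R powr p * (\<Sum>y\<in>words N {..<(2::nat) ^ (CARD('d) * m)}. sign_sum p N (\<lambda>n. incr (k n) i f (label m (k n) (K n) (y n))))"
proof -
  let ?M = "2 ^ (CARD('d) * m) :: nat" let ?W = "words N {..<?M}"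
  let ?e = "\<lambda>n y. incr (k n) i f (label m (k n) (K n) y)"
  have p0: "0 < p" using p by simp
  define S where "S n x y = {blinfun_apply (a (K n) x x') (?e n y) | x'. x' \<in> K n}" for n x y
  have "\<exists>x c. x \<in> K n \<and> v n = (1 / ?M) *\<^sub>R (\<Sum>y<?M. c y) \<and> (\<forall>y<?M. c y \<in> sym_hull (S n x y))"
    if n: "n < N" for n
  proof -
    obtain x where x: "x \<in> K n" "v n = averaging_op a (K n) (haar_proj_level (\<Union>k. G k) i (K n) f) x"
      using v[OF n] by blast
    obtain c where "averaging_op a (K n) (haar_proj_level (\<Union>k. G k) i (K n) f) x
      = (1 / 2 ^ (CARD('d) * m)) *\<^sub>R (\<Sum>y<(2::nat) ^ (CARD('d) * m). c y)"
      "\<And>y. y < 2 ^ (CARD('d) * m) \<Longrightarrow> c y \<in> sym_hull {blinfun_apply (a (K n) x x') (?e n y) | x'. x' \<in> K n}"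
      by (rule averaging_op_mean[OF K[OF n] i x(1), where f = f and a = a], rule that)
    then show ?thesis using x by (intro exI[of _ x] exI[of _ c]) (simp add: S_def)
  qed
  then have "\<forall>n. \<exists>xc. n < N \<longrightarrow> fst xc \<in> K n \<and> v n = (1 / ?M) *\<^sub>R (\<Sum>y<?M. snd xc y)
      \<and> (\<forall>y<?M. snd xc y \<in> sym_hull (S n (fst xc) y))"
    by simp
  then obtain xc where xc: "\<And>n. n < N \<Longrightarrow> fst (xc n) \<in> K n \<and> v n = (1 / ?M) *\<^sub>R (\<Sum>y<?M. snd (xc n) y)
      \<and> (\<forall>y<?M. snd (xc n) y \<in> sym_hull (S n (fst (xc n)) y))"
    by metis
  define x c where "x n = fst (xc n)" and "c n = snd (xc n)" for n
  have x: "x n \<in> K n" and mean: "v n = (1 / ?M) *\<^sub>R (\<Sum>y<?M. c n y)"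
    and c: "\<And>y. y < ?M \<Longrightarrow> c n y \<in> sym_hull (S n (x n) y)" if "n < N" for n
    using xc[OF that] by (simp_all add: x_def c_def)
  \<comment> \<open>Here the partition has a single cell, the whole alphabet.\<close>
  have "sign_dominated p {..<?M} (\<lambda>y. v n) (c n)" if n: "n < N" for n
    unfolding mean[OF n] by (rule sign_dominated_average[OF p]) auto
  moreover have ne: "{..<?M} \<noteq> {}" 
  proof -
    have "0 \<in> {..<?M}" by simp
    then show ?thesis by blast
  qed
  ultimately have "(\<Sum>y\<in>?W. sign_sum p N (\<lambda>n. v n)) \<le> (\<Sum>y\<in>?W. sign_sum p N (\<lambda>n. c n (y n)))"
    by (intro sign_sum_dominated[OF _ ne]) auto
  also have "\<dots> \<le> (\<Sum>y\<in>?W. R powr p * sign_sum p N (\<lambda>n. ?e n (y n)))"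
  proof (rule sum_mono)
    fix y assume y: "y \<in> ?W"
    show "sign_sum p N (\<lambda>n. c n (y n)) \<le> R powr p * sign_sum p N (\<lambda>n. ?e n (y n))"
    proof (rule sign_sum_sym_hull[OF p])
      fix w assume w: "\<And>n. n < N \<Longrightarrow> w n \<in> S n (x n) (y n)"
      then have "\<forall>n. \<exists>x'. n < N \<longrightarrow> x' \<in> K n \<and> w n = blinfun_apply (a (K n) (x n) x') (?e n (y n))"
        unfolding S_def by blast
      then obtain x' where x': "\<And>n. n < N \<Longrightarrow> x' n \<in> K n" "\<And>n. n < N \<Longrightarrow> w n = blinfun_apply (a (K n) (x n) (x' n)) (?e n (y n))"
        by metis
      have "sign_sum p N w = sign_sum p N (\<lambda>n. blinfun_apply (a (K n) (x n) (x' n)) (?e n (y n)))"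
        unfolding sign_sum_def using x'(2) by (intro sum.cong refl arg_cong[where f = "\<lambda>u. norm u powr p"]) auto
      also have "\<dots> \<le> R powr p * sign_sum p N (\<lambda>n. ?e n (y n))"
        by (rule sign_sum_R_bound[OF R p0]) (rule in_kernel_values[OF K x x'(1)])
      finally show "sign_sum p N w \<le> R powr p * sign_sum p N (\<lambda>n. ?e n (y n))" .
    next
      fix n assume n: "n < N"
      then show "c n (y n) \<in> sym_hull (S n (x n) (y n))"
        using c[OF n, of "y n"] words_nth[OF y n] by simp
    qed
  qed
  finally show ?thesis by (simp add: sum_distrib_left)
qed

end

lemma sum_nn_integral_disjoint_le:
  fixes f :: "'a \<Rightarrow> 'e::real_normed_vector"
  assumes f: "strongly_measurable M f" and I: "finite I" "\<And>i. i \<in> I \<Longrightarrow> J i \<in> sets M" "disjoint_family_on J I"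
    and Q: "\<And>i. i \<in> I \<Longrightarrow> J i \<subseteq> Q"
  shows "(\<Sum>i\<in>I. \<integral>\<^sup>+x. indicator (J i) x * ennreal (norm (f x) powr p) \<partial>M)
    \<le> (\<integral>\<^sup>+x. indicator Q x * ennreal (norm (f x) powr p) \<partial>M)"
proof -
  obtain h where h [measurable]: "h \<in> borel_measurable M" and h': "AE x in M. h x = norm (f x)"
    using strongly_measurable_norm[OF f] by metis
  have "(\<Sum>i\<in>I. \<integral>\<^sup>+x. indicator (J i) x * ennreal (norm (f x) powr p) \<partial>M)
     = (\<Sum>i\<in>I. \<integral>\<^sup>+x. indicator (J i) x * ennreal (h x powr p) \<partial>M)"
    using h' by (intro sum.cong refl nn_integral_cong_AE) auto
  also have "\<dots> = (\<integral>\<^sup>+x. (\<Sum>i\<in>I. indicator (J i) x * ennreal (h x powr p)) \<partial>M)"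
    using I(2) by (intro nn_integral_sum[symmetric]) auto
  also have "\<dots> \<le> (\<integral>\<^sup>+x. indicator Q x * ennreal (norm (f x) powr p) \<partial>M)"
  proof (rule nn_integral_mono_AE)
    show "AE x in M. (\<Sum>i\<in>I. indicator (J i) x * ennreal (h x powr p)) \<le> indicator Q x * ennreal (norm (f x) powr p)"
      using h'
    proof eventually_elim
      case (elim x)
      have "(\<Sum>i\<in>I. indicator (J i) x) = (indicator (\<Union>i\<in>I. J i) x :: ennreal)"
        by (rule indicator_UN_disjoint[OF I(1,3), symmetric])
      also have "\<dots> \<le> indicator Q x" using Q by (auto simp: indicator_def)
      finally show ?case using elim by (simp add: sum_distrib_right[symmetric] mult_right_mono)
    qed
  qed
  finally show ?thesis .
qed

section \<open>Bounds within one residue class\<close>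

context dyadic_levels
begin

definition shift_term :: "((real ^ 'd) set \<Rightarrow> real ^ 'd \<Rightarrow> real ^ 'd \<Rightarrow> 'e::banach \<Rightarrow>\<^sub>L 'e) \<Rightarrow> nat \<Rightarrow> nat \<Rightarrow>
    (real ^ 'd \<Rightarrow> 'e) \<Rightarrow> (real ^ 'd) set \<Rightarrow> real ^ 'd \<Rightarrow> 'e" where
  "shift_term a i j f K = haar_proj_level (\<Union>k. G k) j K (averaging_op a K (haar_proj_level (\<Union>k. G k) i K f))"

context
  fixes p \<beta> R :: real and a :: "(real ^ 'd) set \<Rightarrow> real ^ 'd \<Rightarrow> real ^ 'd \<Rightarrow> 'e::banach \<Rightarrow>\<^sub>L 'e"
    and i j m :: nat and f :: "real ^ 'd \<Rightarrow> 'e"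
  assumes umd: "UMD_bound TYPE('e) p \<beta>" and p: "1 \<le> p"
    and ker: "\<And>k K. K \<in> G k \<Longrightarrow> strongly_measurable_kernel (a K)"
    and R: "R_bound p (kernel_values (\<Union>k. G k) a) R"
    and i: "i < m" and j: "j < m" and f: "in_Lp lebesgue p f"
begin

lemma integrable_on_cube: "K \<in> G k \<Longrightarrow> strongly_integrable lebesgue (\<lambda>x. indicator K x *\<^sub>R f x)"
  by (rule in_Lp_strongly_integrable_set[OF f p cube_sets emeasure_cube_finite])

text \<open>The value that the shift term of the n-th cube of the chain takes on the descendant
  chosen by \<open>y\<close>. Membership of that cube in \<open>F\<close> depends only on letters
  before n, so discarding cubes outside \<open>F\<close> preserves the martingale structure.\<close>

definition block :: "int \<Rightarrow> (real ^ 'd) set \<Rightarrow> (real ^ 'd) set set \<Rightarrow> nat \<Rightarrow> (nat \<Rightarrow> nat) \<Rightarrow> nat \<Rightarrow> 'e" where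
  "block k Q F n x y = (let K = path m k Q n x in if K \<in> F
     then incr (k + int (n * m)) j (averaging_op a K (haar_proj_level (\<Union>k. G k) i K f)) (label m (k + int (n * m)) K y) else 0)"

text \<open>Origin of the 4: half a block is half a difference of averages of the function produced
  by \<open>averaging_op\<close>, so it lies in the symmetric hull of its values on the cube; this
  gives one factor 2. \<open>sign_sum_averaging_op\<close> then contributes R, and
  \<open>sign_dominated_incr\<close> the other factor 2.\<close>

lemma sign_sum_block:
  fixes k :: int and N :: nat
  assumes Q: "Q \<in> G k" and x: "x \<in> words N {..<(2::nat) ^ (CARD('d) * m)}" and z: "z \<in> words N {..<(2::nat) ^ (CARD('d) * m)}"
  shows "real (card (words N {..<(2::nat) ^ (CARD('d) * m)})) * sign_sum p N (\<lambda>n. block k Q F n x (z n))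
    \<le> (4 * R) powr p * (\<Sum>y\<in>words N {..<(2::nat) ^ (CARD('d) * m)}. sign_sum p N
      (\<lambda>n. average (label m (k + int (n * m)) (path m k Q n x) (y n)) f - average (path m k Q n x) f))"
proof -
  let ?C = "{..<(2::nat) ^ (CARD('d) * m)}" let ?W = "words N ?C"
  define K l where "K n = path m k Q n x" and "l n = k + int (n * m)" for n
  have K: "K n \<in> G (l n)" if "n < N" for n
    using path_in[OF Q x, of n] that by (simp add: K_def l_def)
  let ?A = "\<lambda>n. averaging_op a (K n) (haar_proj_level (\<Union>k. G k) i (K n) f)"
  let ?h = "\<lambda>n y. incr (l n) i f (label m (l n) (K n) y)"
  let ?f = "\<lambda>n y. average (label m (l n) (K n) y) f - average (K n) f"
  define w where "w = real (card ?W)"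
  have C: "finite ?C" "?C \<noteq> {}"
  proof -
    have "0 \<in> ?C" by simp
    then show "?C \<noteq> {}" by blast
  qed simp
  have w: "0 < w" using C by (simp add: w_def card_gt_0_iff finite_words words_nonempty)
  have R0: "0 \<le> R" using R by (simp add: R_bound_def)
  define B where "B = R powr p * (\<Sum>y\<in>?W. sign_sum p N (\<lambda>n. ?h n (y n)))"
  have "sign_sum p N (\<lambda>n. (1 / 2) *\<^sub>R block k Q F n x (z n)) \<le> B / w"
  proof (rule sign_sum_sym_hull[OF p])
    fix v assume "\<And>n. n < N \<Longrightarrow> v n \<in> ?A n ` K n"
    then have "w * sign_sum p N v \<le> B"
      unfolding w_def B_def by (intro sign_sum_averaging_op[OF K i p R])
    then show "sign_sum p N v \<le> B / w" using w by (simp add: pos_le_divide_eq mult.commute)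
  next
    fix n assume n: "n < N"
    have ne: "?A n ` K n \<noteq> {}" using cube_nonempty[OF K[OF n]] by simp
    show "(1 / 2) *\<^sub>R block k Q F n x (z n) \<in> sym_hull (?A n ` K n)"
    proof (cases "K n \<in> F")
      case False
      then show ?thesis using zero_in_sym_hull[OF ne] by (simp add: block_def K_def)
    next
      case True
      have J: "label m (l n) (K n) (z n) \<in> desc m (l n) (K n)"
        using label_in[OF K[OF n], of "z n" m] words_nth[OF z n] by simp
      define \<xi> where "\<xi> = point (label m (l n) (K n) (z n))"
      have \<xi>: "\<xi> \<in> K n" using J point_in[of "label m (l n) (K n) (z n)" "l n + int m"] by (auto simp: \<xi>_def desc_def)
      have avg: "average (cb (l n + int q) \<xi>) (?A n) \<in> sym_hull (?A n ` K n)" for q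
      proof (rule average_in_sym_hull[OF cube_sets measure_cube_pos emeasure_cube_finite ne])
        fix u assume "u \<in> cb (l n + int q) \<xi>"
        then have "u \<in> K n" using subset_cb[OF K[OF n] \<xi>, of "l n + int q"] by auto
        then show "?A n u \<in> sym_hull (?A n ` K n)" by (intro subsetD[OF subset_sym_hull] imageI)
      qed (rule cb_in)+
      have "block k Q F n x (z n) = average (cb (l n + int (Suc j)) \<xi>) (?A n) - average (cb (l n + int j) \<xi>) (?A n)"
        using True unfolding block_def Let_def K_def[symmetric] l_def[symmetric] incr_def \<xi>_def
        by (simp add: add.assoc add.commute[of 1])
      then show ?thesis using sym_hull_half_diff[OF avg avg, of "Suc j" j] by (simp only:)
    qed
  qed
  then have "w * sign_sum p N (\<lambda>n. (1 / 2) *\<^sub>R block k Q F n x (z n)) \<le> B"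
    using w by (simp add: pos_le_divide_eq mult.commute)
  then have "2 powr p * (w * sign_sum p N (\<lambda>n. (1 / 2) *\<^sub>R block k Q F n x (z n))) \<le> 2 powr p * B"
    by (rule mult_left_mono) simp
  moreover have half: "2 powr p * (w' * ((1 / 2) powr p * S)) = w' * S" for w' S :: real
  proof -
    have "2 powr p * (w' * ((1 / 2) powr p * S)) = (2 powr p * (1 / 2) powr p) * (w' * S)" by (simp only: mult_ac)
    also have "2 powr p * (1 / 2) powr p = (1::real)" by (simp add: powr_mult[symmetric])
    finally show ?thesis by simp
  qed
  moreover have "\<bar>1 / 2 :: real\<bar> = 1 / 2" by simp
  ultimately have 1: "w * sign_sum p N (\<lambda>n. block k Q F n x (z n)) \<le> 2 powr p * B"
    by (simp only: sign_sum_scaleR half)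
  \<comment> \<open>Half of the inner projection, of order i, is dominated by the difference of the
    averages of \<open>f\<close> across m levels.\<close>
  have "(\<Sum>y\<in>?W. sign_sum p N (\<lambda>n. (1 / 2) *\<^sub>R ?h n (y n))) \<le> (\<Sum>y\<in>?W. sign_sum p N (\<lambda>n. ?f n (y n)))"
    by (rule sign_sum_dominated[OF C]) (rule sign_dominated_incr[OF K integrable_on_cube[OF K] i p])
  then have "2 powr p * (\<Sum>y\<in>?W. sign_sum p N (\<lambda>n. (1 / 2) *\<^sub>R ?h n (y n))) \<le> 2 powr p * (\<Sum>y\<in>?W. sign_sum p N (\<lambda>n. ?f n (y n)))"
    by (rule mult_left_mono) simp
  then have 2: "(\<Sum>y\<in>?W. sign_sum p N (\<lambda>n. ?h n (y n))) \<le> 2 powr p * (\<Sum>y\<in>?W. sign_sum p N (\<lambda>n. ?f n (y n)))"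
    using half[of 1, unfolded mult_1] \<open>\<bar>1 / 2 :: real\<bar> = 1 / 2\<close>
    by (simp only: sign_sum_scaleR sum_distrib_left[symmetric])
  have "2 powr p * B \<le> 2 powr p * (R powr p * (2 powr p * (\<Sum>y\<in>?W. sign_sum p N (\<lambda>n. ?f n (y n)))))"
    unfolding B_def by (intro mult_left_mono 2) auto
  also have "\<dots> = (4 * R) powr p * (\<Sum>y\<in>?W. sign_sum p N (\<lambda>n. ?f n (y n)))"
  proof -
    have "(4 * R) powr p = (2 * 2 * R) powr p" by simp
    also have "\<dots> = 2 powr p * 2 powr p * R powr p" using R0 by (simp only: powr_mult)
    finally show ?thesis by (simp only: mult_ac)
  qed
  finally show ?thesis using 1 unfolding w_def K_def l_def by linarith
qed

text \<open>On the side of \<open>f\<close> the differences along the chain telescope: with the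
  average over Q supplied as the constant of \<open>decoupled_comparison\<close>, they add up to the
  average over the last cube.\<close>

lemma class_bound_words:
  fixes k :: int and N :: nat
  assumes Q: "Q \<in> G k"
  shows "(\<Sum>x\<in>words N {..<(2::nat) ^ (CARD('d) * m)}. norm (\<Sum>n<N. block k Q F n x (x n)) powr p)
    \<le> (4 * R * \<beta>\<^sup>2) powr p * (\<Sum>x\<in>words N {..<(2::nat) ^ (CARD('d) * m)}. norm (average (path m k Q N x) f) powr p)"
proof -
  let ?C = "{..<(2::nat) ^ (CARD('d) * m)}" let ?W = "words N ?C"
  let ?f = "\<lambda>n x y. average (label m (k + int (n * m)) (path m k Q n x) y) f - average (path m k Q n x) f"
  have C: "finite ?C" "?C \<noteq> {}"
  proof -
    have "0 \<in> ?C" by simp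
    then show "?C \<noteq> {}" by blast
  qed simp
  have R0: "0 \<le> 4 * R" using R by (simp add: R_bound_def)
  have K: "path m k Q n x \<in> G (k + int (n * m))" if "n < N" "x \<in> ?W" for n x
    using path_in[OF Q that(2), of n] that(1) by simp
  have "(\<Sum>x\<in>?W. norm (\<Sum>n<N. block k Q F n x (x n)) powr p)
    \<le> (4 * R * \<beta>\<^sup>2) powr p * (\<Sum>x\<in>?W. norm (average Q f + (\<Sum>n<N. ?f n x (x n))) powr p)"
  proof (rule decoupled_comparison[OF umd p C R0])
    fix n :: nat and x x' :: "nat \<Rightarrow> nat" and y assume "\<And>i. i < n \<Longrightarrow> x i = x' i"
    then have "path m k Q n x = path m k Q n x'" by (rule path_cong)
    then show "block k Q F n x y = block k Q F n x' y" "?f n x y = ?f n x' y"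
      by (simp_all only: block_def)
  next
    show "(\<Sum>y\<in>?C. block k Q F n x y) = 0" if "n < N" "x \<in> ?W" for n x
    proof (cases "path m k Q n x \<in> F")
      case True
      let ?A = "averaging_op a (path m k Q n x) (haar_proj_level (\<Union>k. G k) i (path m k Q n x) f)"
      have "(\<Sum>y\<in>?C. block k Q F n x y) = (\<Sum>J\<in>desc m (k + int (n * m)) (path m k Q n x). incr (k + int (n * m)) j ?A J)"
        using True sum_label[OF K[OF that], where m = m and \<Phi> = "incr (k + int (n * m)) j ?A"] by (simp add: block_def Let_def)
      also have "\<dots> = 0"
        by (rule sum_incr[OF K[OF that] strongly_integrable_averaging_op[OF K[OF that] ker[OF K[OF that]] _ R] j]) (use p in simp)
      finally show ?thesis .
    qed (simp add: block_def Let_def)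
    show "(\<Sum>y\<in>?C. ?f n x y) = 0" if "n < N" "x \<in> ?W" for n x
      using sum_label[OF K[OF that], where m = m and \<Phi> = "\<lambda>J. average J f"]
        average_desc[OF K[OF that] integrable_on_cube[OF K[OF that]], of m]
      by (simp add: sum_subtractf sum_constant_scaleR)
    show "real (card ?W) * sign_sum p N (\<lambda>n. block k Q F n x (z n))
      \<le> (4 * R) powr p * (\<Sum>y\<in>?W. sign_sum p N (\<lambda>n. ?f n x (y n)))" if "x \<in> ?W" "z \<in> ?W" for x z
      by (rule sign_sum_block[OF Q that])
  qed
  also have "(\<lambda>x. average Q f + (\<Sum>n<N. ?f n x (x n))) = (\<lambda>x. average (path m k Q N x) f)"
  proof
    fix x
    have "(\<Sum>n<N. ?f n x (x n)) = (\<Sum>n<N. average (path m k Q (Suc n) x) f - average (path m k Q n x) f)" by simp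
    also have "\<dots> = average (path m k Q N x) f - average Q f"
      by (subst sum_lessThan_telescope) simp
    finally show "average Q f + (\<Sum>n<N. ?f n x (x n)) = average (path m k Q N x) f" by simp
  qed
  finally show ?thesis .
qed

text \<open>At a given point only cubes containing it contribute, and those of the right levels are
  cubes of its own chain, at most one for each n.\<close>

lemma sum_shift_terms:
  fixes k :: int and N :: nat
  assumes Q: "Q \<in> G k" and x: "x \<in> words N {..<(2::nat) ^ (CARD('d) * m)}" and F: "finite F" "\<And>K. K \<in> F \<Longrightarrow> \<exists>n<N. K \<in> G (k + int (n * m))"
    and \<xi>: "\<xi> \<in> path m k Q N x"
  shows "(\<Sum>K\<in>F. shift_term a i j f K \<xi>) = (\<Sum>n<N. block k Q F n x (x n))"
proof -
  have m: "0 < m" using i by simp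
  have off: "shift_term a i j f K \<xi> = 0" if "K \<in> F" "\<xi> \<notin> K" for K
    using F(2)[OF that(1)] that(2) by (auto simp: shift_term_def haar_proj_level_eq)
  have K: "path m k Q n x \<in> G (k + int (n * m))" if "n < N" for n
    using path_in[OF Q x, of n] that by simp
  have \<xi>K: "\<xi> \<in> path m k Q n x" if "n \<le> N" for n using path_antimono[OF Q x that order_refl] \<xi> by blast
  have on: "shift_term a i j f (path m k Q n x) \<xi> = block k Q F n x (x n)" if n: "n < N" "path m k Q n x \<in> F" for n
  proof -
    have "label m (k + int (n * m)) (path m k Q n x) (x n) \<in> desc m (k + int (n * m)) (path m k Q n x)"
      using label_in[OF K[OF n(1)]] words_nth[OF x n(1)] by simp
    moreover have "\<xi> \<in> label m (k + int (n * m)) (path m k Q n x) (x n)" using \<xi>K[of "Suc n"] n by simp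
    ultimately show ?thesis
      using n by (simp add: shift_term_def block_def haar_proj_level_incr[OF K[OF n(1)] j] Let_def)
  qed
  have inj: "inj_on (\<lambda>n. path m k Q n x) {n. n < N \<and> path m k Q n x \<in> F}"
  proof (rule inj_onI)
    fix n n' assume n: "n \<in> {n. n < N \<and> path m k Q n x \<in> F}" "n' \<in> {n. n < N \<and> path m k Q n x \<in> F}"
      and eq: "path m k Q n x = path m k Q n' x"
    have "k + int (n * m) = k + int (n' * m)" using level_unique[OF K[of n]] K[of n'] n eq by auto
    then show "n = n'" using m by simp
  qed
  have img: "(\<lambda>n. path m k Q n x) ` {n. n < N \<and> path m k Q n x \<in> F} = {K \<in> F. \<xi> \<in> K}"
  proof (intro set_eqI iffI)
    fix K assume "K \<in> {K \<in> F. \<xi> \<in> K}"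
    then obtain n where n: "n < N" "K \<in> G (k + int (n * m))" "K \<in> F" "\<xi> \<in> K" using F(2) by blast
    then have "path m k Q n x = K" using cb_path[OF Q x _ \<xi>, of n] cb_unique[OF n(2,4)] by simp
    then show "K \<in> (\<lambda>n. path m k Q n x) ` {n. n < N \<and> path m k Q n x \<in> F}" using n by blast
  qed (use \<xi>K in auto)
  have "(\<Sum>K\<in>F. shift_term a i j f K \<xi>) = (\<Sum>K\<in>{K \<in> F. \<xi> \<in> K}. shift_term a i j f K \<xi>)"
    using off F(1) by (intro sum.mono_neutral_right) auto
  also have "\<dots> = (\<Sum>n\<in>{n. n < N \<and> path m k Q n x \<in> F}. shift_term a i j f (path m k Q n x) \<xi>)"
    unfolding img[symmetric] by (simp add: sum.reindex[OF inj])
  also have "\<dots> = (\<Sum>n\<in>{n. n < N \<and> path m k Q n x \<in> F}. block k Q F n x (x n))"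
    by (intro sum.cong) (auto simp: on)
  also have "\<dots> = (\<Sum>n<N. block k Q F n x (x n))"
    by (intro sum.mono_neutral_left) (auto simp: block_def Let_def)
  finally show ?thesis .
qed

text \<open>Translation from words to integrals: the sum over \<open>F\<close> is constant on each
  bottom cube, all bottom cubes have the same volume \<mu>, and Jensen bounds the averages of
  \<open>f\<close> over them. The depth N only has to reach below the levels occurring in
  \<open>F\<close>.\<close>

lemma class_bound_cube:
  fixes k :: int and N :: nat
  assumes Q: "Q \<in> G k" and F: "finite F" "\<And>K. K \<in> F \<Longrightarrow> \<exists>n<N. K \<in> G (k + int (n * m))"
  shows "(\<integral>\<^sup>+\<xi>. indicator Q \<xi> * ennreal (norm (\<Sum>K\<in>F. shift_term a i j f K \<xi>) powr p) \<partial>lebesgue)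
    \<le> ennreal ((4 * R * \<beta>\<^sup>2) powr p) * (\<integral>\<^sup>+\<xi>. indicator Q \<xi> * ennreal (norm (f \<xi>) powr p) \<partial>lebesgue)"
proof -
  let ?C = "{..<(2::nat) ^ (CARD('d) * m)}" let ?W = "words N ?C"
  define v where "v x = norm (\<Sum>n<N. block k Q F n x (x n)) powr p" for x
  define \<mu> where "\<mu> = vol (k + int (N * m))"
  have \<mu>: "0 < \<mu>" by (simp add: \<mu>_def vol_pos)
  have P: "path m k Q N x \<in> G (k + int (N * m))" "path m k Q N x \<subseteq> Q" if "x \<in> ?W" for x
    using path_in[OF Q that, of N] by auto
  have finW: "finite ?W" by (simp add: finite_words)
  have "(\<integral>\<^sup>+\<xi>. indicator Q \<xi> * ennreal (norm (\<Sum>K\<in>F. shift_term a i j f K \<xi>) powr p) \<partial>lebesgue)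
    \<le> (\<integral>\<^sup>+\<xi>. (\<Sum>x\<in>?W. ennreal (v x) * indicator (path m k Q N x) \<xi>) \<partial>lebesgue)"
  proof (rule nn_integral_mono)
    fix \<xi> :: "real ^ 'd"
    show "indicator Q \<xi> * ennreal (norm (\<Sum>K\<in>F. shift_term a i j f K \<xi>) powr p)
      \<le> (\<Sum>x\<in>?W. ennreal (v x) * indicator (path m k Q N x) \<xi>)"
    proof (cases "\<xi> \<in> Q")
      case True
      have "cb (k + int (N * m)) \<xi> \<in> desc (N * m) k Q" using True desc_iff[OF Q] by blast
      then obtain x where x: "x \<in> ?W" "path m k Q N x = cb (k + int (N * m)) \<xi>"
        using bij_betw_imp_surj_on[OF bij_path[OF Q, of m N]] by (metis imageE)
      have \<xi>: "\<xi> \<in> path m k Q N x" unfolding x(2) by (rule mem_cb)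
      have "ennreal (v x) * indicator (path m k Q N x) \<xi> \<le> (\<Sum>x\<in>?W. ennreal (v x) * indicator (path m k Q N x) \<xi>)"
        using x(1) finW by (intro member_le_sum) auto
      then show ?thesis using True \<xi> sum_shift_terms[OF Q x(1) F \<xi>] by (simp add: v_def)
    qed simp
  qed
  also have "\<dots> = (\<Sum>x\<in>?W. \<integral>\<^sup>+\<xi>. ennreal (v x) * indicator (path m k Q N x) \<xi> \<partial>lebesgue)"
    using cube_sets[OF P(1)] by (intro nn_integral_sum) auto
  also have "\<dots> = (\<Sum>x\<in>?W. ennreal (v x) * emeasure lebesgue (path m k Q N x))"
    by (intro sum.cong refl nn_integral_cmult_indicator cube_sets[OF P(1)])
  also have "\<dots> = (\<Sum>x\<in>?W. ennreal (v x * \<mu>))"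
    using emeasure_cube[OF P(1)] \<mu> by (intro sum.cong) (auto simp: \<mu>_def v_def ennreal_mult)
  also have "\<dots> = ennreal (\<mu> * (\<Sum>x\<in>?W. v x))"
    using \<mu> by (subst sum_ennreal) (auto simp: v_def sum_distrib_left mult.commute)
  also have "\<dots> \<le> ennreal (\<mu> * ((4 * R * \<beta>\<^sup>2) powr p * (\<Sum>x\<in>?W. norm (average (path m k Q N x) f) powr p)))"
    unfolding v_def using class_bound_words[OF Q, where N = N and F = F] \<mu> by (intro ennreal_leI mult_left_mono) auto
  also have "\<dots> = ennreal ((4 * R * \<beta>\<^sup>2) powr p) * (\<Sum>x\<in>?W. ennreal (\<mu> * norm (average (path m k Q N x) f) powr p))"
    using \<mu> by (subst sum_ennreal) (auto simp: sum_distrib_left ennreal_mult[symmetric] sum_nonneg mult_ac)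
  also have "\<dots> \<le> ennreal ((4 * R * \<beta>\<^sup>2) powr p) * (\<Sum>x\<in>?W. \<integral>\<^sup>+\<xi>. indicator (path m k Q N x) \<xi> * ennreal (norm (f \<xi>) powr p) \<partial>lebesgue)"
  proof (intro mult_left_mono sum_mono)
    fix x assume x: "x \<in> ?W"
    show "ennreal (\<mu> * norm (average (path m k Q N x) f) powr p) \<le> (\<integral>\<^sup>+\<xi>. indicator (path m k Q N x) \<xi> * ennreal (norm (f \<xi>) powr p) \<partial>lebesgue)"
      using average_powr_le[OF p cube_sets[OF P(1)[OF x]] measure_cube_pos[OF P(1)[OF x]] emeasure_cube_finite[OF P(1)[OF x]]
         integrable_on_cube[OF P(1)[OF x]]]
      unfolding measure_cube[OF P(1)[OF x]] \<mu>_def .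
  qed simp
  also have "\<dots> \<le> ennreal ((4 * R * \<beta>\<^sup>2) powr p) * (\<integral>\<^sup>+\<xi>. indicator Q \<xi> * ennreal (norm (f \<xi>) powr p) \<partial>lebesgue)"
  proof (intro mult_left_mono sum_nn_integral_disjoint_le)
    show "disjoint_family_on (path m k Q N) ?W"
      unfolding disjoint_family_on_def
    proof (intro ballI impI)
      fix x x' assume x: "x \<in> ?W" "x' \<in> ?W" "x \<noteq> x'"
      have "path m k Q N x \<noteq> path m k Q N x'"
        using bij_betw_imp_inj_on[OF bij_path[OF Q, of m N]] x by (auto simp: inj_on_def)
      then show "path m k Q N x \<inter> path m k Q N x' = {}" by (rule disjoint_level[OF P(1)[OF x(1)] P(1)[OF x(2)]])
    qed
  qed (use f P cube_sets finW in \<open>auto simp: in_Lp_def\<close>)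
  finally show ?thesis .
qed

end


section \<open>From one top cube to arbitrary finite families\<close>

lemma simple_function_haar_proj_level:
  fixes F :: "real ^ 'd \<Rightarrow> 'e::banach"
  assumes K: "K \<in> G k"
  shows "simple_function lebesgue (haar_proj_level (\<Union>k. G k) j K F)"
proof -
  have "simple_function lebesgue (\<lambda>x. indicat_real J x *\<^sub>R v)" if "J \<in> desc (Suc j) k K" for J and v :: 'e
    using that cube_sets by (intro simple_function_compose1[where g = "\<lambda>s. s *\<^sub>R v"]) (auto simp: desc_def)
  then have "simple_function lebesgue (\<lambda>x. \<Sum>J\<in>desc (Suc j) k K. indicat_real J x *\<^sub>R incr k j F J)"
    by (intro simple_function_sum)
  moreover have "haar_proj_level (\<Union>k. G k) j K F = (\<lambda>x. \<Sum>J\<in>desc (Suc j) k K. indicat_real J x *\<^sub>R incr k j F J)"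
    by (rule ext) (rule haar_proj_level_sum[OF K lessI])
  ultimately show ?thesis by simp
qed

lemma simple_function_shift_sum:
  assumes "F \<subseteq> (\<Union>k. G k)"
  shows "simple_function lebesgue (\<lambda>x. \<Sum>K\<in>F. shift_term a i j f K x)"
  using assms by (intro simple_function_sum) (auto simp: shift_term_def intro: simple_function_haar_proj_level)

lemma measurable_norm_shift_sum:
  assumes "F \<subseteq> (\<Union>k. G k)"
  shows "(\<lambda>x. norm (\<Sum>K\<in>F. shift_term a i j f K x) powr p) \<in> borel_measurable lebesgue"
  by (rule borel_measurable_simple_function[OF simple_function_compose1[OF simple_function_shift_sum[OF assms]]])

text \<open>The cubes of \<open>F\<close> lie under finitely many pairwise disjoint cubes of level
  k. The estimates on these add up because they concern integrals of p-th powers.\<close>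

lemma class_bound:
  fixes a :: "(real ^ 'd) set \<Rightarrow> real ^ 'd \<Rightarrow> real ^ 'd \<Rightarrow> 'e::banach \<Rightarrow>\<^sub>L 'e"
  assumes umd: "UMD_bound TYPE('e) p \<beta>" and p: "1 \<le> p"
    and ker: "\<And>k K. K \<in> G k \<Longrightarrow> strongly_measurable_kernel (a K)"
    and R: "R_bound p (kernel_values (\<Union>k. G k) a) R"
    and ij: "i < m" "j < m" and f: "in_Lp lebesgue p f"
    and F: "finite F" "\<And>K. K \<in> F \<Longrightarrow> \<exists>n<N. K \<in> G (k + int (n * m))"
  shows "(\<integral>\<^sup>+\<xi>. ennreal (norm (\<Sum>K\<in>F. shift_term a i j f K \<xi>) powr p) \<partial>lebesgue)
    \<le> ennreal ((4 * R * \<beta>\<^sup>2) powr p) * (\<integral>\<^sup>+\<xi>. ennreal (norm (f \<xi>) powr p) \<partial>lebesgue)"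
proof -
  let ?S = "\<lambda>\<xi>. norm (\<Sum>K\<in>F. shift_term a i j f K \<xi>) powr p"
  define T where "T = (\<lambda>K. cb k (point K)) ` F"
  have T: "finite T" "Q \<in> T \<Longrightarrow> Q \<in> G k" for Q using F(1) cb_in by (auto simp: T_def)
  have sub: "F \<subseteq> (\<Union>k. G k)" using F(2) by blast
  note meas = measurable_norm_shift_sum[OF sub, of a i j f p]
  have top: "\<xi> \<in> cb k (point K)" if K: "K \<in> F" "\<xi> \<in> K" for K \<xi>
  proof -
    obtain n where n: "K \<in> G (k + int (n * m))" using F(2)[OF K(1)] by blast
    have "cb k (point K) = cb k \<xi>" by (rule cb_point[OF n K(2)]) simp
    then show ?thesis using mem_cb by simp
  qed
  have off: "?S \<xi> = 0" if "\<And>K. K \<in> F \<Longrightarrow> \<xi> \<notin> K" for \<xi>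
  proof -
    have "shift_term a i j f K \<xi> = 0" if K: "K \<in> F" for K
      using F(2)[OF K] \<open>\<And>K. K \<in> F \<Longrightarrow> \<xi> \<notin> K\<close>[OF K] by (auto simp: shift_term_def haar_proj_level_eq)
    then show ?thesis by simp
  qed
  have "(\<integral>\<^sup>+\<xi>. ennreal (?S \<xi>) \<partial>lebesgue) \<le> (\<integral>\<^sup>+\<xi>. (\<Sum>Q\<in>T. indicator Q \<xi> * ennreal (?S \<xi>)) \<partial>lebesgue)"
  proof (rule nn_integral_mono)
    fix \<xi> :: "real ^ 'd"
    show "ennreal (?S \<xi>) \<le> (\<Sum>Q\<in>T. indicator Q \<xi> * ennreal (?S \<xi>))"
    proof (cases "\<exists>K\<in>F. \<xi> \<in> K")
      case True
      then obtain K where K: "K \<in> F" "\<xi> \<in> K" by blast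
      have "indicator (cb k (point K)) \<xi> * ennreal (?S \<xi>) \<le> (\<Sum>Q\<in>T. indicator Q \<xi> * ennreal (?S \<xi>))"
        by (rule member_le_sum[OF _ _ T(1)]) (use K in \<open>auto simp: T_def\<close>)
      then show ?thesis using top[OF K] by simp
    next
      case False
      then have "?S \<xi> = 0" by (intro off) blast
      then show ?thesis by simp
    qed
  qed
  also have "\<dots> = (\<Sum>Q\<in>T. \<integral>\<^sup>+\<xi>. indicator Q \<xi> * ennreal (?S \<xi>) \<partial>lebesgue)"
    using T(2) cube_sets meas by (intro nn_integral_sum) auto
  also have "\<dots> \<le> (\<Sum>Q\<in>T. ennreal ((4 * R * \<beta>\<^sup>2) powr p) * (\<integral>\<^sup>+\<xi>. indicator Q \<xi> * ennreal (norm (f \<xi>) powr p) \<partial>lebesgue))"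
    by (intro sum_mono class_bound_cube[OF umd p ker R ij f T(2) F])
  also have "\<dots> = ennreal ((4 * R * \<beta>\<^sup>2) powr p) * (\<Sum>Q\<in>T. \<integral>\<^sup>+\<xi>. indicator Q \<xi> * ennreal (norm (f \<xi>) powr p) \<partial>lebesgue)"
    by (rule sum_distrib_left[symmetric])
  also have "\<dots> \<le> ennreal ((4 * R * \<beta>\<^sup>2) powr p) * (\<integral>\<^sup>+\<xi>. indicator UNIV \<xi> * ennreal (norm (f \<xi>) powr p) \<partial>lebesgue)"
  proof (intro mult_left_mono sum_nn_integral_disjoint_le)
    show "disjoint_family_on (\<lambda>Q. Q) T"
      using disjoint_level[OF T(2) T(2)] by (auto simp: disjoint_family_on_def)
  qed (use f T cube_sets in \<open>auto simp: in_Lp_def\<close>)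
  finally show ?thesis by simp
qed

text \<open>Splitting into m residue classes costs \<open>real m powr (p - 1)\<close> by convexity,
  and adding the m class bounds costs another m; together this is the p-th power of the factor m in
  the constant.\<close>

lemma shift_sum_bound:
  fixes a :: "(real ^ 'd) set \<Rightarrow> real ^ 'd \<Rightarrow> real ^ 'd \<Rightarrow> 'e::banach \<Rightarrow>\<^sub>L 'e"
  assumes umd: "UMD_bound TYPE('e) p \<beta>" and p: "1 \<le> p"
    and ker: "\<And>k K. K \<in> G k \<Longrightarrow> strongly_measurable_kernel (a K)"
    and R: "R_bound p (kernel_values (\<Union>k. G k) a) R"
    and ij: "i < m" "j < m" and f: "in_Lp lebesgue p f"
    and F: "finite F" "F \<subseteq> (\<Union>k. G k)"
  shows "(\<integral>\<^sup>+\<xi>. ennreal (norm (\<Sum>K\<in>F. shift_term a i j f K \<xi>) powr p) \<partial>lebesgue)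
    \<le> ennreal ((4 * real m * R * \<beta>\<^sup>2) powr p) * (\<integral>\<^sup>+\<xi>. ennreal (norm (f \<xi>) powr p) \<partial>lebesgue)"
proof -
  have m: "0 < m" using ij by simp
  have "\<forall>K\<in>F. \<exists>l. K \<in> G l" using F(2) by blast
  then obtain lev where lev: "\<And>K. K \<in> F \<Longrightarrow> K \<in> G (lev K)" by metis
  \<comment> \<open>Inserting 0 keeps minimum and maximum meaningful when \<open>F\<close> is empty;
    only lower and upper bounds for the levels matter.\<close>
  define k0 where "k0 = Min (insert 0 (lev ` F))"
  define N where "N = nat (Max (insert 0 (lev ` F)) - k0) + 1"
  have k0: "k0 \<le> lev K" and N: "lev K - k0 < int N" if "K \<in> F" for K
  proof -
    show "k0 \<le> lev K" unfolding k0_def using F(1) that by (intro Min_le) auto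
    have "lev K \<le> Max (insert 0 (lev ` F))" using F(1) that by (intro Max_ge) auto
    then show "lev K - k0 < int N" unfolding N_def by linarith
  qed
  define Fr where "Fr r = {K \<in> F. nat (lev K - k0) mod m = r}" for r
  have Fr: "finite (Fr r)" "Fr r \<subseteq> (\<Union>k. G k)" for r using F by (auto simp: Fr_def)
  have cls: "\<exists>n<N. K \<in> G (k0 + int r + int (n * m))" if K: "K \<in> Fr r" for K r
  proof (intro exI conjI)
    let ?t = "nat (lev K - k0)"
    have KF: "K \<in> F" and r: "?t mod m = r" using K by (auto simp: Fr_def)
    have "?t div m \<le> ?t" by simp
    then show "?t div m < N" using k0[OF KF] N[OF KF] by linarith
    have "int (?t mod m) + int (?t div m * m) = int ?t"
      by (metis mod_div_mult_eq of_nat_add)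
    then have "k0 + int r + int (?t div m * m) = lev K" using k0[OF KF] r by linarith
    then show "K \<in> G (k0 + int r + int (?t div m * m))" using lev[OF KF] by simp
  qed
  let ?S = "\<lambda>F \<xi>. \<Sum>K\<in>F. shift_term a i j f K \<xi>" and ?I = "\<integral>\<^sup>+\<xi>. ennreal (norm (f \<xi>) powr p) \<partial>lebesgue"
  have split: "?S F \<xi> = (\<Sum>r<m. ?S (Fr r) \<xi>)" for \<xi>
    unfolding Fr_def using F(1) m by (intro sum.group[symmetric]) auto
  have R0: "0 \<le> R" using R by (simp add: R_bound_def)
  have [measurable]: "(\<lambda>\<xi>. norm (?S (Fr r) \<xi>) powr p) \<in> borel_measurable lebesgue" for r
    by (rule measurable_norm_shift_sum[OF Fr(2)])
  have "(\<integral>\<^sup>+\<xi>. ennreal (norm (?S F \<xi>) powr p) \<partial>lebesgue)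
    \<le> (\<integral>\<^sup>+\<xi>. (\<Sum>r<m. ennreal (real m powr (p - 1)) * ennreal (norm (?S (Fr r) \<xi>) powr p)) \<partial>lebesgue)"
  proof (rule nn_integral_mono)
    fix \<xi> :: "real ^ 'd"
    have "norm (?S F \<xi>) powr p \<le> real m powr (p - 1) * (\<Sum>r<m. norm (?S (Fr r) \<xi>) powr p)"
      using norm_sum_powr_le[OF p, of "{..<m}" "\<lambda>r. ?S (Fr r) \<xi>"] by (simp add: split)
    then have "ennreal (norm (?S F \<xi>) powr p) \<le> ennreal (\<Sum>r<m. real m powr (p - 1) * norm (?S (Fr r) \<xi>) powr p)"
      unfolding sum_distrib_left by (rule ennreal_leI)
    also have "\<dots> = (\<Sum>r<m. ennreal (real m powr (p - 1) * norm (?S (Fr r) \<xi>) powr p))"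
      by (rule sum_ennreal[symmetric]) simp
    finally show "ennreal (norm (?S F \<xi>) powr p) \<le> (\<Sum>r<m. ennreal (real m powr (p - 1)) * ennreal (norm (?S (Fr r) \<xi>) powr p))"
      by (simp add: ennreal_mult)
  qed
  also have "\<dots> = (\<Sum>r<m. \<integral>\<^sup>+\<xi>. ennreal (real m powr (p - 1)) * ennreal (norm (?S (Fr r) \<xi>) powr p) \<partial>lebesgue)"
    by (intro nn_integral_sum) measurable
  also have "\<dots> = (\<Sum>r<m. ennreal (real m powr (p - 1)) * (\<integral>\<^sup>+\<xi>. ennreal (norm (?S (Fr r) \<xi>) powr p) \<partial>lebesgue))"
    by (intro sum.cong refl nn_integral_cmult) measurable
  also have "\<dots> \<le> (\<Sum>r<m. ennreal (real m powr (p - 1)) * (ennreal ((4 * R * \<beta>\<^sup>2) powr p) * ?I))"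
    by (intro sum_mono mult_left_mono class_bound[OF umd p ker R ij f Fr(1) cls]) auto
  also have "\<dots> = ennreal (real m * (real m powr (p - 1) * (4 * R * \<beta>\<^sup>2) powr p)) * ?I"
    by (simp add: ennreal_mult mult.assoc ennreal_of_nat_eq_real_of_nat)
  also have "real m * (real m powr (p - 1) * (4 * R * \<beta>\<^sup>2) powr p) = (4 * real m * R * \<beta>\<^sup>2) powr p"
  proof -
    have "(4 * real m * R * \<beta>\<^sup>2) powr p = (real m * (4 * R * \<beta>\<^sup>2)) powr p" by (simp add: mult_ac)
    also have "\<dots> = real m powr p * (4 * R * \<beta>\<^sup>2) powr p" using R0 by (intro powr_mult)
    also have "real m powr p = real m * real m powr (p - 1)" using m by (simp add: powr_diff)
    finally show ?thesis by simp
  qed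
  finally show ?thesis .
qed

end

section \<open>Unconditional convergence\<close>

text \<open>Fatou's lemma: the power of the norm of the limit is almost everywhere a limes
  inferior.\<close>

lemma nn_integral_norm_powr_limit_le:
  fixes s :: "nat \<Rightarrow> 'a \<Rightarrow> 'e::real_normed_vector"
  assumes s: "\<And>n. simple_function M (s n)" and lim: "AE x in M. (\<lambda>n. s n x) \<longlonglongrightarrow> S x" and p: "0 < p"
    and B: "\<And>n. n \<ge> n0 \<Longrightarrow> (\<integral>\<^sup>+x. norm (s n x) powr p \<partial>M) \<le> B"
  shows "(\<integral>\<^sup>+x. norm (S x) powr p \<partial>M) \<le> B"
proof -
  have [measurable]: "(\<lambda>x. norm (s n x) powr p) \<in> borel_measurable M" for n
    by (rule borel_measurable_simple_function[OF simple_function_compose1[OF s]])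
  have "(\<integral>\<^sup>+x. norm (S x) powr p \<partial>M) = (\<integral>\<^sup>+x. liminf (\<lambda>n. ennreal (norm (s n x) powr p)) \<partial>M)"
  proof (rule nn_integral_cong_AE)
    show "AE x in M. ennreal (norm (S x) powr p) = liminf (\<lambda>n. ennreal (norm (s n x) powr p))"
      using lim
    proof eventually_elim
      case (elim x)
      have "(\<lambda>n. norm (s n x) powr p) \<longlonglongrightarrow> norm (S x) powr p"
        using elim p by (intro tendsto_powr' tendsto_norm tendsto_const) auto
      then have "(\<lambda>n. ennreal (norm (s n x) powr p)) \<longlonglongrightarrow> ennreal (norm (S x) powr p)" by (rule tendsto_ennrealI)
      then show ?case by (rule lim_imp_Liminf[OF trivial_limit_sequentially, symmetric])
    qed
  qed
  also have "\<dots> \<le> liminf (\<lambda>n. \<integral>\<^sup>+x. norm (s n x) powr p \<partial>M)"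
    by (rule nn_integral_liminf) measurable
  also have "\<dots> \<le> B"
  proof -
    have "\<forall>\<^sub>F n in sequentially. (\<integral>\<^sup>+x. norm (s n x) powr p \<partial>M) \<le> B"
      using B by (auto simp: eventually_sequentially)
    then have "liminf (\<lambda>n. \<integral>\<^sup>+x. norm (s n x) powr p \<partial>M) \<le> liminf (\<lambda>n. B)"
      by (rule Liminf_mono)
    then show ?thesis by (simp add: Liminf_const)
  qed
  finally show ?thesis .
qed

text \<open>A crude substitute for Minkowski's inequality. It serves only to show smallness and
  finiteness, so its constant does not enter the final bound.\<close>

lemma nn_integral_norm_powr_add_le:
  fixes u v :: "'a \<Rightarrow> 'e::real_normed_vector"
  assumes "strongly_measurable M u" "strongly_measurable M v" and p: "1 \<le> p"
  shows "(\<integral>\<^sup>+x. norm (u x + v x) powr p \<partial>M)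
    \<le> ennreal (2 powr (p - 1)) * ((\<integral>\<^sup>+x. norm (u x) powr p \<partial>M) + (\<integral>\<^sup>+x. norm (v x) powr p \<partial>M))"
proof -
  obtain h k where h [measurable]: "h \<in> borel_measurable M" and h': "AE x in M. h x = norm (u x)"
    and k [measurable]: "k \<in> borel_measurable M" and k': "AE x in M. k x = norm (v x)"
    using strongly_measurable_norm assms by metis
  have le: "norm (x + y) powr p \<le> 2 powr (p - 1) * (norm x powr p + norm y powr p)" for x y :: 'e
    using norm_sum_powr_le[OF p, of "UNIV :: bool set" "\<lambda>b. if b then x else y"] by (simp add: UNIV_bool add.commute)
  have "(\<integral>\<^sup>+x. norm (u x + v x) powr p \<partial>M) \<le> (\<integral>\<^sup>+x. ennreal (2 powr (p - 1)) * (ennreal (h x powr p) + ennreal (k x powr p)) \<partial>M)"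
  proof (rule nn_integral_mono_AE)
    show "AE x in M. ennreal (norm (u x + v x) powr p) \<le> ennreal (2 powr (p - 1)) * (ennreal (h x powr p) + ennreal (k x powr p))"
      using h' k' by eventually_elim (use le in \<open>auto simp: ennreal_leI simp flip: ennreal_plus ennreal_mult'\<close>)
  qed
  also have "\<dots> = ennreal (2 powr (p - 1)) * ((\<integral>\<^sup>+x. h x powr p \<partial>M) + (\<integral>\<^sup>+x. k x powr p \<partial>M))"
    by (simp add: nn_integral_cmult nn_integral_add)
  also have "(\<integral>\<^sup>+x. h x powr p \<partial>M) = (\<integral>\<^sup>+x. norm (u x) powr p \<partial>M)"
    using h' by (intro nn_integral_cong_AE) auto
  also have "(\<integral>\<^sup>+x. k x powr p \<partial>M) = (\<integral>\<^sup>+x. norm (v x) powr p \<partial>M)"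
    using k' by (intro nn_integral_cong_AE) auto
  finally show ?thesis .
qed

text \<open>Small tails make the net of finite sums Cauchy. The limit is built along an increasing
  sequence of finite sets whose increments decay fast enough for convergence almost everywhere;
  Fatou then gives both its norm bound and its distance to any larger finite sum.\<close>

lemma has_Lp_sum_of_small_tails:
  fixes g :: "'i \<Rightarrow> 'a \<Rightarrow> 'e::banach"
  assumes p: "1 \<le> p" and g: "\<And>i. i \<in> A \<Longrightarrow> simple_function M (g i)"
    and B: "\<And>F. finite F \<Longrightarrow> F \<subseteq> A \<Longrightarrow> (\<integral>\<^sup>+x. norm (\<Sum>i\<in>F. g i x) powr p \<partial>M) \<le> B" "B < \<infinity>"
    and tails: "\<And>\<delta>. 0 < \<delta> \<Longrightarrow> \<exists>F0. finite F0 \<and> F0 \<subseteq> A \<and> (\<forall>F. finite F \<longrightarrow> F \<subseteq> A \<longrightarrow> F \<inter> F0 = {} \<longrightarrow>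
        (\<integral>\<^sup>+x. norm (\<Sum>i\<in>F. g i x) powr p \<partial>M) \<le> ennreal \<delta>)"
  obtains S where "has_Lp_sum M p g S A" "(\<integral>\<^sup>+x. norm (S x) powr p \<partial>M) \<le> B"
proof -
  have p0: "0 < p" using p by simp
  \<comment> \<open>After weighting by \<open>(2 ^ n) powr p\<close>, the integral of the n-th
    increment is still at most \<open>(1 / 2) ^ n\<close>. The weighted terms are thus summable
    almost everywhere, which forces the increment itself to be eventually below
    \<open>(1 / 2) ^ n\<close>.\<close>
  define \<delta> where "\<delta> n = (1 / 2) ^ n * ((1 / 2) ^ n) powr p" for n :: nat
  have \<delta>: "0 < \<delta> n" for n by (simp add: \<delta>_def)
  obtain F0 where F0: "\<And>n. finite (F0 n)" "\<And>n. F0 n \<subseteq> A" and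
    tail: "\<And>n F. finite F \<Longrightarrow> F \<subseteq> A \<Longrightarrow> F \<inter> F0 n = {} \<Longrightarrow> (\<integral>\<^sup>+x. norm (\<Sum>i\<in>F. g i x) powr p \<partial>M) \<le> ennreal (\<delta> n)"
    using tails[OF \<delta>] by metis
  define F where "F n = (\<Union>l\<le>n. F0 l)" for n
  have F: "finite (F n)" "F n \<subseteq> A" "F0 n \<subseteq> F n" for n using F0 by (auto simp: F_def)
  have F_mono: "n \<le> n' \<Longrightarrow> F n \<subseteq> F n'" for n n' by (auto simp: F_def intro: order_trans)
  define s where "s H x = (\<Sum>i\<in>H. g i x)" for H x
  have sf: "simple_function M (s H)" if "H \<subseteq> A" for H
    unfolding s_def[abs_def] using that g by (intro simple_function_sum) auto
  have s_diff: "s H x - s H' x = s (H - H') x - s (H' - H) x" if "finite H" "finite H'" for H H' x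
  proof -
    have "s H x = s (H \<inter> H') x + s (H - H') x" "s H' x = s (H \<inter> H') x + s (H' - H) x"
      unfolding s_def using sum.Int_Diff[OF that(1), of _ H'] sum.Int_Diff[OF that(2), of _ H] by (simp_all add: Int_commute)
    then show ?thesis by simp
  qed
  define \<Delta> where "\<Delta> n x = s (F (Suc n)) x - s (F n) x" for n x
  have \<Delta>: "\<Delta> n x = s (F (Suc n) - F n) x" for n x
    using s_diff[of "F (Suc n)" "F n" x, OF F(1) F(1)] F_mono[of n "Suc n"] by (simp add: \<Delta>_def Diff_eq_empty_iff[THEN iffD2] s_def[of "{}"])
  have int_\<Delta>: "(\<integral>\<^sup>+x. norm (\<Delta> n x) powr p \<partial>M) \<le> ennreal (\<delta> n)" for n
    unfolding \<Delta> s_def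
  proof (rule tail)
    show "F (Suc n) - F n \<subseteq> A" using F(2)[of "Suc n"] by blast
    show "(F (Suc n) - F n) \<inter> F0 n = {}" using F(3)[of n] by blast
  qed (use F(1) in simp)
  define w where "w n x = (2 ^ n) powr p * norm (\<Delta> n x) powr p" for n :: nat and x
  have w_meas [measurable]: "w n \<in> borel_measurable M" for n
  proof -
    have "simple_function M (\<Delta> n)" unfolding \<Delta>[abs_def] by (rule sf) (use F in auto)
    then show ?thesis unfolding w_def[abs_def]
      by (intro borel_measurable_simple_function simple_function_compose1[where g = "\<lambda>v. (2 ^ n) powr p * norm v powr p"])
  qed
  have "(\<integral>\<^sup>+x. (\<Sum>n. ennreal (w n x)) \<partial>M) = (\<Sum>n. \<integral>\<^sup>+x. ennreal (w n x) \<partial>M)"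
    by (rule nn_integral_suminf) measurable
  also have "\<dots> \<le> (\<Sum>n. ennreal ((1 / 2) ^ n))"
  proof (rule suminf_le)
    fix n :: nat
    have [measurable]: "(\<lambda>x. norm (\<Delta> n x) powr p) \<in> borel_measurable M"
    proof -
      have "simple_function M (\<Delta> n)" unfolding \<Delta>[abs_def] by (rule sf) (use F in auto)
      then show ?thesis by (intro borel_measurable_simple_function simple_function_compose1[where g = "\<lambda>v. norm v powr p"])
    qed
    have "(\<integral>\<^sup>+x. ennreal (w n x) \<partial>M) = ennreal ((2 ^ n) powr p) * (\<integral>\<^sup>+x. norm (\<Delta> n x) powr p \<partial>M)"
      unfolding w_def by (subst nn_integral_cmult[symmetric]) (auto simp: ennreal_mult)
    also have "\<dots> \<le> ennreal ((2 ^ n) powr p) * ennreal (\<delta> n)" by (intro mult_left_mono int_\<Delta>) simp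
    also have "\<dots> = ennreal ((2 ^ n) powr p * \<delta> n)" using \<delta>[of n] by (simp add: ennreal_mult less_imp_le)
    also have "(2 ^ n) powr p * \<delta> n = (1 / 2) ^ n * (2 ^ n * (1 / 2) ^ n) powr p"
      unfolding \<delta>_def by (subst powr_mult) auto
    also have "\<dots> = (1 / 2) ^ n" by (simp add: power_mult_distrib[symmetric])
    finally show "(\<integral>\<^sup>+x. ennreal (w n x) \<partial>M) \<le> ennreal ((1 / 2) ^ n)" .
  qed auto
  also have "\<dots> = ennreal (\<Sum>n. (1 / 2) ^ n)" by (rule suminf_ennreal2) (auto intro: summable_geometric)
  also have "\<dots> < \<infinity>" by simp
  finally have "AE x in M. (\<Sum>n. ennreal (w n x)) \<noteq> \<infinity>"
    by (intro nn_integral_PInf_AE) auto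
  then have conv: "AE x in M. convergent (\<lambda>n. s (F n) x)"
  proof eventually_elim
    case (elim x)
    have "summable (\<lambda>n. w n x)"
      by (rule summable_suminf_not_top) (use elim in \<open>auto simp: w_def\<close>)
    then have "(\<lambda>n. w n x) \<longlonglongrightarrow> 0" by (rule summable_LIMSEQ_zero)
    then have "\<forall>\<^sub>F n in sequentially. w n x < 1" by (rule order_tendstoD) simp
    then have "\<forall>\<^sub>F n in sequentially. norm (\<Delta> n x) \<le> (1 / 2) ^ n"
    proof eventually_elim
      case (elim n)
      then have "(2 ^ n * norm (\<Delta> n x)) powr p < 1 powr p" by (simp add: w_def powr_mult)
      then have "2 ^ n * norm (\<Delta> n x) < 1" using p0
        by (meson linorder_not_le norm_ge_zero powr_mono2 less_imp_le mult_nonneg_nonneg zero_le_numeral zero_le_power zero_le_one)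
      then show ?case by (simp add: power_one_over field_simps)
    qed
    then have "summable (\<lambda>n. \<Delta> n x)"
      by (rule summable_comparison_test_ev) (auto intro: summable_geometric)
    then have "convergent (\<lambda>n. \<Sum>l<n. \<Delta> l x)" by (simp add: summable_iff_convergent)
    moreover have "(\<Sum>l<n. \<Delta> l x) = s (F n) x - s (F 0) x" for n
      unfolding \<Delta>_def by (rule sum_lessThan_telescope)
    ultimately have cv: "convergent (\<lambda>n. s (F n) x - s (F 0) x)" by simp
    show ?case using convergent_add[OF cv convergent_const[of "s (F 0) x"]] by simp
  qed
  define S where "S x = lim (\<lambda>n. s (F n) x)" for x
  have lim: "AE x in M. (\<lambda>n. s (F n) x) \<longlonglongrightarrow> S x"
    using conv by eventually_elim (simp add: S_def convergent_LIMSEQ_iff)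
  have S_B: "(\<integral>\<^sup>+x. norm (S x) powr p \<partial>M) \<le> B"
    by (rule nn_integral_norm_powr_limit_le[OF sf[OF F(2)] lim p0, of 0]) (use B(1) F in \<open>auto simp: s_def\<close>)
  have "strongly_measurable M S" unfolding strongly_measurable_def
    by (intro exI[of _ "\<lambda>n. s (F n)"] conjI allI sf F lim)
  then have S_Lp: "in_Lp M p S" using S_B B(2) by (auto simp: in_Lp_def)
  \<comment> \<open>A finite set H containing \<open>F n\<close> and a later \<open>F l\<close>
    differ by two sets that avoid \<open>F0 n\<close>, so both differences are small; Fatou in l
    replaces \<open>F l\<close> by the limit. The constant is \<open>2 powr (p - 1)\<close> times
    2.\<close>
  have close: "(\<integral>\<^sup>+x. norm ((\<Sum>i\<in>H. g i x) - S x) powr p \<partial>M) \<le> ennreal (2 powr p * \<delta> n)"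
    if H: "finite H" "F n \<subseteq> H" "H \<subseteq> A" for H n
  proof -
    have "AE x in M. (\<lambda>l. s H x - s (F l) x) \<longlonglongrightarrow> s H x - S x"
      using lim by eventually_elim (rule tendsto_diff[OF tendsto_const])
    then have "(\<integral>\<^sup>+x. norm (s H x - S x) powr p \<partial>M) \<le> ennreal (2 powr p * \<delta> n)"
    proof (rule nn_integral_norm_powr_limit_le[OF _ _ p0, of _ "\<lambda>l x. s H x - s (F l) x" _ n, rotated])
      fix l assume l: "n \<le> l"
      have "(\<integral>\<^sup>+x. norm (s H x - s (F l) x) powr p \<partial>M) = (\<integral>\<^sup>+x. norm (s (H - F l) x + - 1 *\<^sub>R s (F l - H) x) powr p \<partial>M)"
        by (simp add: s_diff[OF H(1) F(1)])
      also have "\<dots> \<le> ennreal (2 powr (p - 1)) * ((\<integral>\<^sup>+x. norm (s (H - F l) x) powr p \<partial>M) + (\<integral>\<^sup>+x. norm (- 1 *\<^sub>R s (F l - H) x) powr p \<partial>M))"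
        by (rule nn_integral_norm_powr_add_le[OF strongly_measurable_simple strongly_measurable_cmult[OF strongly_measurable_simple] p])
          (rule sf, use H F(2)[of l] in blast)+
      also have "\<dots> \<le> ennreal (2 powr (p - 1)) * (ennreal (\<delta> n) + ennreal (\<delta> n))"
      proof (intro mult_left_mono add_mono)
        show "(\<integral>\<^sup>+x. norm (s (H - F l) x) powr p \<partial>M) \<le> ennreal (\<delta> n)"
          unfolding s_def
        proof (rule tail)
          show "H - F l \<subseteq> A" "(H - F l) \<inter> F0 n = {}" using H F_mono[OF l] F(3)[of n] by blast+
        qed (use H in simp)
        have "(\<integral>\<^sup>+x. norm (s (F l - H) x) powr p \<partial>M) \<le> ennreal (\<delta> n)"
          unfolding s_def
        proof (rule tail)
          show "F l - H \<subseteq> A" "(F l - H) \<inter> F0 n = {}" using H F(2)[of l] F(3)[of n] by blast+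
        qed (use F(1) in simp)
        then show "(\<integral>\<^sup>+x. norm (- 1 *\<^sub>R s (F l - H) x) powr p \<partial>M) \<le> ennreal (\<delta> n)" by simp
      qed simp
      also have "\<dots> = ennreal (2 powr p * \<delta> n)"
        using \<delta>[of n] by (simp add: powr_diff flip: ennreal_plus ennreal_mult')
      finally show "(\<integral>\<^sup>+x. norm (s H x - s (F l) x) powr p \<partial>M) \<le> ennreal (2 powr p * \<delta> n)" .
    next
      show "simple_function M (\<lambda>x. s H x - s (F l) x)" for l
        by (intro simple_function_compose2[where h = "(-)"] sf H F)
    qed
    then show ?thesis by (simp add: s_def)
  qed
  have "((\<lambda>H. \<integral>\<^sup>+x. norm ((\<Sum>i\<in>H. g i x) - S x) powr p \<partial>M) \<longlongrightarrow> 0) (finite_subsets_at_top A)"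
  proof (rule order_tendstoI)
    fix e :: ennreal assume "0 < e"
    have "(\<lambda>n. 2 powr p * \<delta> n) \<longlonglongrightarrow> 0"
    proof (rule real_tendsto_sandwich[OF _ _ tendsto_const])
      show "(\<lambda>n. 2 powr p * (1 / 2) ^ n) \<longlonglongrightarrow> 0" by (intro tendsto_mult_right_zero LIMSEQ_power_zero) simp
      have "\<delta> n \<le> (1 / 2) ^ n * 1" for n
      proof -
        have "(1 / 2 :: real) ^ n \<le> 1" by (rule power_le_one) auto
        then show ?thesis unfolding \<delta>_def using p0 by (intro mult_left_mono powr_le1) auto
      qed
      then show "\<forall>\<^sub>F n in sequentially. 2 powr p * \<delta> n \<le> 2 powr p * (1 / 2) ^ n" by simp
    qed (use \<delta> in \<open>auto simp: less_imp_le\<close>)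
    then have "(\<lambda>n. ennreal (2 powr p * \<delta> n)) \<longlonglongrightarrow> 0" using tendsto_ennrealI by fastforce
    then have "\<forall>\<^sub>F n in sequentially. ennreal (2 powr p * \<delta> n) < e" using \<open>0 < e\<close> by (rule order_tendstoD)
    then obtain n where n: "ennreal (2 powr p * \<delta> n) < e" by (auto simp: eventually_sequentially)
    then show "\<forall>\<^sub>F H in finite_subsets_at_top A. (\<integral>\<^sup>+x. norm ((\<Sum>i\<in>H. g i x) - S x) powr p \<partial>M) < e"
      unfolding eventually_finite_subsets_at_top using F by (intro exI[of _ "F n"]) (auto intro!: le_less_trans[OF close n])
  qed auto
  with S_Lp S_B show thesis by (intro that[of S]) (auto simp: has_Lp_sum_def)
qed

section \<open>Vanishing of Haar projections up to small functions\<close>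

lemma nn_integral_norm_powr_add_less_top:
  assumes "(\<integral>\<^sup>+x. norm (u x) powr p \<partial>M) < \<infinity>" "(\<integral>\<^sup>+x. norm (v x) powr p \<partial>M) < \<infinity>"
    "strongly_measurable M u" "strongly_measurable M v" "1 \<le> p"
  shows "(\<integral>\<^sup>+x. norm (u x + v x) powr p \<partial>M) < \<infinity>"
  by (rule le_less_trans[OF nn_integral_norm_powr_add_le[OF assms(3,4,5)]])
    (use assms(1,2) in \<open>simp add: ennreal_mult_less_top\<close>)

lemma in_Lp_add: "in_Lp M p u \<Longrightarrow> in_Lp M p v \<Longrightarrow> 1 \<le> p \<Longrightarrow> in_Lp M p (\<lambda>x. u x + v x)"
  unfolding in_Lp_def using nn_integral_norm_powr_add_less_top[of M u p v] by (simp add: strongly_measurable_add)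

lemma in_Lp_uminus: "in_Lp M p u \<Longrightarrow> in_Lp M p (\<lambda>x. - u x)"
  using strongly_measurable_cmult[of M u "-1"] by (simp add: in_Lp_def)

lemma in_Lp_diff: "in_Lp M p u \<Longrightarrow> in_Lp M p v \<Longrightarrow> 1 \<le> p \<Longrightarrow> in_Lp M p (\<lambda>x. u x - v x)"
  using in_Lp_add[of M p u "\<lambda>x. - v x"] in_Lp_uminus[of M p v] by simp

lemma nn_integral_indicator_powr:
  fixes v :: "'e::real_normed_vector"
  assumes B: "B \<in> sets M" and p: "0 < p"
  shows "(\<integral>\<^sup>+x. norm (indicat_real B x *\<^sub>R v) powr p \<partial>M) = ennreal (norm v powr p) * emeasure M B"
proof -
  have "(\<integral>\<^sup>+x. norm (indicat_real B x *\<^sub>R v) powr p \<partial>M) = (\<integral>\<^sup>+x. ennreal (norm v powr p) * indicator B x \<partial>M)"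
    using p by (intro nn_integral_cong) (auto simp: indicator_def)
  then show ?thesis using B by (simp add: nn_integral_cmult_indicator)
qed

lemma in_Lp_indicator:
  assumes B: "B \<in> sets M" "emeasure M B < \<infinity>" and p: "0 < p"
  shows "in_Lp M p (\<lambda>x. indicat_real B x *\<^sub>R v)"
  unfolding in_Lp_def nn_integral_indicator_powr[OF B(1) p]
  using B by (auto intro!: strongly_measurable_set strongly_measurable_const simp: ennreal_mult_less_top)

context dyadic_levels
begin

lemma average_add:
  fixes u v :: "real ^ 'd \<Rightarrow> 'e::banach"
  assumes u: "in_Lp lebesgue p u" and v: "in_Lp lebesgue p v" and p: "1 \<le> p" and J: "J \<in> G k"
  shows "average J (\<lambda>x. u x + v x) = average J u + average J v"
proof -
  have "strongly_integrable lebesgue (\<lambda>x. indicat_real J x *\<^sub>R u x)" "strongly_integrable lebesgue (\<lambda>x. indicat_real J x *\<^sub>R v x)"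
    using u v by (auto intro!: in_Lp_strongly_integrable_set[OF _ p cube_sets[OF J] emeasure_cube_finite[OF J]])
  from strongly_integrable_linear(2)[OF this, of 1 1] show ?thesis
    by (simp add: average_def set_strong_integral_def scaleR_add_right)
qed

lemma haar_proj_level_add:
  fixes u v :: "real ^ 'd \<Rightarrow> 'e::banach"
  assumes "in_Lp lebesgue p u" "in_Lp lebesgue p v" "1 \<le> p" "K \<in> G k"
  shows "haar_proj_level (\<Union>k. G k) i K (\<lambda>x. u x + v x) x
    = haar_proj_level (\<Union>k. G k) i K u x + haar_proj_level (\<Union>k. G k) i K v x"
  unfolding haar_proj_level_eq[OF assms(4)] average_add[OF assms(1-3) cb_in] by (simp add: algebra_simps)

definition haar_agree :: "nat \<Rightarrow> (real ^ 'd) set set \<Rightarrow> (real ^ 'd \<Rightarrow> 'e::banach) \<Rightarrow> (real ^ 'd \<Rightarrow> 'e) \<Rightarrow> bool" where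
  "haar_agree i F0 f r \<longleftrightarrow> finite F0 \<and> F0 \<subseteq> (\<Union>k. G k) \<and>
     (\<forall>K\<in>(\<Union>k. G k) - F0. \<forall>x. haar_proj_level (\<Union>k. G k) i K f x = haar_proj_level (\<Union>k. G k) i K r x)"

lemma haar_agreeD: "haar_agree i F0 f r \<Longrightarrow> K \<in> (\<Union>k. G k) - F0 \<Longrightarrow>
    haar_proj_level (\<Union>k. G k) i K f x = haar_proj_level (\<Union>k. G k) i K r x"
  by (simp add: haar_agree_def)

text \<open>Asking for finitely many nonzero Haar projections would exclude indicators of cubes,
  which have nonzero projections along all ancestors. Trading \<open>f\<close> for a small function
  outside finitely many cubes is enough, since a shift term sees \<open>f\<close> only through its
  projection.\<close>

definition haar_negligible :: "real \<Rightarrow> nat \<Rightarrow> (real ^ 'd \<Rightarrow> 'e::banach) \<Rightarrow> bool" where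
  "haar_negligible p i f \<longleftrightarrow> in_Lp lebesgue p f \<and> (\<forall>\<delta>>0. \<exists>r F0. in_Lp lebesgue p r \<and>
     (\<integral>\<^sup>+x. norm (r x) powr p \<partial>lebesgue) \<le> ennreal \<delta> \<and> haar_agree i F0 f r)"

lemma haar_negligibleD:
  "haar_negligible p i f \<Longrightarrow> 0 < \<delta> \<Longrightarrow> \<exists>r F0. in_Lp lebesgue p r \<and>
     (\<integral>\<^sup>+x. norm (r x) powr p \<partial>lebesgue) \<le> ennreal \<delta> \<and> haar_agree i F0 f r"
  by (simp add: haar_negligible_def)

text \<open>The remainder f - g is itself small and is simply added to the small substitute of g.
  Negligibility is therefore stable under approximation in L^p.\<close>

lemma haar_negligible_perturb:
  fixes f g :: "real ^ 'd \<Rightarrow> 'e::banach"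
  assumes p: "1 \<le> p" and f: "in_Lp lebesgue p f"
    and approx: "\<And>\<delta>. 0 < \<delta> \<Longrightarrow> \<exists>g. haar_negligible p i g \<and> (\<integral>\<^sup>+x. norm (f x - g x) powr p \<partial>lebesgue) \<le> ennreal \<delta>"
  shows "haar_negligible p i f"
  unfolding haar_negligible_def
proof (intro conjI allI impI f)
  fix \<delta> :: real assume \<delta>: "0 < \<delta>"
  \<comment> \<open>Two terms of this size, multiplied by \<open>2 powr (p - 1)\<close>, add up to
    \<delta>.\<close>
  let ?\<delta> = "\<delta> / 2 powr p"
  have \<delta>': "0 < ?\<delta>" using \<delta> by simp
  obtain g where g: "haar_negligible p i g" "(\<integral>\<^sup>+x. norm (f x - g x) powr p \<partial>lebesgue) \<le> ennreal ?\<delta>"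
    using approx[OF \<delta>'] by blast
  have gL: "in_Lp lebesgue p g" using g(1) by (simp add: haar_negligible_def)
  obtain r F0 where r: "in_Lp lebesgue p r" "(\<integral>\<^sup>+x. norm (r x) powr p \<partial>lebesgue) \<le> ennreal ?\<delta>"
    and F0: "haar_agree i F0 g r"
    using haar_negligibleD[OF g(1) \<delta>'] by blast
  have d: "in_Lp lebesgue p (\<lambda>x. f x - g x)" by (rule in_Lp_diff[OF f gL p])
  have sum: "in_Lp lebesgue p (\<lambda>x. (f x - g x) + r x)" by (rule in_Lp_add[OF d r(1) p])
  have "(\<integral>\<^sup>+x. norm ((f x - g x) + r x) powr p \<partial>lebesgue)
      \<le> ennreal (2 powr (p - 1)) * ((\<integral>\<^sup>+x. norm (f x - g x) powr p \<partial>lebesgue) + (\<integral>\<^sup>+x. norm (r x) powr p \<partial>lebesgue))"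
    using d r(1) by (intro nn_integral_norm_powr_add_le p) (auto simp: in_Lp_def)
  also have "\<dots> \<le> ennreal (2 powr (p - 1)) * (ennreal ?\<delta> + ennreal ?\<delta>)"
    by (intro mult_left_mono add_mono g r) simp
  also have "\<dots> = ennreal \<delta>"
    using \<delta> by (simp add: powr_diff flip: ennreal_plus ennreal_mult')
  finally have small: "(\<integral>\<^sup>+x. norm ((f x - g x) + r x) powr p \<partial>lebesgue) \<le> ennreal \<delta>" .
  have "haar_proj_level (\<Union>k. G k) i K f x = haar_proj_level (\<Union>k. G k) i K (\<lambda>x. (f x - g x) + r x) x"
    if K: "K \<in> (\<Union>k. G k) - F0" for K x
  proof -
    obtain k where k: "K \<in> G k" using K by blast
    have "haar_proj_level (\<Union>k. G k) i K (\<lambda>x. (f x - g x) + g x) x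
      = haar_proj_level (\<Union>k. G k) i K (\<lambda>x. f x - g x) x + haar_proj_level (\<Union>k. G k) i K g x"
      by (rule haar_proj_level_add[OF d gL p k])
    also have "\<dots> = haar_proj_level (\<Union>k. G k) i K (\<lambda>x. (f x - g x) + r x) x"
      unfolding haar_proj_level_add[OF d r(1) p k] haar_agreeD[OF F0 K] ..
    finally show ?thesis by simp
  qed
  then have "haar_agree i F0 f (\<lambda>x. (f x - g x) + r x)" using F0 by (simp add: haar_agree_def)
  with sum small show "\<exists>r F0. in_Lp lebesgue p r \<and> (\<integral>\<^sup>+x. norm (r x) powr p \<partial>lebesgue) \<le> ennreal \<delta> \<and> haar_agree i F0 f r"
    by (intro exI conjI)
qed

lemma haar_negligible_add:
  fixes u v :: "real ^ 'd \<Rightarrow> 'e::banach"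
  assumes p: "1 \<le> p" and u: "haar_negligible p i u" and v: "haar_negligible p i v"
  shows "haar_negligible p i (\<lambda>x. u x + v x)"
  unfolding haar_negligible_def
proof (intro conjI allI impI)
  have uL: "in_Lp lebesgue p u" and vL: "in_Lp lebesgue p v" using u v by (auto simp: haar_negligible_def)
  then show "in_Lp lebesgue p (\<lambda>x. u x + v x)" by (rule in_Lp_add[OF _ _ p])
  fix \<delta> :: real assume \<delta>: "0 < \<delta>"
  let ?\<delta> = "\<delta> / 2 powr p"
  have \<delta>': "0 < ?\<delta>" using \<delta> by simp
  obtain r F where r: "in_Lp lebesgue p r" "(\<integral>\<^sup>+x. norm (r x) powr p \<partial>lebesgue) \<le> ennreal ?\<delta>"
    and F: "haar_agree i F u r"
    using haar_negligibleD[OF u \<delta>'] by blast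
  obtain r' F' where r': "in_Lp lebesgue p r'" "(\<integral>\<^sup>+x. norm (r' x) powr p \<partial>lebesgue) \<le> ennreal ?\<delta>"
    and F': "haar_agree i F' v r'"
    using haar_negligibleD[OF v \<delta>'] by blast
  have "(\<integral>\<^sup>+x. norm (r x + r' x) powr p \<partial>lebesgue)
      \<le> ennreal (2 powr (p - 1)) * ((\<integral>\<^sup>+x. norm (r x) powr p \<partial>lebesgue) + (\<integral>\<^sup>+x. norm (r' x) powr p \<partial>lebesgue))"
    using r' r by (intro nn_integral_norm_powr_add_le p) (auto simp: in_Lp_def)
  also have "\<dots> \<le> ennreal (2 powr (p - 1)) * (ennreal ?\<delta> + ennreal ?\<delta>)"
    by (intro mult_left_mono add_mono r r') simp
  also have "\<dots> = ennreal \<delta>"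
    using \<delta> by (simp add: powr_diff flip: ennreal_plus ennreal_mult')
  finally have small: "(\<integral>\<^sup>+x. norm (r x + r' x) powr p \<partial>lebesgue) \<le> ennreal \<delta>" .
  have "haar_proj_level (\<Union>k. G k) i K (\<lambda>x. u x + v x) x = haar_proj_level (\<Union>k. G k) i K (\<lambda>x. r x + r' x) x"
    if K: "K \<in> (\<Union>k. G k) - (F \<union> F')" for K x
  proof -
    obtain k where k: "K \<in> G k" using K by blast
    have "K \<in> (\<Union>k. G k) - F" "K \<in> (\<Union>k. G k) - F'" using K by auto
    then show ?thesis
      unfolding haar_proj_level_add[OF uL vL p k] haar_proj_level_add[OF r(1) r'(1) p k] by (simp only: haar_agreeD[OF F] haar_agreeD[OF F'])
  qed
  then have "haar_agree i (F \<union> F') (\<lambda>x. u x + v x) (\<lambda>x. r x + r' x)" using F F' by (simp add: haar_agree_def)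
  with in_Lp_add[OF r(1) r'(1) p] small show "\<exists>r F0. in_Lp lebesgue p r \<and> (\<integral>\<^sup>+x. norm (r x) powr p \<partial>lebesgue) \<le> ennreal \<delta> \<and>
      haar_agree i F0 (\<lambda>x. u x + v x) r"
    by (intro exI conjI)
qed

lemma haar_negligible_zero:
  assumes p: "1 \<le> p"
  shows "haar_negligible p i (\<lambda>x. 0)"
proof -
  have "in_Lp lebesgue p (\<lambda>x :: real ^ 'd. 0 :: 'e::banach)" using p by (simp add: in_Lp_def strongly_measurable_const)
  then show ?thesis unfolding haar_negligible_def using p
    by (intro conjI allI impI exI[of _ "\<lambda>x. 0"] exI[of _ "{}"]) (auto simp: haar_agree_def)
qed

lemma haar_negligible_sum:
  fixes u :: "'i \<Rightarrow> real ^ 'd \<Rightarrow> 'e::banach"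
  assumes p: "1 \<le> p" and "finite I" "\<And>l. l \<in> I \<Longrightarrow> haar_negligible p i (u l)"
  shows "haar_negligible p i (\<lambda>x. \<Sum>l\<in>I. u l x)"
  using assms(2,3) by (induction I rule: finite_induct) (auto intro: haar_negligible_zero haar_negligible_add p)

section \<open>Indicators, simple functions and density\<close>

lemma average_indicator:
  fixes v :: "'e::banach"
  assumes J: "J \<in> G l" and B: "B \<in> sets lebesgue"
  shows "average J (\<lambda>x. indicat_real B x *\<^sub>R v) = (measure lebesgue (J \<inter> B) / vol l) *\<^sub>R v"
proof -
  have "emeasure lebesgue (J \<inter> B) \<le> emeasure lebesgue J" using cube_sets[OF J] by (intro emeasure_mono) auto
  then have fin: "emeasure lebesgue (J \<inter> B) < \<infinity>" using emeasure_cube_finite[OF J] by (rule le_less_trans)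
  have "(\<lambda>x. indicat_real J x *\<^sub>R indicat_real B x *\<^sub>R v) = (\<lambda>x. indicat_real (J \<inter> B) x *\<^sub>R v)"
    by (auto simp: indicator_def fun_eq_iff)
  then show ?thesis
    using has_strong_integral_indicator(2)[OF sets.Int[OF cube_sets[OF J] B] fin, of v]
    by (simp add: average_def set_strong_integral_def measure_cube[OF J])
qed

lemma average_indicator_fine:
  fixes v :: "'e::banach"
  assumes B: "B \<in> G k" and l: "k \<le> l"
  shows "average (cb l x) (\<lambda>x. indicat_real B x *\<^sub>R v) = indicat_real B x *\<^sub>R v"
proof (cases "x \<in> B")
  case True
  then have "cb l x \<inter> B = cb l x" using subset_cb[OF B True l] by blast
  then show ?thesis using True measure_cube[OF cb_in, of l x] vol_pos[of l]
    by (simp add: average_indicator[OF cb_in cube_sets[OF B]])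
next
  case False
  have "cb l x \<inter> B = {}"
  proof (rule ccontr)
    assume "cb l x \<inter> B \<noteq> {}"
    then obtain y where y: "y \<in> cb l x" "y \<in> B" by blast
    then have "cb l x = cb l y" using cb_eq by simp
    then have "cb l x \<subseteq> B" using subset_cb[OF B y(2) l] by simp
    then show False using False mem_cb by blast
  qed
  then show ?thesis using False by (simp add: average_indicator[OF cb_in cube_sets[OF B]])
qed

text \<open>A coarse cube contains the given one or is disjoint from it, so only the position of
  \<open>b\<close> and volumes matter. Hence spreading mass evenly over an ancestor leaves coarser
  averages unchanged.\<close>

lemma average_indicator_coarse:
  fixes v :: "'e::banach"
  assumes l: "l \<le> k"
  shows "average (cb l x) (\<lambda>x. indicat_real (cb k b) x *\<^sub>R v) = (indicat_real (cb l x) b * vol k / vol l) *\<^sub>R v"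
proof (cases "b \<in> cb l x")
  case True
  then have "cb k b \<subseteq> cb l x" using subset_cb[OF cb_in True l] by blast
  then have "cb l x \<inter> cb k b = cb k b" by blast
  then show ?thesis using True measure_cube[OF cb_in, of k b]
    by (simp add: average_indicator[OF cb_in cube_sets[OF cb_in]])
next
  case False
  have "cb l x \<inter> cb k b = {}"
  proof (rule ccontr)
    assume "cb l x \<inter> cb k b \<noteq> {}"
    then obtain y where y: "y \<in> cb l x" "y \<in> cb k b" by blast
    then have "b \<in> cb l y" using cb_mono[OF l, of y] cb_eq[OF y(2)] mem_cb by blast
    then show False using False cb_eq[OF y(1)] by simp
  qed
  then show ?thesis using False by (simp add: average_indicator[OF cb_in cube_sets[OF cb_in]])
qed

lemma finite_meeting:
  assumes Q: "Q \<in> G k"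
  shows "finite {K \<in> G l. K \<inter> Q \<noteq> {}}"
proof (cases "k \<le> l")
  case True
  have "{K \<in> G l. K \<inter> Q \<noteq> {}} \<subseteq> desc (nat (l - k)) k Q"
  proof
    fix K assume "K \<in> {K \<in> G l. K \<inter> Q \<noteq> {}}"
    then obtain x where "K \<in> G l" "x \<in> K" "x \<in> Q" by blast
    then show "K \<in> desc (nat (l - k)) k Q" using desc_iff[OF Q] cb_unique[of K l x] True by auto
  qed
  then show ?thesis using finite_desc[OF Q] by (rule finite_subset)
next
  case False
  have "{K \<in> G l. K \<inter> Q \<noteq> {}} \<subseteq> {cb l (point Q)}"
  proof
    fix K assume "K \<in> {K \<in> G l. K \<inter> Q \<noteq> {}}"
    then obtain x where x: "K \<in> G l" "x \<in> K" "x \<in> Q" by blast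
    then have "Q \<subseteq> K" using subset_cb[OF x(1,2), of k] cb_unique[OF Q x(3)] False by simp
    then show "K \<in> {cb l (point Q)}" using point_in[OF Q] cb_unique[OF x(1)] by blast
  qed
  then show ?thesis by (rule finite_subset) simp
qed

text \<open>The indicator is replaced by its average over the ancestor Q that lies n levels up.
  Coarse averages agree, the p-th power of the norm decays like \<open>q ^ n\<close> because
  spreading mass lowers it when p > 1, and projections differ only for cubes meeting Q at finitely
  many levels.\<close>

lemma haar_negligible_cube:
  fixes v :: "'e::banach"
  assumes p: "1 < p" and B: "B \<in> G k"
  shows "haar_negligible p i (\<lambda>x. indicat_real B x *\<^sub>R v)"
  unfolding haar_negligible_def
proof (intro conjI allI impI)
  have p0: "0 < p" using p by simp
  show "in_Lp lebesgue p (\<lambda>x. indicat_real B x *\<^sub>R v)"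
    by (rule in_Lp_indicator[OF cube_sets[OF B] emeasure_cube_finite[OF B] p0])
  fix \<delta> :: real assume \<delta>: "0 < \<delta>"
  \<comment> \<open>Going up one level divides the height by \<open>2 ^ CARD('d)\<close> and
    multiplies the volume by the same number, so the p-th power of the norm changes by this
    factor.\<close>
  define q where "q = (2 ^ CARD('d)) powr (1 - p)"
  have q: "0 < q" "q < 1"
  proof -
    have "(2::real) ^ CARD('d) > 1" by (rule one_less_power) auto
    then have "(2 ^ CARD('d)) powr (1 - p) < (2 ^ CARD('d)) powr (0::real)" using p by (intro powr_less_mono) auto
    then show "q < 1" by (simp add: q_def)
  qed (simp add: q_def)
  have "(\<lambda>n. norm v powr p * vol k * q ^ n) \<longlonglongrightarrow> 0"
    using q by (intro tendsto_mult_right_zero LIMSEQ_power_zero) simp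
  then have "\<forall>\<^sub>F n in sequentially. norm v powr p * vol k * q ^ n < \<delta>" using \<delta> by (rule order_tendstoD)
  then obtain n where n: "norm v powr p * vol k * q ^ n < \<delta>" by (auto simp: eventually_sequentially)
  define k' b Q where "k' = k - int n" and "b = point B" and "Q = cb k' b"
  have B_eq: "B = cb k b" using cb_unique[OF B point_in[OF B]] by (simp add: b_def)
  have Q: "Q \<in> G k'" by (simp add: Q_def cb_in)
  have k': "k' \<le> k" by (simp add: k'_def)
  define c where "c = vol k / vol k'"
  have vol: "vol k' = (2 ^ CARD('d)) ^ n * vol k"
    using vol_add[of k' n] by (simp add: k'_def power_mult)
  have c_eq: "c = 1 / (2 ^ CARD('d)) ^ n" unfolding c_def vol using vol_pos[of k] by simp
  define r where "r x = indicat_real Q x *\<^sub>R (c *\<^sub>R v)" for x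
  have r_Lp: "in_Lp lebesgue p r"
    unfolding r_def[abs_def] by (rule in_Lp_indicator[OF cube_sets[OF Q] emeasure_cube_finite[OF Q] p0])
  have "(\<integral>\<^sup>+x. norm (r x) powr p \<partial>lebesgue) = ennreal (norm (c *\<^sub>R v) powr p) * ennreal (vol k')"
    unfolding r_def nn_integral_indicator_powr[OF cube_sets[OF Q] p0] emeasure_cube[OF Q] ..
  also have "\<dots> = ennreal (norm v powr p * vol k * q ^ n)"
  proof -
    have c0: "0 < c" using vol_pos by (simp add: c_def)
    let ?b = "(2 ^ CARD('d)) ^ n :: real"
    have "norm (c *\<^sub>R v) powr p * vol k' = norm v powr p * vol k * (c powr p * ?b)"
      using c0 unfolding vol by (simp add: powr_mult mult_ac)
    also have "c powr p = ?b powr (- p)" unfolding c_eq by (simp add: powr_divide powr_minus_divide)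
    also have "?b powr (- p) * ?b = ?b powr (1 - p)"
      using powr_add[of ?b "- p" 1] by simp
    also have "\<dots> = q ^ n"
      by (simp add: q_def powr_power powr_powr flip: powr_realpow) (simp add: mult_ac powr_powr flip: powr_realpow)
    finally show ?thesis using vol_pos[of k'] by (simp flip: ennreal_mult')
  qed
  also have "\<dots> \<le> ennreal \<delta>" using n by (intro ennreal_leI) simp
  finally have small: "(\<integral>\<^sup>+x. norm (r x) powr p \<partial>lebesgue) \<le> ennreal \<delta>" .
  \<comment> \<open>The range covers every level at which a projection of order i compares averages
    at scales between k' and k. At such levels, cubes disjoint from Q see both functions as
    0.\<close>
  define F0 where "F0 = (\<Union>l\<in>{k' - int i..k}. {K \<in> G l. K \<inter> Q \<noteq> {}})"
  have F0: "finite F0" "F0 \<subseteq> (\<Union>k. G k)" unfolding F0_def using finite_meeting[OF Q] by auto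
  have coarse: "average (cb l x) (\<lambda>x. indicat_real B x *\<^sub>R v) = average (cb l x) r" if l: "l \<le> k'" for l x
  proof -
    have "average (cb l x) r = (indicat_real (cb l x) b * vol k' / vol l) *\<^sub>R c *\<^sub>R v"
      unfolding r_def[abs_def] Q_def by (rule average_indicator_coarse[OF l])
    also have "\<dots> = (indicat_real (cb l x) b * vol k / vol l) *\<^sub>R v" using vol_pos[of k'] by (simp add: c_def)
    also have "\<dots> = average (cb l x) (\<lambda>x. indicat_real B x *\<^sub>R v)"
      unfolding B_eq using l k' by (intro average_indicator_coarse[symmetric]) simp
    finally show ?thesis by simp
  qed
  have fine: "average (cb l x) (\<lambda>x. indicat_real B x *\<^sub>R v) = indicat_real B x *\<^sub>R v" if "k \<le> l" for l x
    by (rule average_indicator_fine[OF B that])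
  have fine_r: "average (cb l x) r = r x" if "k' \<le> l" for l x
    unfolding r_def[abs_def] by (rule average_indicator_fine[OF Q that])
  have off: "average (cb l x) (\<lambda>x. indicat_real B x *\<^sub>R v) = 0" if "k' \<le> l" "x \<notin> Q" for l x
  proof -
    have "cb l x \<inter> Q = {}"
      using that subset_cb[OF Q, of _ l] cb_eq[of _ l x] mem_cb[of x l] by blast
    moreover have "B \<subseteq> Q" unfolding B_eq Q_def by (rule cb_mono[OF k'])
    ultimately have "cb l x \<inter> B = {}" by blast
    then show ?thesis by (simp add: average_indicator[OF cb_in cube_sets[OF B]])
  qed
  have "haar_proj_level (\<Union>k. G k) i K (\<lambda>x. indicat_real B x *\<^sub>R v) x = haar_proj_level (\<Union>k. G k) i K r x"
    if K: "K \<in> (\<Union>k. G k) - F0" for K x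
  proof -
    obtain l where l: "K \<in> G l" using K by blast
    consider "l + int i + 1 \<le> k'" | "k \<le> l + int i" "k' \<le> l + int i" | "k' \<le> l + int i" "l + int i < k"
      using k' by linarith
    then show ?thesis
    proof cases
      case 1 then show ?thesis unfolding haar_proj_level_eq[OF l] by (simp add: coarse)
    next
      case 2 then show ?thesis unfolding haar_proj_level_eq[OF l] by (simp add: fine fine_r)
    next
      case 3
      show ?thesis
      proof (cases "x \<in> K")
        case True
        have "x \<notin> Q"
        proof
          assume "x \<in> Q"
          then have "K \<in> F0" unfolding F0_def using l True 3 by auto
          then show False using K by simp
        qed
        then show ?thesis unfolding haar_proj_level_eq[OF l] using 3 off[of _ x] fine_r[of _ x] by (simp add: r_def)
      qed (simp add: haar_proj_level_eq[OF l])
    qed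
  qed
  then have "haar_agree i F0 (\<lambda>x. indicat_real B x *\<^sub>R v) r" using F0 by (simp add: haar_agree_def)
  with r_Lp small show "\<exists>r F0. in_Lp lebesgue p r \<and> (\<integral>\<^sup>+x. norm (r x) powr p \<partial>lebesgue) \<le> ennreal \<delta> \<and>
      haar_agree i F0 (\<lambda>x. indicat_real B x *\<^sub>R v) r"
    by (intro exI conjI)
qed


lemma cb_diameter: "y \<in> cb k x \<Longrightarrow> dist y x \<le> CARD('d) * 2 powi (- k)"
proof -
  assume y: "y \<in> cb k x"
  obtain b where b: "cb k x = half_open_cube b (2 powi (- k))" using cube[OF cb_in] by blast
  have "\<bar>(y - x) $ i\<bar> \<le> 2 powi (- k)" for i
  proof -
    have "x \<in> half_open_cube b (2 powi (- k))" "y \<in> half_open_cube b (2 powi (- k))" using y mem_cb b by auto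
    then have "b $ i \<le> x $ i" "x $ i < b $ i + 2 powi (- k)" "b $ i \<le> y $ i" "y $ i < b $ i + 2 powi (- k)"
      by (auto simp: half_open_cube_def)
    then show ?thesis by (simp add: abs_le_iff)
  qed
  then have "(\<Sum>i\<in>UNIV. \<bar>(y - x) $ i\<bar>) \<le> (\<Sum>i\<in>(UNIV :: 'd set). 2 powi (- k))" by (rule sum_mono)
  then show ?thesis using norm_le_l1_cart[of "y - x"] by (simp add: dist_norm)
qed

definition inner_cubes :: "(real ^ 'd) set \<Rightarrow> nat \<Rightarrow> (real ^ 'd) set set" where
  "inner_cubes U n = {Q \<in> G (int n). Q \<subseteq> U}"

lemma incseq_inner_cubes: "incseq (\<lambda>n. \<Union> (inner_cubes U n))"
proof (rule incseq_SucI)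
  fix n
  show "\<Union> (inner_cubes U n) \<subseteq> \<Union> (inner_cubes U (Suc n))"
  proof
    fix x assume "x \<in> \<Union> (inner_cubes U n)"
    then obtain Q where Q: "Q \<in> G (int n)" "Q \<subseteq> U" "x \<in> Q" by (auto simp: inner_cubes_def)
    then have "cb (int (Suc n)) x \<subseteq> U" using subset_cb[OF Q(1,3), of "int (Suc n)"] by auto
    then show "x \<in> \<Union> (inner_cubes U (Suc n))" using cb_in mem_cb by (fastforce simp: inner_cubes_def)
  qed
qed

text \<open>Cubes of level n have diameter at most \<open>CARD('d)\<close> times 2^-n, so the cube
  around a point of an open set is eventually contained in it.\<close>

lemma Union_inner_cubes:
  assumes "open U"
  shows "(\<Union>n. \<Union> (inner_cubes U n)) = U"
proof (intro subset_antisym subsetI)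
  fix x assume x: "x \<in> U"
  obtain e where e: "0 < e" "ball x e \<subseteq> U" using assms x openE by blast
  have "(\<lambda>n. CARD('d) * (1 / 2) ^ n) \<longlonglongrightarrow> (0::real)"
    by (intro tendsto_mult_right_zero LIMSEQ_power_zero) simp
  then have "\<forall>\<^sub>F n in sequentially. CARD('d) * (1 / 2) ^ n < e" using e(1) by (rule order_tendstoD)
  then obtain n :: nat where n: "CARD('d) * (1 / 2) ^ n < e" by (auto simp: eventually_sequentially)
  have "cb (int n) x \<subseteq> U"
  proof
    fix y assume "y \<in> cb (int n) x"
    then have "dist y x \<le> CARD('d) * 2 powi (- int n)" by (rule cb_diameter)
    also have "\<dots> = CARD('d) * (1 / 2) ^ n" by (simp add: power_int_minus power_one_over inverse_eq_divide)
    finally show "y \<in> U" using n e(2) by (auto simp: dist_commute)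
  qed
  then show "x \<in> (\<Union>n. \<Union> (inner_cubes U n))" using cb_in mem_cb by (fastforce simp: inner_cubes_def)
qed (auto simp: inner_cubes_def)

lemma finite_inner_cubes:
  assumes "U \<in> sets lebesgue" "emeasure lebesgue U < \<infinity>"
  shows "finite (inner_cubes U n)"
proof (rule finite_if_finite_subsets_card_bdd[THEN conjunct1])
  fix F assume F: "F \<subseteq> inner_cubes U n" "finite F"
  have F': "F \<subseteq> G (int n)" "\<Union> F \<subseteq> U" using F by (auto simp: inner_cubes_def)
  have "ennreal (card F * vol (int n)) \<le> emeasure lebesgue U"
    unfolding measure_Union_level[OF F(2) F'(1), symmetric] by (rule emeasure_mono[OF F'(2) assms(1)])
  also have "\<dots> = ennreal (measure lebesgue U)" using assms(2) by (simp add: emeasure_eq_ennreal_measure less_top)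
  finally have "card F * vol (int n) \<le> measure lebesgue U" by (simp add: ennreal_le_iff)
  then have "real (card F) \<le> measure lebesgue U / vol (int n)" using vol_pos[of "int n"] by (simp add: pos_le_divide_eq)
  then show "card F \<le> nat \<lceil>measure lebesgue U / vol (int n)\<rceil>" by linarith
qed

text \<open>\<open>B\<close> is approximated from outside by an open set U of finite measure, and U
  from inside by a finite union of disjoint cubes of one level. The error is supported in two sets
  of small measure.\<close>

lemma haar_negligible_set:
  fixes v :: "'e::banach"
  assumes p: "1 < p" and B: "B \<in> sets lebesgue" "emeasure lebesgue B < \<infinity>"
  shows "haar_negligible p i (\<lambda>x. indicat_real B x *\<^sub>R v)"
proof (rule haar_negligible_perturb)
  have p0: "0 < p" using p by simp
  show "1 \<le> p" using p by simp
  show "in_Lp lebesgue p (\<lambda>x. indicat_real B x *\<^sub>R v)" by (rule in_Lp_indicator[OF B p0])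
  fix \<delta> :: real assume \<delta>: "0 < \<delta>"
  \<comment> \<open>Makes \<open>norm v powr p * (2 * e)\<close> at most \<delta>; the summand 1
    covers v = 0.\<close>
  define e where "e = \<delta> / (2 * (norm v powr p + 1))"
  have v1: "0 < norm v powr p + 1" by (simp add: add_nonneg_pos)
  have e: "0 < e" using \<delta> v1 by (simp add: e_def)
  obtain U where U: "open U" "B \<subseteq> U" "U - B \<in> lmeasurable" "emeasure lebesgue (U - B) < ennreal e"
    using sets_lebesgue_outer_open[OF B(1) e] by metis
  have "U \<in> sets lborel" using U(1) by simp
  then have Us: "U \<in> sets lebesgue" by (rule sets_completionI_sets)
  have "emeasure lebesgue (B \<union> (U - B)) \<le> emeasure lebesgue B + emeasure lebesgue (U - B)"
    by (rule emeasure_subadditive[OF B(1) sets.Diff[OF Us B(1)]])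
  also have "B \<union> (U - B) = U" using U(2) by blast
  also have "emeasure lebesgue B + emeasure lebesgue (U - B) < \<infinity>"
  proof -
    have "emeasure lebesgue (U - B) < \<infinity>" by (rule less_trans[OF U(4)]) simp
    then show ?thesis using B(2) by simp
  qed
  finally have Ufin: "emeasure lebesgue U < \<infinity>" .
  define A where "A n = \<Union> (inner_cubes U n)" for n
  note fin = finite_inner_cubes[OF Us Ufin]
  have As: "A n \<in> sets lebesgue" for n
    unfolding A_def using fin cube_sets by (intro sets.finite_Union) (auto simp: inner_cubes_def)
  have AU: "A n \<subseteq> U" for n by (auto simp: A_def inner_cubes_def)
  have A_lim: "(\<lambda>n. emeasure lebesgue (A n)) \<longlonglongrightarrow> emeasure lebesgue U"
  proof -
    have "(\<lambda>n. emeasure lebesgue (A n)) \<longlonglongrightarrow> emeasure lebesgue (\<Union>n. A n)"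
      by (rule Lim_emeasure_incseq) (use As incseq_inner_cubes in \<open>auto simp: A_def[abs_def]\<close>)
    also have "(\<Union>n. A n) = U" unfolding A_def by (rule Union_inner_cubes[OF U(1)])
    finally show ?thesis .
  qed
  have Afin: "emeasure lebesgue (A n) \<noteq> \<infinity>" for n
  proof -
    have "emeasure lebesgue (A n) \<le> emeasure lebesgue U" by (rule emeasure_mono[OF AU Us])
    then have "emeasure lebesgue (A n) < \<infinity>" using Ufin by (rule le_less_trans)
    then show ?thesis by simp
  qed
  have "\<exists>n. emeasure lebesgue (U - A n) \<le> ennreal e"
  proof -
    have lim: "(\<lambda>n. emeasure lebesgue U - emeasure lebesgue (A n)) \<longlonglongrightarrow> emeasure lebesgue U - emeasure lebesgue U"
      by (rule tendsto_diff_ennreal[OF tendsto_const A_lim]) (use Ufin in auto)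
    have "emeasure lebesgue U - emeasure lebesgue U < ennreal e" using e Ufin by simp
    from order_tendstoD(2)[OF lim this]
    obtain n where n: "emeasure lebesgue U - emeasure lebesgue (A n) < ennreal e" by (auto simp: eventually_sequentially)
    have "emeasure lebesgue (U - A n) = emeasure lebesgue U - emeasure lebesgue (A n)"
      by (rule emeasure_Diff[OF Afin Us As AU])
    then show ?thesis using n by (intro exI[of _ n]) simp
  qed
  then obtain n where n: "emeasure lebesgue (U - A n) \<le> ennreal e" by blast
  have ind: "indicat_real (A n) x = (\<Sum>Q\<in>inner_cubes U n. indicat_real Q x)" for x
  proof -
    have "disjoint_family_on (\<lambda>Q. Q) (inner_cubes U n)"
      using disjoint_level by (auto simp: disjoint_family_on_def inner_cubes_def)
    from indicator_UN_disjoint[OF fin this] show ?thesis by (simp add: A_def)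
  qed
  have "haar_negligible p i (\<lambda>x. \<Sum>Q\<in>inner_cubes U n. indicat_real Q x *\<^sub>R v)"
    using p by (intro haar_negligible_sum fin haar_negligible_cube[of _ _ "int n"]) (auto simp: inner_cubes_def)
  then have neg: "haar_negligible p i (\<lambda>x. indicat_real (A n) x *\<^sub>R v)"
    unfolding ind scaleR_sum_left .
  have "(\<integral>\<^sup>+x. norm (indicat_real B x *\<^sub>R v - indicat_real (A n) x *\<^sub>R v) powr p \<partial>lebesgue)
      \<le> (\<integral>\<^sup>+x. norm (indicat_real ((U - B) \<union> (U - A n)) x *\<^sub>R v) powr p \<partial>lebesgue)"
    using U(2) AU p0 by (intro nn_integral_mono ennreal_leI) (auto simp: indicator_def)
  also have "\<dots> = ennreal (norm v powr p) * emeasure lebesgue ((U - B) \<union> (U - A n))"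
    using Us As B by (intro nn_integral_indicator_powr p0) auto
  also have "\<dots> \<le> ennreal (norm v powr p) * (emeasure lebesgue (U - B) + emeasure lebesgue (U - A n))"
    using Us As B by (intro mult_left_mono emeasure_subadditive) auto
  also have "\<dots> \<le> ennreal (norm v powr p) * (ennreal e + ennreal e)"
    using U(4) n by (intro mult_left_mono add_mono) auto
  also have "\<dots> = ennreal (norm v powr p * (2 * e))" using e by (simp flip: ennreal_plus ennreal_mult')
  also have "norm v powr p * (2 * e) \<le> (norm v powr p + 1) * (2 * e)" using e by (intro mult_right_mono) auto
  also have "(norm v powr p + 1) * (2 * e) = \<delta>"
    using v1 unfolding e_def by (simp only: times_divide_eq_right) (simp add: field_simps)
  finally show "\<exists>g. haar_negligible p i g \<and> (\<integral>\<^sup>+x. norm (indicat_real B x *\<^sub>R v - g x) powr p \<partial>lebesgue) \<le> ennreal \<delta>"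
    using neg by (intro exI[of _ "\<lambda>x. indicat_real (A n) x *\<^sub>R v"]) (simp add: ennreal_leI)
qed

text \<open>Only nonzero values contribute, and their level sets have finite measure because the
  p-th power of the norm is integrable.\<close>

lemma haar_negligible_simple:
  fixes t :: "real ^ 'd \<Rightarrow> 'e::banach"
  assumes p: "1 < p" and t: "simple_function lebesgue t" "(\<integral>\<^sup>+x. norm (t x) powr p \<partial>lebesgue) < \<infinity>"
  shows "haar_negligible p i t"
proof -
  have p0: "0 < p" using p by simp
  have fin: "finite (range t)" using t(1) by (simp add: simple_function_def)
  have B: "t -` {v} \<in> sets lebesgue" for v using simple_functionD(2)[OF t(1), of "{v}"] by simp
  have small: "emeasure lebesgue (t -` {v}) < \<infinity>" if v: "v \<noteq> 0" for v
  proof -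
    have "ennreal (norm v powr p) * emeasure lebesgue (t -` {v}) = (\<integral>\<^sup>+x. norm (indicat_real (t -` {v}) x *\<^sub>R v) powr p \<partial>lebesgue)"
      by (rule nn_integral_indicator_powr[OF B p0, symmetric])
    also have "\<dots> \<le> (\<integral>\<^sup>+x. norm (t x) powr p \<partial>lebesgue)"
      using p0 by (intro nn_integral_mono ennreal_leI) (auto simp: indicator_def)
    also have "\<dots> < \<infinity>" by (rule t(2))
    finally show ?thesis using v by (auto simp: ennreal_mult_less_top)
  qed
  have eq: "t = (\<lambda>x. \<Sum>v\<in>range t - {0}. indicat_real (t -` {v}) x *\<^sub>R v)"
  proof
    fix x
    have "(\<Sum>v\<in>range t - {0}. indicat_real (t -` {v}) x *\<^sub>R v) = (\<Sum>v\<in>range t - {0}. if v = t x then t x else 0)"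
      by (intro sum.cong) (auto simp: indicator_def)
    also have "\<dots> = t x" using fin by (simp add: sum.delta)
    finally show "t x = (\<Sum>v\<in>range t - {0}. indicat_real (t -` {v}) x *\<^sub>R v)" by simp
  qed
  have "haar_negligible p i (\<lambda>x. \<Sum>v\<in>range t - {0}. indicat_real (t -` {v}) x *\<^sub>R v)"
    using p fin by (intro haar_negligible_sum haar_negligible_set B small) auto
  then show ?thesis by (rule back_subst[of "haar_negligible p i", OF _ eq[symmetric]])
qed

lemma haar_negligible_Lp:
  fixes f :: "real ^ 'd \<Rightarrow> 'e::banach"
  assumes p: "1 < p" and f: "in_Lp lebesgue p f"
  shows "haar_negligible p i f"
proof (rule haar_negligible_perturb[OF _ f])
  show "1 \<le> p" using p by simp
  have p0: "0 < p" using p by simp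
  fix \<delta> :: real assume \<delta>: "0 < \<delta>"
  have f': "strongly_measurable lebesgue f" "(\<integral>\<^sup>+x. norm (f x) powr p \<partial>lebesgue) < \<infinity>"
    using f by (auto simp: in_Lp_def)
  obtain t where t: "\<And>n. simple_function lebesgue (t n)" "\<And>n. (\<integral>\<^sup>+x. norm (t n x) powr p \<partial>lebesgue) < \<infinity>"
    "(\<lambda>n. \<integral>\<^sup>+x. norm (f x - t n x) powr p \<partial>lebesgue) \<longlonglongrightarrow> 0"
    by (rule simple_function_approx_Lp[OF f' p0, of thesis]) (rule that)
  have "\<forall>\<^sub>F n in sequentially. (\<integral>\<^sup>+x. norm (f x - t n x) powr p \<partial>lebesgue) < ennreal \<delta>"
    using \<delta> by (intro order_tendstoD(2)[OF t(3)]) simp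
  then obtain n where "(\<integral>\<^sup>+x. norm (f x - t n x) powr p \<partial>lebesgue) < ennreal \<delta>" by (auto simp: eventually_sequentially)
  then show "\<exists>g. haar_negligible p i g \<and> (\<integral>\<^sup>+x. norm (f x - g x) powr p \<partial>lebesgue) \<le> ennreal \<delta>"
    using haar_negligible_simple[OF p t(1,2)] by (intro exI[of _ "t n"]) auto
qed

end

section \<open>Attainment of the least constants\<close>

text \<open>For each martingale the inequality is linear in the constant, so it survives the passage
  to the infimum. Dividing by the norm on the right requires the separate case where that norm is
  0.\<close>

lemma UMD_bound_UMD_const:
  assumes "UMD TYPE('e::banach) p"
  shows "UMD_bound TYPE('e) p (UMD_const TYPE('e) p)"
proof -
  let ?S = "{\<beta>. UMD_bound TYPE('e) p \<beta>}"
  have ne: "?S \<noteq> {}" using assms by (auto simp: UMD_def)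
  have Inf: "x \<le> UMD_const TYPE('e) p * c" if c: "0 \<le> c" and x: "\<And>\<beta>. \<beta> \<in> ?S \<Longrightarrow> x \<le> \<beta> * c" for x c
  proof (cases "c = 0")
    case True
    obtain \<beta> where "\<beta> \<in> ?S" using ne by blast
    with x[OF this] True show ?thesis by simp
  next
    case False
    with c have c: "0 < c" by simp
    have "x / c \<le> UMD_const TYPE('e) p"
      unfolding UMD_const_def by (rule cInf_greatest[OF ne]) (use x c in \<open>simp add: pos_divide_le_eq\<close>)
    then show ?thesis using c by (simp add: pos_divide_le_eq)
  qed
  have "0 \<le> UMD_const TYPE('e) p"
    unfolding UMD_const_def by (rule cInf_greatest[OF ne]) (auto simp: UMD_bound_def)
  moreover have "Lp_norm M p (\<lambda>\<omega>. \<Sum>n=1..N. \<epsilon> n *\<^sub>R d n \<omega>) \<le> UMD_const TYPE('e) p * Lp_norm M p (\<lambda>\<omega>. \<Sum>n=1..N. d n \<omega>)"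
    if "prob_space M" "martingale_differences M p F N d" "\<forall>n\<in>{1..N}. \<epsilon> n \<in> {-1, 1}"
    for M :: "(nat \<Rightarrow> real) measure" and F N and d :: "nat \<Rightarrow> (nat \<Rightarrow> real) \<Rightarrow> 'e" and \<epsilon> :: "nat \<Rightarrow> real"
    by (rule Inf) (use that in \<open>auto simp: UMD_bound_def Lp_norm_def\<close>)
  ultimately show ?thesis unfolding UMD_bound_def by blast
qed

lemma R_bound_mono: "R_bound p \<T> C \<Longrightarrow> C \<le> C' \<Longrightarrow> R_bound p \<T> C'"
  unfolding R_bound_def by (meson order_trans mult_right_mono powr_ge_zero)

lemma R_bound_R_const:
  assumes "R_bounded p (\<T> :: ('e::banach \<Rightarrow>\<^sub>L 'e) set)"
  shows "R_bound p \<T> (R_const p \<T>)"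
proof -
  let ?S = "{C. R_bound p \<T> C}"
  have ne: "?S \<noteq> {}" using assms by (auto simp: R_bounded_def)
  have Inf: "x \<le> R_const p \<T> * c" if c: "0 \<le> c" and x: "\<And>C. C \<in> ?S \<Longrightarrow> x \<le> C * c" for x c
  proof (cases "c = 0")
    case True
    obtain C where "C \<in> ?S" using ne by blast
    with x[OF this] True show ?thesis by simp
  next
    case False
    with c have c: "0 < c" by simp
    have "x / c \<le> R_const p \<T>"
      unfolding R_const_def by (rule cInf_greatest[OF ne]) (use x c in \<open>simp add: pos_divide_le_eq\<close>)
    then show ?thesis using c by (simp add: pos_divide_le_eq)
  qed
  have "0 \<le> R_const p \<T>"
    unfolding R_const_def by (rule cInf_greatest[OF ne]) (auto simp: R_bound_def)
  then show ?thesis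
    unfolding R_bound_def
  proof (intro conjI allI impI)
    fix N and T :: "nat \<Rightarrow> 'e \<Rightarrow>\<^sub>L 'e" and e :: "nat \<Rightarrow> 'e"
    assume T: "\<forall>n\<in>{1..N}. T n \<in> \<T>"
    show "measure_pmf.expectation (random_signs N) (\<lambda>\<epsilon>. norm (\<Sum>n=1..N. \<epsilon> n *\<^sub>R T n (e n)) powr p) powr (1 / p)
      \<le> R_const p \<T> * measure_pmf.expectation (random_signs N) (\<lambda>\<epsilon>. norm (\<Sum>n=1..N. \<epsilon> n *\<^sub>R e n) powr p) powr (1 / p)"
    proof (rule Inf[OF powr_ge_zero])
      fix C assume "C \<in> ?S"
      then have "R_bound p \<T> C" by (rule CollectD)
      from this[unfolded R_bound_def, THEN conjunct2, rule_format, OF bspec[OF T]]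
      show "measure_pmf.expectation (random_signs N) (\<lambda>\<epsilon>. norm (\<Sum>n=1..N. \<epsilon> n *\<^sub>R T n (e n)) powr p) powr (1 / p)
        \<le> C * measure_pmf.expectation (random_signs N) (\<lambda>\<epsilon>. norm (\<Sum>n=1..N. \<epsilon> n *\<^sub>R e n) powr p) powr (1 / p)" .
    qed
  qed
qed

theorem theorem1p2:
  fixes p :: real and i j :: nat
    and \<D> :: "(real ^ 'd) set set"
    and a :: "(real ^ 'd) set \<Rightarrow> real ^ 'd \<Rightarrow> real ^ 'd \<Rightarrow> 'e::banach \<Rightarrow>\<^sub>L 'e"
    and Ra :: real
    and f :: "real ^ 'd \<Rightarrow> 'e"
  assumes "1 < p"
    and "UMD TYPE('e) p"
    and "dyadic_system \<D>"
    and "\<And>K. K \<in> \<D> \<Longrightarrow> strongly_measurable_kernel (a K)"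
    and "R_bounded p (kernel_values \<D> a)"
    and "R_const p (kernel_values \<D> a) \<le> Ra"
    and "in_Lp lebesgue p f"
  shows "\<exists>Sf. is_dyadic_shift_image \<D> p i j a f Sf \<and>
           Lp_norm lebesgue p Sf
             \<le> 4 * (real (max i j) + 1) * Ra * (UMD_const TYPE('e) p)\<^sup>2 * Lp_norm lebesgue p f"
proof -
  obtain G :: "int \<Rightarrow> (real ^ 'd) set set" where G: "\<D> = (\<Union>k. G k) \<and> (\<forall>k. partition_on UNIV (G k)) \<and>
      (\<forall>k. \<forall>Q\<in>G k. \<exists>a. Q = half_open_cube a (2 powi (- k))) \<and> (\<forall>k. \<forall>Q\<in>G (k + 1). \<exists>P\<in>G k. Q \<subseteq> P)"
    using assms(3)[unfolded dyadic_system_def] by (rule exE)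
  have \<D>: "\<D> = (\<Union>k. G k)" by (rule G[THEN conjunct1])
  interpret dyadic_levels G
    by (rule dyadic_levels.intro)
      (erule G[THEN conjunct2, THEN conjunct1, THEN spec] G[THEN conjunct2, THEN conjunct2, THEN conjunct1, THEN spec, THEN bspec]
        G[THEN conjunct2, THEN conjunct2, THEN conjunct2, THEN spec, THEN bspec] | rule G[THEN conjunct2, THEN conjunct1, THEN spec])+
  define \<beta> m where "\<beta> = UMD_const TYPE('e) p" and "m = max i j + 1"
  have p: "1 \<le> p" "0 < p" using assms(1) by auto
  have umd: "UMD_bound TYPE('e) p \<beta>" unfolding \<beta>_def by (rule UMD_bound_UMD_const[OF assms(2)])
  \<comment> \<open>Monotonicity passes from the least constant to the given upper bound
    \<open>Ra\<close>.\<close>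
  have R: "R_bound p (kernel_values (\<Union>k. G k) a) Ra"
    using R_bound_mono[OF R_bound_R_const[OF assms(5)] assms(6)] unfolding \<D> .
  have R0: "0 \<le> Ra" using R by (simp add: R_bound_def)
  have ker: "strongly_measurable_kernel (a K)" if "K \<in> G k" for k K
    using assms(4) that unfolding \<D> by blast
  have ij: "i < m" "j < m" by (auto simp: m_def)
  define c I where "c = 4 * real m * Ra * \<beta>\<^sup>2" and "I = (\<integral>\<^sup>+x. norm (f x) powr p \<partial>lebesgue)"
  have c: "0 \<le> c" using R0 by (simp add: c_def)
  have I: "I < \<infinity>" using assms(7) by (simp add: I_def in_Lp_def)
  note bound = shift_sum_bound[OF umd p(1) ker R ij, folded c_def]
  obtain S where S: "has_Lp_sum lebesgue p (shift_term a i j f) S (\<Union>k. G k)"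
    "(\<integral>\<^sup>+x. norm (S x) powr p \<partial>lebesgue) \<le> ennreal (c powr p) * I"
  proof (rule has_Lp_sum_of_small_tails[OF p(1), of "\<Union>k. G k" lebesgue "shift_term a i j f" "ennreal (c powr p) * I"])
    show "simple_function lebesgue (shift_term a i j f K)" if "K \<in> (\<Union>k. G k)" for K
      using that by (auto simp: shift_term_def intro: simple_function_haar_proj_level)
    show "(\<integral>\<^sup>+x. norm (\<Sum>K\<in>F. shift_term a i j f K x) powr p \<partial>lebesgue) \<le> ennreal (c powr p) * I"
      if "finite F" "F \<subseteq> (\<Union>k. G k)" for F
      unfolding I_def by (rule bound[OF _ assms(7) that])
    show "ennreal (c powr p) * I < \<infinity>" using I by (simp add: ennreal_mult_less_top)
    show "\<exists>F0. finite F0 \<and> F0 \<subseteq> (\<Union>k. G k) \<and> (\<forall>F. finite F \<longrightarrow> F \<subseteq> (\<Union>k. G k) \<longrightarrow> F \<inter> F0 = {} \<longrightarrow>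
        (\<integral>\<^sup>+x. norm (\<Sum>K\<in>F. shift_term a i j f K x) powr p \<partial>lebesgue) \<le> ennreal \<delta>)" if \<delta>: "0 < \<delta>" for \<delta>
    proof -
      \<comment> \<open>The uniform bound multiplies the norm of the small substitute by
        \<open>c powr p\<close>, which leaves at most \<delta>; adding 1 avoids division by
        0.\<close>
      have c1: "0 < c powr p + 1" by (simp add: add_nonneg_pos)
      then have "0 < \<delta> / (c powr p + 1)" using \<delta> by simp
      from haar_negligibleD[OF haar_negligible_Lp[OF assms(1,7)] this]
      obtain r F0 where r: "in_Lp lebesgue p r" "(\<integral>\<^sup>+x. norm (r x) powr p \<partial>lebesgue) \<le> ennreal (\<delta> / (c powr p + 1))"
        and F0: "haar_agree i F0 f r" by blast
      have "(\<integral>\<^sup>+x. norm (\<Sum>K\<in>F. shift_term a i j f K x) powr p \<partial>lebesgue) \<le> ennreal \<delta>"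
        if F: "finite F" "F \<subseteq> (\<Union>k. G k)" "F \<inter> F0 = {}" for F
      proof -
        \<comment> \<open>Off \<open>F0\<close> the summands see \<open>f\<close> only through
          projections shared with r, so the tail for \<open>f\<close> is a finite sum for r.\<close>
        have "shift_term a i j f K = shift_term a i j r K" if "K \<in> F" for K
        proof -
          have "haar_proj_level (\<Union>k. G k) i K f = haar_proj_level (\<Union>k. G k) i K r"
            using that F by (intro ext haar_agreeD[OF F0]) blast
          then show ?thesis by (simp add: shift_term_def)
        qed
        then have "(\<integral>\<^sup>+x. norm (\<Sum>K\<in>F. shift_term a i j f K x) powr p \<partial>lebesgue)
          = (\<integral>\<^sup>+x. norm (\<Sum>K\<in>F. shift_term a i j r K x) powr p \<partial>lebesgue)" by simp
        also have "\<dots> \<le> ennreal (c powr p) * (\<integral>\<^sup>+x. norm (r x) powr p \<partial>lebesgue)"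
          by (rule bound[OF _ r(1) F(1,2)])
        also have "\<dots> \<le> ennreal (c powr p) * ennreal (\<delta> / (c powr p + 1))"
          by (intro mult_left_mono r) simp
        also have "\<dots> \<le> ennreal \<delta>"
          using \<delta> c1 by (simp add: ennreal_leI divide_simps flip: ennreal_mult')
        finally show ?thesis .
      qed
      then show ?thesis using F0 by (intro exI[of _ F0]) (simp add: haar_agree_def)
    qed
  qed
  have "is_dyadic_shift_image \<D> p i j a f S"
    using S(1) unfolding is_dyadic_shift_image_def \<D> shift_term_def .
  moreover have "Lp_norm lebesgue p S \<le> c * Lp_norm lebesgue p f"
  proof -
    have "enn2real (\<integral>\<^sup>+x. norm (S x) powr p \<partial>lebesgue) \<le> enn2real (ennreal (c powr p) * I)"
      using S(2) I by (intro enn2real_mono) (auto simp: ennreal_mult_less_top)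
    also have "\<dots> = c powr p * enn2real I" by (simp add: enn2real_mult)
    finally have "Lp_norm lebesgue p S \<le> (c powr p * enn2real I) powr (1 / p)"
      unfolding Lp_norm_def using p by (intro powr_mono2) auto
    also have "\<dots> = c * enn2real I powr (1 / p)"
      using c p by (subst powr_mult) (auto simp: powr_powr)
    finally show ?thesis by (simp add: Lp_norm_def I_def)
  qed
  ultimately show ?thesis
    unfolding c_def \<beta>_def m_def by (intro exI[of _ S]) (simp add: add.commute)
qed

end
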